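(* Let $T$ be the $(d_0,d_1)$-semiregular tree with $d_0,d_1\geq 4$, let $i$ be a legal coloring of $T$, and let $Y_0,Y_1$ be (possibly empty) finite subsets of $\mathbf{Z}_{\geq 0}$. Then: (i) $G_{(i)}^+(Y_0,Y_1)$ belongs to $\mathcal{H}_T^+$. (ii) $G_{(i)}^+(Y_0,Y_1)$ is abstractly simple. (iii) The quotient $N_{\mathrm{Aut}(T)^+}(G_{(i)}^+(Y_0,Y_1))/G_{(i)}^+(Y_0,Y_1)$ is isomorphic to $(\mathbf{C}_2)^k$, where $k=|\{t\in\{0,1\} : Y_t\neq\varnothing\}|$. Moreover, if $d_0=d_1$ and $Y_0=Y_1=:Y$ with $Y\neq\varnothing$, then $N_{\mathrm{Aut}(T)}(G_{(i)}^+(Y,Y))/G_{(i)}^+(Y,Y)\cong \mathbf{D}_8$.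
   Context: The $(d_0,d_1)$-semiregular tree $T$ is the tree whose vertex set has a bipartition $V(T)=V_0(T)\sqcup V_1(T)$ such that every edge joins $V_0(T)$ to $V_1(T)$ and each vertex of type $t$ (i.e. in $V_t(T)$) is incident to exactly $d_t$ edges. $\mathrm{Aut}(T)$ carries the topology of pointwise convergence on vertices; $\mathrm{Aut}(T)^+$ is the subgroup of automorphisms preserving $V_0(T)$ and $V_1(T)$. $\partial T$ is the set of ends of $T$. $\mathcal{H}_T$ is the set of closed subgroups of $\mathrm{Aut}(T)$ that are $2$-transitive on $\partial T$, and $\mathcal{H}_T^+=\{H\in\mathcal{H}_T : H\leq \mathrm{Aut}(T)^+\}$. $S(v,r)$ is the set of vertices at distance exactly $r$ from $v$. A legal coloring $i$ of $T$ is a map on $V(T)$ given by $i_0\colon V_0(T)\to\{1,\dots,d_1\}$ and $i_1\colon V_1(T)\to\{1,\dots,d_0\}$ such that for each $v\in V_1(T)$ the restriction $i_0|_{S(v,1)}$ is a bijection onto $\{1,\dots,d_1\}$, and for each $v\in V_0(T)$ the restriction $i_1|_{S(v,1)}$ is a bijection onto $\{1,\dots,d_0\}$. For $g\in\mathrm{Aut}(T)$ and $v\in V(T)$ put $\sigma_{(i)}(g,v)=i|_{S(g(v),1)}\circ g\circ i|_{S(v,1)}^{-1}$, a permutation in $\mathrm{Sym}(d_t)$ where $t$ is the type of $v$. For $Y\subseteq\mathbf{Z}_{\geq0}$ put $S_Y(v)=\bigcup_{r\in Y}S(v,r)$. With $\max(\varnothing):=0$, $t_0:=(\max Y_0)\bmod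 2$ and $t_1:=(1+\max Y_1)\bmod 2$, the group $G_{(i)}^+(Y_0,Y_1)$ consists of all $g\in\mathrm{Aut}(T)^+$ such that $\prod_{w\in S_{Y_0}(v)}\mathrm{sgn}(\sigma_{(i)}(g,w))=1$ for each $v\in V_{t_0}(T)$ and $\prod_{w\in S_{Y_1}(v)}\mathrm{sgn}(\sigma_{(i)}(g,w))=1$ for each $v\in V_{t_1}(T)$. $N_G(H)$ is the normalizer of $H$ in $G$; $\mathbf{C}_2$ is the cyclic group of order $2$ and $\mathbf{D}_8$ the dihedral group of order $8$. *)

theory Defs
  imports
    "HOL-Analysis.Function_Topology"
    "HOL-Algebra.Algebra"
    "HOL-Combinatorics.Permutations"
begin

subsection \<open>Semiregular trees\<close>

text \<open>A graph is a symmetric edge relation \<^term>\<open>E\<close>; its vertex set is the whole vertex type.\<close>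

definition is_cycle :: "('v \<times> 'v) set \<Rightarrow> 'v list \<Rightarrow> bool" where
  "is_cycle E p \<longleftrightarrow> 3 \<le> length p \<and> distinct p
     \<and> successively (\<lambda>u v. (u, v) \<in> E) p \<and> (last p, hd p) \<in> E"

definition is_tree :: "('v \<times> 'v) set \<Rightarrow> bool" where
  "is_tree E \<longleftrightarrow> sym E \<and> irrefl E \<and> (\<forall>u v. (u, v) \<in> E\<^sup>*) \<and> (\<nexists>p. is_cycle E p)"

text \<open>The families \<^term>\<open>V\<close> and \<^term>\<open>d\<close> are indexed by the types 0 and 1; their values at
  other indices play no role.\<close>

locale semiregular_tree =
  fixes E :: "('v \<times> 'v) set" and V :: "nat \<Rightarrow> 'v set" and d :: "nat \<Rightarrow> nat"
  assumes tree: "is_tree E"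
    and types_cover: "V 0 \<union> V 1 = UNIV"
    and types_disjoint: "V 0 \<inter> V 1 = {}"
    and edge_types: "(u, v) \<in> E \<Longrightarrow> u \<in> V 0 \<and> v \<in> V 1 \<or> u \<in> V 1 \<and> v \<in> V 0"
    and degree: "t \<in> {0, 1} \<Longrightarrow> v \<in> V t \<Longrightarrow> finite (E `` {v}) \<and> card (E `` {v}) = d t"

definition gdist :: "('v \<times> 'v) set \<Rightarrow> 'v \<Rightarrow> 'v \<Rightarrow> nat" where
  "gdist E u v = (LEAST n. (u, v) \<in> E ^^ n)"

definition gsphere :: "('v \<times> 'v) set \<Rightarrow> 'v \<Rightarrow> nat \<Rightarrow> 'v set" where
  "gsphere E v r = {w. gdist E v w = r}"

definition gspheres :: "('v \<times> 'v) set \<Rightarrow> nat set \<Rightarrow> 'v \<Rightarrow> 'v set" where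
  "gspheres E Y v = (\<Union>r\<in>Y. gsphere E v r)"


subsection \<open>Automorphisms\<close>

definition Aut :: "('v \<times> 'v) set \<Rightarrow> ('v \<Rightarrow> 'v) set" where
  "Aut E = {g. bij g \<and> (\<forall>u v. (g u, g v) \<in> E \<longleftrightarrow> (u, v) \<in> E)}"

definition Aut_plus :: "('v \<times> 'v) set \<Rightarrow> (nat \<Rightarrow> 'v set) \<Rightarrow> ('v \<Rightarrow> 'v) set" where
  "Aut_plus E V = {g \<in> Aut E. g ` V 0 = V 0 \<and> g ` V 1 = V 1}"

definition comp_group :: "('v \<Rightarrow> 'v) set \<Rightarrow> ('v \<Rightarrow> 'v) monoid" where
  "comp_group A = \<lparr>carrier = A, monoid.mult = (\<circ>), one = id\<rparr>"

definition Aut_topology :: "('v \<times> 'v) set \<Rightarrow> ('v \<Rightarrow> 'v) topology" where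
  "Aut_topology E = subtopology (product_topology (\<lambda>_. discrete_topology UNIV) UNIV) (Aut E)"


subsection \<open>Ends and boundary 2-transitivity\<close>

definition rays :: "('v \<times> 'v) set \<Rightarrow> (nat \<Rightarrow> 'v) set" where
  "rays E = {\<rho>. inj \<rho> \<and> (\<forall>n. (\<rho> n, \<rho> (Suc n)) \<in> E)}"

text \<open>In a tree, two rays define the same end iff they have a common subray.\<close>

definition cofinal :: "('v \<times> 'v) set \<Rightarrow> ((nat \<Rightarrow> 'v) \<times> (nat \<Rightarrow> 'v)) set" where
  "cofinal E = {(\<rho>, \<rho>') \<in> rays E \<times> rays E. \<exists>m n. \<forall>k. \<rho> (m + k) = \<rho>' (n + k)}"

definition ends :: "('v \<times> 'v) set \<Rightarrow> (nat \<Rightarrow> 'v) set set" where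
  "ends E = rays E // cofinal E"

definition end_act :: "('v \<Rightarrow> 'v) \<Rightarrow> (nat \<Rightarrow> 'v) set \<Rightarrow> (nat \<Rightarrow> 'v) set" where
  "end_act g \<xi> = (\<lambda>\<rho>. g \<circ> \<rho>) ` \<xi>"

definition two_transitive_on_ends :: "('v \<times> 'v) set \<Rightarrow> ('v \<Rightarrow> 'v) set \<Rightarrow> bool" where
  "two_transitive_on_ends E H \<longleftrightarrow>
     (\<forall>\<xi>\<^sub>1\<in>ends E. \<forall>\<xi>\<^sub>2\<in>ends E. \<forall>\<eta>\<^sub>1\<in>ends E. \<forall>\<eta>\<^sub>2\<in>ends E. \<xi>\<^sub>1 \<noteq> \<xi>\<^sub>2 \<longrightarrow> \<eta>\<^sub>1 \<noteq> \<eta>\<^sub>2 \<longrightarrow>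
       (\<exists>h\<in>H. end_act h \<xi>\<^sub>1 = \<eta>\<^sub>1 \<and> end_act h \<xi>\<^sub>2 = \<eta>\<^sub>2))"

definition HT :: "('v \<times> 'v) set \<Rightarrow> ('v \<Rightarrow> 'v) set set" where
  "HT E = {H. subgroup H (comp_group (Aut E)) \<and> closedin (Aut_topology E) H
              \<and> two_transitive_on_ends E H}"

definition HT_plus :: "('v \<times> 'v) set \<Rightarrow> (nat \<Rightarrow> 'v set) \<Rightarrow> ('v \<Rightarrow> 'v) set set" where
  "HT_plus E V = {H \<in> HT E. H \<subseteq> Aut_plus E V}"


subsection \<open>Legal colorings and the groups they define\<close>

definition legal_coloring ::
  "('v \<times> 'v) set \<Rightarrow> (nat \<Rightarrow> 'v set) \<Rightarrow> (nat \<Rightarrow> nat) \<Rightarrow> ('v \<Rightarrow> nat) \<Rightarrow> bool" where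
  "legal_coloring E V d i \<longleftrightarrow>
     i ` V 0 \<subseteq> {1..d 1} \<and> i ` V 1 \<subseteq> {1..d 0} \<and>
     (\<forall>v\<in>V 1. bij_betw i (gsphere E v 1) {1..d 1}) \<and>
     (\<forall>v\<in>V 0. bij_betw i (gsphere E v 1) {1..d 0})"

text \<open>For a legal coloring, \<^term>\<open>i ` gsphere E v 1\<close> is \<open>{1..d t}\<close>, where \<open>t\<close> is the type of
  \<^term>\<open>v\<close>. The local permutation is extended by the identity to all of \<^typ>\<open>nat\<close>, as required
  by \<^const>\<open>sign\<close>.\<close>

definition local_perm ::
  "('v \<times> 'v) set \<Rightarrow> ('v \<Rightarrow> nat) \<Rightarrow> ('v \<Rightarrow> 'v) \<Rightarrow> 'v \<Rightarrow> nat \<Rightarrow> nat" where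
  "local_perm E i g v =
     restrict_id (i \<circ> g \<circ> inv_into (gsphere E v 1) i) (i ` gsphere E v 1)"

definition max0 :: "nat set \<Rightarrow> nat" where
  "max0 Y = (if Y = {} then 0 else Max Y)"

definition G_plus ::
  "('v \<times> 'v) set \<Rightarrow> (nat \<Rightarrow> 'v set) \<Rightarrow> ('v \<Rightarrow> nat) \<Rightarrow> nat set \<Rightarrow> nat set \<Rightarrow> ('v \<Rightarrow> 'v) set" where
  "G_plus E V i Y0 Y1 =
     {g \<in> Aut_plus E V.
        (\<forall>v\<in>V (max0 Y0 mod 2). (\<Prod>w\<in>gspheres E Y0 v. sign (local_perm E i g w)) = 1) \<and>
        (\<forall>v\<in>V ((1 + max0 Y1) mod 2). (\<Prod>w\<in>gspheres E Y1 v. sign (local_perm E i g w)) = 1)}"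


subsection \<open>Group theory\<close>

text \<open>The library locale \<^locale>\<open>simple_group\<close> demands \<open>order G > 1\<close>, which excludes infinite groups
  because the cardinality of an infinite set is 0.\<close>

definition abstractly_simple :: "('a, 'b) monoid_scheme \<Rightarrow> bool" where
  "abstractly_simple G \<longleftrightarrow> group G \<and> carrier G \<noteq> {\<one>\<^bsub>G\<^esub>}
     \<and> (\<forall>N. N \<lhd> G \<longrightarrow> N = {\<one>\<^bsub>G\<^esub>} \<or> N = carrier G)"

definition dihedral_group :: "nat \<Rightarrow> (int \<times> bool) monoid" where
  \<comment> \<open>\<open>\<int>/n \<rtimes> \<int>/2\<close>, of order \<open>2n\<close>: \<open>(a, s)\<close> is the rotation by \<open>a\<close>, preceded by a
    reflection if \<open>s\<close>\<close>
  "dihedral_group n = \<lparr>carrier = {0..<int n} \<times> UNIV,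
     monoid.mult = (\<lambda>(a, s) (b, t). ((a + (if s then - b else b)) mod int n, s \<noteq> t)),
     one = (0, False)\<rparr>"

lemma group_dihedral_group:
  assumes "n > 0" shows "group (dihedral_group n)"
proof (rule groupI)
  fix x assume "x \<in> carrier (dihedral_group n)"
  then obtain a s where x: "x = (a, s)" and a: "a \<in> {0..<int n}"
    by (auto simp: dihedral_group_def)
  show "\<exists>y\<in>carrier (dihedral_group n). y \<otimes>\<^bsub>dihedral_group n\<^esub> x = \<one>\<^bsub>dihedral_group n\<^esub>"
    using a assms
    by (intro bexI[of _ "(if s then a else (- a) mod int n, s)"])
       (auto simp: dihedral_group_def x mod_simps)
qed (use assms in \<open>auto simp: dihedral_group_def mod_simps algebra_simps\<close>)

lemma order_dihedral_group: "order (dihedral_group n) = 2 * n"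
  by (simp add: order_def dihedral_group_def card_cartesian_product)

lemma group_comp_group_Aut: "group (comp_group (Aut E))"
proof (rule groupI)
  fix g assume "g \<in> carrier (comp_group (Aut E))"
  then have g: "bij g" "\<And>u v. (g u, g v) \<in> E \<longleftrightarrow> (u, v) \<in> E"
    by (auto simp: comp_group_def Aut_def)
  have "inv_into UNIV g \<in> Aut E"
    using g(1) g(2)[of "inv_into UNIV g _" "inv_into UNIV g _"]
    by (auto simp: Aut_def bij_imp_bij_inv bij_is_surj surj_f_inv_f)
  then show "\<exists>h\<in>carrier (comp_group (Aut E)). h \<otimes>\<^bsub>comp_group (Aut E)\<^esub> g = \<one>\<^bsub>comp_group (Aut E)\<^esub>"
    using g(1) by (auto simp: comp_group_def bij_is_inj inv_o_cancel intro!: bexI[of _ "inv_into UNIV g"])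
qed (auto simp: comp_group_def Aut_def bij_comp o_assoc)

end

(*
A vertex v gets the sign of the local permutation of g at v. These signs form a cocycle, and the
group is cut out by the condition that the product of the signs over each sphere configuration
around a center is 1. Two existence principles carry the proof. First, since all degrees are at
least 4, a partial automorphism on a subtree extends with arbitrarily prescribed signs wherever
two neighbours are still free. Secondly, the sign equations are triangular with respect to the
distance from a base vertex, so they can be solved with arbitrary right-hand sides and with
prescribed values near two far apart half-trees.

Prescribing all signs to be 1 along a bi-infinite line gives 2-transitivity on the ends. For
simplicity, a nontrivial normal subgroup N contains some h mapping a half-tree properly into
itself; every group element supported in a half-tree that h translates to disjoint copies is a
commutator with h, hence lies in N. Gluing along far apart half-trees shows that vertex stabilizers
are products of such elements. Finally, an automorphism normalizes the group iff its products of
signs depend only on the type of the center, and the values of these products give the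
quotient.
*)
theory Submission
  imports Defs
begin

subsection \<open>Trees\<close>

context semiregular_tree
begin

text \<open>A vertex on a line has two neighbours on it; swapping two further neighbours flips its
  sign without moving the line, hence the bound 4 on the degrees. The obstacle is that each equation
  couples many vertices, so outside special cases signs cannot be chosen one vertex at a time. The
  types of the centers are set so that the outermost sphere of an equation of family
  \<open>t\<close> has type \<open>t\<close>. Hence equations of different families never compete
  for the same unknown, and within one family an outermost vertex determines its center as its
  ancestor at a fixed height. When gluing, an equation close to a chosen half-tree already holds
  because it sees only the local behaviour of the given element or of the identity; every other
  equation is solved at a vertex reached by walking away from both half-trees. The commutator
  construction involves an infinite product; it stays in the group because every condition looks at
  finitely many vertices only. In the last part the two families give one function on all vertices,
  and a type-exchanging automorphism interchanges its values on the two types. The quotient is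
  therefore the wreath product of two groups of order 2, which is \<open>D_8\<close>.\<close>

abbreviation S :: "'v \<Rightarrow> 'v set" where "S v \<equiv> E `` {v}"

abbreviation \<delta> :: "'v \<Rightarrow> 'v \<Rightarrow> nat" where "\<delta> \<equiv> gdist E"

definition ty :: "'v \<Rightarrow> nat" where "ty v = (if v \<in> V 0 then 0 else 1)"

lemma sym_E: "(u, v) \<in> E \<Longrightarrow> (v, u) \<in> E"
  using tree by (auto simp: is_tree_def sym_def)

lemma V_iff_ty: "t \<in> {0, 1} \<Longrightarrow> v \<in> V t \<longleftrightarrow> ty v = t"
  using types_cover types_disjoint by (auto simp: ty_def)

lemma ty_01: "ty v \<in> {0, 1}"
  by (simp add: ty_def)

lemma ty_edge: "(u, v) \<in> E \<Longrightarrow> ty u + ty v = 1"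
  using edge_types[of u v] types_disjoint by (auto simp: ty_def)

lemma finite_S: "finite (S v)" and card_S: "card (S v) = d (ty v)"
  using degree[OF ty_01, of v v] V_iff_ty[OF ty_01, of v] by auto

section \<open>Distance, parity and edges\<close>

lemma rel_power_\<delta>: "(u, v) \<in> E ^^ \<delta> u v"
proof -
  have "(u, v) \<in> E\<^sup>*" using tree by (simp add: is_tree_def)
  then obtain n where "(u, v) \<in> E ^^ n" by (auto simp: rtrancl_power)
  then show ?thesis unfolding gdist_def by (rule LeastI)
qed

lemma \<delta>_le: "(u, v) \<in> E ^^ n \<Longrightarrow> \<delta> u v \<le> n"
  unfolding gdist_def by (rule Least_le)

lemma \<delta>_self [simp]: "\<delta> u u = 0"
  using \<delta>_le[of u u 0] by simp

lemma \<delta>_0_iff [simp]: "\<delta> u v = 0 \<longleftrightarrow> u = v"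
proof
  assume "\<delta> u v = 0" then show "u = v" using rel_power_\<delta>[of u v] by simp
qed simp

lemma \<delta>_sym: "\<delta> u v = \<delta> v u"
proof -
  have "(v, u) \<in> E ^^ n" if "(u, v) \<in> E ^^ n" for u v n
    using that
  proof (induction n arbitrary: v)
    case (Suc n)
    then obtain w where "(u, w) \<in> E ^^ n" "(w, v) \<in> E" by auto
    then have "(v, w) \<in> E" "(w, u) \<in> E ^^ n" using Suc.IH sym_E by auto
    then show ?case by (rule relpow_Suc_I2)
  qed simp
  then show ?thesis using rel_power_\<delta> \<delta>_le by (meson order_antisym)
qed

lemma \<delta>_triangle: "\<delta> u w \<le> \<delta> u v + \<delta> v w"
proof -
  have "(u, w) \<in> E ^^ \<delta> u v O E ^^ \<delta> v w" using rel_power_\<delta> by auto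
  then show ?thesis using \<delta>_le by (simp add: relpow_add)
qed

lemma even_\<delta>_iff: "even (\<delta> u v) \<longleftrightarrow> ty u = ty v"
proof -
  have "even n \<longleftrightarrow> ty u = ty v" if "(u, v) \<in> E ^^ n" for u v n
    using that
  proof (induction n arbitrary: v)
    case 0 then show ?case by simp
  next
    case (Suc n)
    then obtain w where w: "(u, w) \<in> E ^^ n" "(w, v) \<in> E" by auto
    then have "ty w + ty v = 1" "even n \<longleftrightarrow> ty u = ty w" using Suc.IH ty_edge by auto
    then show ?case using ty_01[of u] ty_01[of v] ty_01[of w] by auto
  qed
  from this[OF rel_power_\<delta>] show ?thesis .
qed

lemma edge_iff_\<delta>: "(u, v) \<in> E \<longleftrightarrow> \<delta> u v = 1"
proof
  assume e: "(u, v) \<in> E"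
  then have "\<delta> u v \<le> 1" using \<delta>_le[of u v 1] by simp
  moreover have "u \<noteq> v"
  proof
    assume "u = v" then have "ty v + ty v = 1" using ty_edge[OF e] by simp
    then show False by presburger
  qed
  ultimately show "\<delta> u v = 1" by (metis \<delta>_0_iff le_neq_implies_less less_one)
next
  assume "\<delta> u v = 1" then show "(u, v) \<in> E" using rel_power_\<delta>[of u v] by simp
qed

lemma not_edge_refl [simp]: "(u, u) \<notin> E"
  by (simp add: edge_iff_\<delta>)

lemma gsphere_1: "gsphere E v 1 = S v"
  by (auto simp: gsphere_def edge_iff_\<delta>)

lemma \<delta>_step: assumes "(v, w) \<in> E" shows "\<delta> p w = \<delta> p v + 1 \<or> \<delta> p v = \<delta> p w + 1"
proof -
  have "\<delta> v w = 1" using assms by (simp add: edge_iff_\<delta>)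
  moreover have "\<delta> w v = 1" using sym_E[OF assms] by (simp add: edge_iff_\<delta>)
  ultimately have "\<delta> p w \<le> \<delta> p v + 1" "\<delta> p v \<le> \<delta> p w + 1"
    using \<delta>_triangle[of p w v] \<delta>_triangle[of p v w] by linarith+
  moreover
  have "even (\<delta> p w) \<noteq> even (\<delta> p v)"
    using ty_edge[OF assms] ty_01[of v] ty_01[of w] ty_01[of p] by (auto simp: even_\<delta>_iff)
  then have "\<delta> p w \<noteq> \<delta> p v" by auto
  ultimately show ?thesis by linarith
qed

lemma parent_ex: assumes "v \<noteq> p" shows "\<exists>u. (u, v) \<in> E \<and> \<delta> p v = \<delta> p u + 1"
proof -
  obtain n where n: "\<delta> p v = Suc n" using assms by (metis \<delta>_0_iff not0_implies_Suc)
  with rel_power_\<delta>[of p v] obtain u where u: "(p, u) \<in> E ^^ n" "(u, v) \<in> E" by auto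
  have "\<delta> p u \<le> n" by (rule \<delta>_le[OF u(1)])
  then show ?thesis using \<delta>_step[OF u(2), of p] n u by auto
qed

text \<open>Climb from both vertices to their parents until these coincide. Closing the path with a
  vertex one level further out gives a cycle, so acyclicity yields uniqueness of parents in
  \<open>parent_unique\<close>.\<close>

lemma sphere_path:
  assumes "a \<noteq> b" "\<delta> p a = n" "\<delta> p b = n"
  shows "\<exists>xs. 3 \<le> length xs \<and> distinct xs \<and> successively (\<lambda>u v. (u, v) \<in> E) xs
    \<and> hd xs = a \<and> last xs = b \<and> (\<forall>x\<in>set xs. \<delta> p x \<le> n)"
  using assms
proof (induction n arbitrary: a b)
  case 0
  then show ?case by auto
next
  case (Suc n)
  then have "a \<noteq> p" "b \<noteq> p" by auto
  then obtain a' b' where "(a', a) \<in> E" "\<delta> p a = \<delta> p a' + 1" "(b', b) \<in> E" "\<delta> p b = \<delta> p b' + 1"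
    using parent_ex[of a p] parent_ex[of b p] by blast
  then have ab: "(a', a) \<in> E" "\<delta> p a' = n" "(b', b) \<in> E" "\<delta> p b' = n"
    using Suc.prems by linarith+
  show ?case
  proof (cases "a' = b'")
    case True
    then have "a' \<noteq> a" "a' \<noteq> b" using ab Suc.prems by auto
    then show ?thesis
      using True ab Suc.prems sym_E by (intro exI[of _ "[a, a', b]"]) auto
  next
    case False
    then obtain xs where xs: "3 \<le> length xs" "distinct xs" "successively (\<lambda>u v. (u, v) \<in> E) xs"
      "hd xs = a'" "last xs = b'" "\<forall>x\<in>set xs. \<delta> p x \<le> n"
      using Suc.IH[of a' b'] ab by blast
    have "a \<notin> set xs" "b \<notin> set xs" "xs \<noteq> []" using xs Suc.prems by auto
    then show ?thesis using xs ab Suc.prems sym_E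
      by (intro exI[of _ "a # xs @ [b]"])
         (auto simp: successively_append_iff successively_Cons le_SucI)
  qed
qed

lemma parent_unique:
  assumes "(u, v) \<in> E" "(u', v) \<in> E" "\<delta> p v = \<delta> p u + 1" "\<delta> p v = \<delta> p u' + 1"
  shows "u = u'"
proof (rule ccontr)
  assume "u \<noteq> u'"
  then obtain xs where xs: "3 \<le> length xs" "distinct xs" "successively (\<lambda>u v. (u, v) \<in> E) xs"
      "hd xs = u" "last xs = u'" "\<forall>x\<in>set xs. \<delta> p x \<le> \<delta> p u"
    using sphere_path[of u u' p "\<delta> p u"] assms by auto
  then have "v \<notin> set xs" "xs \<noteq> []" using assms by auto
  then have "is_cycle E (xs @ [v])"
    using xs assms sym_E by (auto simp: is_cycle_def successively_append_iff)
  then show False using tree by (auto simp: is_tree_def)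
qed

section \<open>Parents, half-trees and ancestors as seen from a root\<close>

definition par :: "'v \<Rightarrow> 'v \<Rightarrow> 'v" where
  "par p v = (THE u. (u, v) \<in> E \<and> \<delta> p v = \<delta> p u + 1)"

lemma par_eqI: "(u, v) \<in> E \<Longrightarrow> \<delta> p v = \<delta> p u + 1 \<Longrightarrow> par p v = u"
  unfolding par_def using parent_unique by blast

lemma par: assumes "v \<noteq> p" shows "(par p v, v) \<in> E" "\<delta> p v = \<delta> p (par p v) + 1"
  using parent_ex[OF assms] par_eqI by auto

lemma edge_cases:
  assumes "(v, w) \<in> E"
  shows "w \<noteq> p \<and> v = par p w \<and> \<delta> p w = \<delta> p v + 1 \<or> v \<noteq> p \<and> w = par p v \<and> \<delta> p v = \<delta> p w + 1"
  using \<delta>_step[OF assms, of p] par_eqI[OF assms, of p] par_eqI[OF sym_E[OF assms], of p] by auto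

text \<open>For adjacent \<^term>\<open>x\<close> and \<^term>\<open>y\<close>, this is the half-tree containing \<^term>\<open>x\<close> that is
  obtained by removing the edge between them.\<close>

definition branch :: "'v \<Rightarrow> 'v \<Rightarrow> 'v set" where
  "branch y x = {z. \<delta> x z < \<delta> y z}"

lemma branch_compl: assumes "(x, y) \<in> E" shows "z \<in> branch y x \<longleftrightarrow> z \<notin> branch x y"
  using \<delta>_step[OF assms, of z] by (auto simp: branch_def \<delta>_sym[of z])

lemma branch_D: assumes "(x, y) \<in> E" "z \<in> branch y x" shows "\<delta> y z = \<delta> x z + 1"
  using \<delta>_step[OF assms(1), of z] assms(2) by (auto simp: branch_def \<delta>_sym[of z])

lemma branch_self: "(x, y) \<in> E \<Longrightarrow> x \<in> branch y x" "y \<notin> branch y x"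
  by (auto simp: branch_def edge_iff_\<delta> \<delta>_sym)

text \<open>If the distance from \<open>w\<close> dropped on the step from \<open>z'\<close> to
  \<open>z\<close>, then \<open>z'\<close> would have two parents as seen from \<open>w\<close>: the
  vertex \<open>z\<close> and the next vertex towards \<open>x\<close> (or \<open>y\<close>, if
  \<open>z' = x\<close>). Uniqueness of parents rules this out.\<close>

lemma edge_separates:
  assumes "(x, y) \<in> E" "z \<in> branch y x" "w \<notin> branch y x"
  shows "\<delta> w z = \<delta> w y + 1 + \<delta> x z"
  using assms(2)
proof (induction "\<delta> x z" arbitrary: z rule: less_induct)
  case (less z)
  have w: "\<delta> w x = \<delta> w y + 1"
    using branch_D[OF sym_E[OF assms(1)], of w] assms branch_compl[OF assms(1), of w] \<delta>_sym by metis
  show ?case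
  proof (cases "z = x")
    case True then show ?thesis using w by simp
  next
    case zx: False
    define z' where "z' = par x z"
    have z': "(z', z) \<in> E" "\<delta> x z = \<delta> x z' + 1" using par[OF zx] by (simp_all add: z'_def)
    have "\<delta> y z = \<delta> x z + 1" using branch_D[OF assms(1) less.prems] .
    then have "z' \<in> branch y x" using \<delta>_step[OF z'(1), of y] z'(2) by (auto simp: branch_def)
    then have IH: "\<delta> w z' = \<delta> w y + 1 + \<delta> x z'" using less.hyps z'(2) by simp
    have "\<delta> w z = \<delta> w z' + 1"
    proof (rule ccontr)
      assume "\<delta> w z \<noteq> \<delta> w z' + 1"
      then have b: "\<delta> w z' = \<delta> w z + 1" using \<delta>_step[OF z'(1), of w] by auto
      show False
      proof (cases "z' = x")
        case True
        then have "z = y"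
          using parent_unique[OF sym_E[OF z'(1)], of y w] b w sym_E[OF assms(1)] by auto
        then show False using less.prems by (simp add: branch_self)
      next
        case False
        have p: "(par x z', z') \<in> E" "\<delta> x z' = \<delta> x (par x z') + 1" using par[OF False] by auto
        have "\<delta> y z' = \<delta> x z' + 1" using branch_D[OF assms(1) \<open>z' \<in> branch y x\<close>] .
        then have "par x z' \<in> branch y x"
          using \<delta>_step[OF p(1), of y] p(2) by (auto simp: branch_def)
        then have "\<delta> w (par x z') = \<delta> w y + 1 + \<delta> x (par x z')"
          using less.hyps z'(2) p by simp
        then have "z = par x z'"
          using parent_unique[OF sym_E[OF z'(1)] p(1), of w] b IH p by auto
        then show False using z'(2) p(2) by simp
      qed
    qed
    then show ?thesis using IH z'(2) by simp
  qed
qed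

lemma branch_disjoint: assumes "(x, y) \<in> E" "(x', y) \<in> E" "x \<noteq> x'"
  shows "branch y x \<inter> branch y x' = {}"
proof (rule ccontr)
  assume "branch y x \<inter> branch y x' \<noteq> {}"
  then obtain z where z: "z \<in> branch y x" "z \<in> branch y x'" by auto
  then show False
    using parent_unique[OF assms(1,2), of z] branch_D[OF assms(1) z(1)] branch_D[OF assms(2) z(2)] assms(3)
    by (simp add: \<delta>_sym)
qed

lemma branch_cover: assumes "z \<noteq> y" shows "\<exists>x. (x, y) \<in> E \<and> z \<in> branch y x"
  using parent_ex[of y z] assms by (auto simp: branch_def \<delta>_sym)

lemma branch_par: "v \<noteq> p \<Longrightarrow> p \<notin> branch (par p v) v"
  using par(2)[of v p] by (auto simp: branch_def \<delta>_sym)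

text \<open>With \<open>branch_rootI\<close>, this identifies the half-tree beyond \<open>v\<close>
  with the descendants of \<open>v\<close> in the tree rooted at \<open>p\<close>.\<close>

lemma \<delta>_branch_root: assumes "v \<noteq> p" "z \<in> branch (par p v) v" shows "\<delta> p z = \<delta> p v + \<delta> v z"
  using edge_separates[OF sym_E[OF par(1)[OF assms(1)]] assms(2) branch_par[OF assms(1)]]
    par(2)[OF assms(1)] by simp

lemma branch_rootI: assumes "v \<noteq> p" "\<delta> p z = \<delta> p v + \<delta> v z" shows "z \<in> branch (par p v) v"
  using \<delta>_triangle[of p z "par p v"] par(2)[OF assms(1)] assms(2) by (auto simp: branch_def)

lemma ty_eqI: "(ty c = ty a \<longleftrightarrow> ty c = ty b) \<Longrightarrow> ty a = ty b"
  using ty_01[of a] ty_01[of b] ty_01[of c] by auto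

text \<open>The distance equation encodes that \<open>u\<close> is an ancestor of \<open>x\<close>
  for the root \<open>p\<close>. The parent of \<open>x\<close> towards \<open>u\<close> is then
  also its parent towards \<open>p\<close>, which permits inductions along the geodesic from
  \<open>u\<close> to \<open>x\<close>.\<close>

lemma par_ancestor:
  assumes "u \<noteq> x" "\<delta> p x = \<delta> p u + \<delta> u x"
  shows "\<delta> u x = Suc (\<delta> u (par p x))" "\<delta> p (par p x) = \<delta> p u + \<delta> u (par p x)"
proof -
  have pu: "(par u x, x) \<in> E" "\<delta> u x = \<delta> u (par u x) + 1" using par[of x u] assms(1) by auto
  then have "\<delta> p (par u x) \<le> \<delta> p u + \<delta> u (par u x)" using \<delta>_triangle[of p "par u x" u] by simp
  then have "\<delta> p x = \<delta> p (par u x) + 1" using \<delta>_step[OF pu(1), of p] pu(2) assms(2) by auto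
  moreover from this have "par p x = par u x" by (rule par_eqI[OF pu(1)])
  ultimately show "\<delta> u x = Suc (\<delta> u (par p x))" "\<delta> p (par p x) = \<delta> p u + \<delta> u (par p x)"
    using pu(2) assms(2) by simp_all
qed

text \<open>Climbing \<open>n\<close> levels from \<open>x\<close> leaves no choice. In
  \<open>solve_signs\<close> this recovers the center of an equation from the vertex at which it is
  solved.\<close>

lemma ancestor_unique:
  assumes "\<delta> v x = n" "\<delta> v' x = n" "\<delta> p x = \<delta> p v + n" "\<delta> p x = \<delta> p v' + n"
  shows "v = v'"
  using assms
proof (induction n arbitrary: x)
  case 0
  then have "v = x" "v' = x" using \<delta>_0_iff by blast+
  then show ?case by simp
next
  case (Suc n)
  have k: "\<delta> u (par p x) = n \<and> \<delta> p (par p x) = \<delta> p u + n"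
    if u: "\<delta> u x = Suc n" "\<delta> p x = \<delta> p u + Suc n" for u
  proof -
    have "u \<noteq> x" using u(1) by auto
    then show ?thesis using par_ancestor[of u x p] u by simp
  qed
  show ?case
    by (rule Suc.IH[of "par p x"]) (use k[of v] k[of v'] Suc.prems in blast)+
qed

lemma closed_ancestor:
  assumes closed: "\<And>v. v \<in> U \<Longrightarrow> v \<noteq> p \<Longrightarrow> par p v \<in> U"
    and "z \<in> U" "\<delta> p z = \<delta> p y + \<delta> y z"
  shows "y \<in> U"
  using assms(2,3)
proof (induction "\<delta> y z" arbitrary: z)
  case 0
  then show ?case by simp
next
  case (Suc n)
  have yz: "y \<noteq> z" using Suc.hyps(2) by auto
  have "\<delta> p z > 0" using Suc.hyps(2) Suc.prems(2) by linarith
  then have "z \<noteq> p" by auto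
  then have "par p z \<in> U" by (rule closed[OF Suc.prems(1)])
  moreover have "n = \<delta> y (par p z)" using par_ancestor(1)[OF yz Suc.prems(2)] Suc.hyps(2) by simp
  ultimately show ?case using Suc.hyps(1) par_ancestor(2)[OF yz Suc.prems(2)] by blast
qed

lemma branch_nest:
  assumes "(x, y) \<in> E" "(y, z) \<in> E" "x \<noteq> z" shows "branch y z \<subseteq> branch x y"
  using branch_disjoint[OF assms(1) sym_E[OF assms(2)] assms(3)] branch_compl[OF assms(1)] by blast

lemma finite_ball: "finite {w. \<delta> v w \<le> n}"
proof (induction n)
  case 0 then show ?case by simp
next
  case (Suc n)
  have "w \<in> (\<Union>u\<in>{w. \<delta> v w \<le> n}. S u)" if "\<delta> v w \<le> Suc n" "w \<noteq> v" for w
    using par[of w v] that by force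
  then have "{w. \<delta> v w \<le> Suc n} \<subseteq> insert v (\<Union>u\<in>{w. \<delta> v w \<le> n}. S u)" by blast
  then show ?case using Suc finite_S by (meson finite_UN_I finite_insert finite_subset)
qed

subsection \<open>Automorphisms\<close>

text \<open>A covering map cannot fold a geodesic. At \<open>u\<close>, the only neighbour of
  \<open>g u\<close> closer to \<open>g p\<close> is the image of the parent of \<open>u\<close>,
  and local injectivity keeps \<open>g v\<close> away from it.\<close>

lemma local_iso_\<delta>:
  assumes "\<And>v. bij_betw g (S v) (S (g v))"
  shows "\<delta> (g p) (g v) = \<delta> p v"
proof (induction "\<delta> p v" arbitrary: v rule: less_induct)
  case (less v)
  have edge: "(g x, g y) \<in> E" if "(x, y) \<in> E" for x y
    using bij_betwE[OF assms[of x]] that by auto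
  show ?case
  proof (cases "v = p")
    case False
    define u where "u = par p v"
    have u: "(u, v) \<in> E" "\<delta> p v = \<delta> p u + 1" using par[OF False] by (simp_all add: u_def)
    then have gu: "\<delta> (g p) (g u) = \<delta> p u" using less by simp
    show ?thesis
    proof (cases "u = p")
      case True
      then have "\<delta> p v = 1" using u(2) by simp
      moreover have "\<delta> (g p) (g v) = 1" using edge[OF u(1)] True by (simp add: edge_iff_\<delta>)
      ultimately show ?thesis by simp
    next
      case False
      define t where "t = par p u"
      have t: "(t, u) \<in> E" "\<delta> p u = \<delta> p t + 1" using par[OF False] by (simp_all add: t_def)
      then have gt: "\<delta> (g p) (g t) = \<delta> p t" using less u by simp
      have "v \<noteq> t" using u t by auto
      then have "g v \<noteq> g t"
        using bij_betw_imp_inj_on[OF assms[of u]] u(1) sym_E[OF t(1)] by (auto simp: inj_on_def)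
      then have "\<not> \<delta> (g p) (g u) = \<delta> (g p) (g v) + 1"
        using parent_unique[OF sym_E[OF edge[OF u(1)]] edge[OF t(1)], of "g p"] gu gt t(2) by auto
      then show ?thesis using \<delta>_step[OF edge[OF u(1)], of "g p"] gu u(2) by auto
    qed
  qed simp
qed

text \<open>Injectivity comes from preservation of distances, surjectivity from connectedness, as
  the range is closed under passing to neighbours. Maps built vertex by vertex or as pointwise
  limits are recognised as automorphisms in this way.\<close>

lemma local_iso_Aut:
  assumes "\<And>v. bij_betw g (S v) (S (g v))"
  shows "g \<in> Aut E"
proof -
  note iso = local_iso_\<delta>[OF assms]
  have inj: "inj g" using iso by (metis \<delta>_0_iff injI)
  have r: "w \<in> range g" for w
  proof -
    have "(g undefined, w) \<in> E\<^sup>*" using tree by (simp add: is_tree_def)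
    then show "w \<in> range g"
    proof (induction rule: rtrancl_induct)
      case (step v u)
      then show ?case using bij_betw_imp_surj_on[OF assms] by blast
    qed simp
  qed
  have "surj g" by (rule UNIV_eq_I[symmetric], rule r)
  with inj have "bij g" unfolding bij_def ..
  then show ?thesis using iso by (simp add: Aut_def edge_iff_\<delta>)
qed

lemma Aut_local_iso: assumes "g \<in> Aut E" shows "bij_betw g (S v) (S (g v))"
proof -
  have g: "bij g" "\<And>u v. (g u, g v) \<in> E \<longleftrightarrow> (u, v) \<in> E" using assms by (auto simp: Aut_def)
  have "g ` S v = S (g v)"
  proof
    show "S (g v) \<subseteq> g ` S v"
    proof
      fix y assume "y \<in> S (g v)"
      moreover obtain x where "y = g x" using g(1) by (metis bij_pointE)
      ultimately show "y \<in> g ` S v" using g(2) by auto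
    qed
  qed (use g(2) in auto)
  then show ?thesis using g(1) by (metis bij_betw_imageI bij_is_inj inj_on_subset subset_UNIV)
qed

lemma Aut_\<delta>: "g \<in> Aut E \<Longrightarrow> \<delta> (g u) (g v) = \<delta> u v"
  by (rule local_iso_\<delta>[OF Aut_local_iso])

lemma id_Aut: "id \<in> Aut E"
  by (simp add: Aut_def)

lemma comp_Aut: "g \<in> Aut E \<Longrightarrow> h \<in> Aut E \<Longrightarrow> g \<circ> h \<in> Aut E"
  by (auto simp: Aut_def bij_comp)

lemma inv_Aut:
  assumes "g \<in> Aut E"
  shows "inv_into UNIV g \<in> Aut E" "g (inv_into UNIV g x) = x" "inv_into UNIV g (g x) = x"
    "g \<circ> inv_into UNIV g = id" "inv_into UNIV g \<circ> g = id"
proof -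
  have b: "bij g" and e: "\<And>u v. (g u, g v) \<in> E \<longleftrightarrow> (u, v) \<in> E" using assms by (auto simp: Aut_def)
  show 1: "g (inv_into UNIV g x) = x" "inv_into UNIV g (g x) = x" for x
    using b by (simp_all add: bij_is_surj surj_f_inv_f bij_is_inj)
  then show "g \<circ> inv_into UNIV g = id" "inv_into UNIV g \<circ> g = id" by auto
  show "inv_into UNIV g \<in> Aut E"
    using b e[of "inv_into UNIV g _" "inv_into UNIV g _"] by (simp add: Aut_def bij_imp_bij_inv 1)
qed

lemma Aut_same_type: assumes "g \<in> Aut E" shows "ty (g u) = ty (g v) \<longleftrightarrow> ty u = ty v"
  using even_\<delta>_iff[of "g u" "g v"] even_\<delta>_iff[of u v] Aut_\<delta>[OF assms] by simp

lemma type_preserving: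
  assumes "g \<in> Aut E" "ty (g p) = ty p" shows "ty (g v) = ty v"
proof (rule ty_eqI)
  have "even (\<delta> (g p) (g v)) \<longleftrightarrow> even (\<delta> p v)" by (simp add: Aut_\<delta>[OF assms(1)])
  then show "ty p = ty (g v) \<longleftrightarrow> ty p = ty v" unfolding even_\<delta>_iff assms(2) .
qed

lemma Aut_plus_iff: "g \<in> Aut_plus E V \<longleftrightarrow> g \<in> Aut E \<and> (\<forall>v. ty (g v) = ty v)"
proof (cases "g \<in> Aut E")
  case True
  have V: "V 0 = {v. ty v = 0}" "V 1 = {v. ty v = 1}"
    using V_iff_ty[of 0] V_iff_ty[of 1] by auto
  have "surj g" using True by (auto simp: Aut_def bij_def)
  then have "g ` {v. ty v = 0} = {v. ty v = 0} \<and> g ` {v. ty v = 1} = {v. ty v = 1}"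
    if "\<forall>v. ty (g v) = ty v"
    using that by (auto simp: image_iff) (metis surjD)+
  moreover have "ty (g v) = ty v"
    if "g ` {v. ty v = 0} = {v. ty v = 0}" "g ` {v. ty v = 1} = {v. ty v = 1}" for v
    using that ty_01[of v] imageI[of v "{v. ty v = 0}" g] imageI[of v "{v. ty v = 1}" g]
    by (auto simp del: image_eqI)
  ultimately show ?thesis using True unfolding Aut_plus_def V mem_Collect_eq
    by (metis (mono_tags, lifting))
qed (simp add: Aut_plus_def)

lemma Aut_branch: assumes "g \<in> Aut E" shows "g z \<in> branch (g y) (g x) \<longleftrightarrow> z \<in> branch y x"
  by (simp add: branch_def Aut_\<delta>[OF assms])

section \<open>Groups of automorphisms under composition\<close>

lemma mult_comp_group [simp]: "x \<otimes>\<^bsub>comp_group A\<^esub> y = x \<circ> y" "carrier (comp_group A) = A"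
  "\<one>\<^bsub>comp_group A\<^esub> = id"
  by (simp_all add: comp_group_def)

lemma inv_comp_Aut: "a \<in> Aut E \<Longrightarrow> inv\<^bsub>comp_group (Aut E)\<^esub> a = inv_into UNIV a"
  by (rule group.inv_equality[OF group_comp_group_Aut]) (simp_all add: inv_Aut)

lemma subgroup_AutI:
  assumes "A \<subseteq> Aut E" "id \<in> A" "\<And>a b. a \<in> A \<Longrightarrow> b \<in> A \<Longrightarrow> a \<circ> b \<in> A" "\<And>a. a \<in> A \<Longrightarrow> inv_into UNIV a \<in> A"
  shows "subgroup A (comp_group (Aut E))"
proof
  show "inv\<^bsub>comp_group (Aut E)\<^esub> a \<in> A" if "a \<in> A" for a
    using inv_comp_Aut[of a] assms(1,4) that by auto
qed (use assms in auto)

lemma group_comp_group: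
  assumes "subgroup A (comp_group (Aut E))"
  shows "group (comp_group A)" "a \<in> A \<Longrightarrow> inv\<^bsub>comp_group A\<^esub> a = inv_into UNIV a"
proof -
  have eq: "comp_group (Aut E)\<lparr>carrier := A\<rparr> = comp_group A" by (simp add: comp_group_def)
  show "group (comp_group A)"
    using subgroup.subgroup_is_group[OF assms group_comp_group_Aut] unfolding eq .
  show "inv\<^bsub>comp_group A\<^esub> a = inv_into UNIV a" if "a \<in> A"
    using group.m_inv_consistent[OF group_comp_group_Aut assms that] inv_comp_Aut[of a]
      subgroup.subset[OF assms] that unfolding eq by auto
qed

lemma subgroup_Aut: "subgroup (Aut E) (comp_group (Aut E))"
  using group.subgroup_self[OF group_comp_group_Aut[of E]] by simp

lemma subgroup_Aut_plus: "subgroup (Aut_plus E V) (comp_group (Aut E))"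
proof (rule subgroup_AutI)
  show "inv_into UNIV a \<in> Aut_plus E V" if a: "a \<in> Aut_plus E V" for a
  proof -
    have A: "a \<in> Aut E" "\<And>v. ty (a v) = ty v" using a by (auto simp: Aut_plus_iff)
    have "ty (inv_into UNIV a v) = ty v" for v
      using A(2)[of "inv_into UNIV a v"] inv_Aut(2)[OF A(1)] by simp
    then show ?thesis using inv_Aut(1)[OF A(1)] by (simp add: Aut_plus_iff)
  qed
qed (auto simp: Aut_plus_iff id_Aut comp_Aut)

subsection \<open>Rays and ends\<close>

text \<open>Being injective, a ray never steps back to the unique neighbour closer to its
  origin.\<close>

lemma ray_\<delta>: assumes "\<rho> \<in> rays E" shows "\<delta> (\<rho> 0) (\<rho> n) = n"
proof (induction n rule: less_induct)
  case (less n)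
  have e: "(\<rho> k, \<rho> (Suc k)) \<in> E" for k using assms by (simp add: rays_def)
  have inj: "inj \<rho>" using assms by (simp add: rays_def)
  show ?case
  proof (cases n)
    case (Suc k)
    then have k: "\<delta> (\<rho> 0) (\<rho> k) = k" using less by simp
    show ?thesis
    proof (cases k)
      case 0 then show ?thesis using e[of 0] Suc by (simp add: edge_iff_\<delta>)
    next
      case (Suc j)
      then have j: "\<delta> (\<rho> 0) (\<rho> j) = j" using less \<open>n = Suc k\<close> by simp
      have "\<rho> j \<noteq> \<rho> n" using inj Suc \<open>n = Suc k\<close> by (simp add: inj_eq)
      then have "\<delta> (\<rho> 0) (\<rho> k) \<noteq> \<delta> (\<rho> 0) (\<rho> n) + 1"
        using parent_unique[of "\<rho> j" "\<rho> k" "\<rho> n"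
          "\<rho> 0"] e[of j] sym_E[OF e[of k]] j k Suc \<open>n = Suc k\<close> by auto
      then show ?thesis using \<delta>_step[OF e[of k], of "\<rho> 0"] k \<open>n = Suc k\<close> by auto
    qed
  qed simp
qed

lemma ray_par: assumes "\<rho> \<in> rays E" shows "par (\<rho> 0) (\<rho> (Suc n)) = \<rho> n"
  using assms by (intro par_eqI) (simp_all add: rays_def ray_\<delta>[OF assms])

lemma ray_tail: "\<rho> \<in> rays E \<Longrightarrow> (\<lambda>n. \<rho> (n + k)) \<in> rays E"
  by (simp add: rays_def inj_def) (metis add_right_cancel)

lemma ray_cons:
  assumes \<rho>: "\<rho> \<in> rays E" and x: "(x, \<rho> 0) \<in> E" "x \<noteq> \<rho> 1"
  shows "case_nat x \<rho> \<in> rays E"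
proof -
  have "\<rho> n \<noteq> x" for n
  proof
    assume n: "\<rho> n = x"
    then have "n = 1" using x(1) ray_\<delta>[OF \<rho>, of n] \<delta>_sym[of x] by (simp add: edge_iff_\<delta>)
    then show False using n x(2) by simp
  qed
  then have "inj (case_nat x \<rho>)" using \<rho> by (auto simp: rays_def inj_on_def split: nat.splits)
  moreover have "(case_nat x \<rho> n, case_nat x \<rho> (Suc n)) \<in> E" for n
    using \<rho> x(1) by (cases n) (auto simp: rays_def)
  ultimately show ?thesis by (simp add: rays_def)
qed

lemma cofinalI:
  "\<rho> \<in> rays E \<Longrightarrow> \<rho>' \<in> rays E \<Longrightarrow> (\<And>k. \<rho> (a + k) = \<rho>' (b + k)) \<Longrightarrow> (\<rho>, \<rho>') \<in> cofinal E"
  unfolding cofinal_def by blast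

lemma equiv_cofinal: "equiv (rays E) (cofinal E)"
proof (rule equivI)
  show "cofinal E \<subseteq> rays E \<times> rays E" by (auto simp: cofinal_def)
  show "refl_on (rays E) (cofinal E)" by (auto simp: refl_on_def cofinal_def)
  show "sym (cofinal E)" unfolding cofinal_def sym_def by (auto, metis)
  show "trans (cofinal E)"
  proof (rule transI)
    fix \<rho> \<rho>' \<rho>'' assume a: "(\<rho>, \<rho>') \<in> cofinal E" "(\<rho>', \<rho>'') \<in> cofinal E"
    obtain m n where 1: "\<And>k. \<rho> (m + k) = \<rho>' (n + k)" using a(1) by (auto simp: cofinal_def)
    obtain m' n' where 2: "\<And>k. \<rho>' (m' + k) = \<rho>'' (n' + k)" using a(2) by (auto simp: cofinal_def)
    have "\<rho> (m + m' + k) = \<rho>'' (n' + n + k)" for k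
      using 1[of "m' + k"] 2[of "n + k"] by (simp add: ac_simps)
    then show "(\<rho>, \<rho>'') \<in> cofinal E" using a unfolding cofinal_def by blast
  qed
qed

lemma endsD: "\<xi> \<in> ends E \<Longrightarrow> \<rho> \<in> \<xi> \<Longrightarrow> \<rho> \<in> rays E"
  and ends_eq: "\<xi> \<in> ends E \<Longrightarrow> \<rho> \<in> \<xi> \<Longrightarrow> \<xi> = cofinal E `` {\<rho>}"
  unfolding ends_def using in_quotient_imp_subset[OF equiv_cofinal]
  by (blast, metis Image_singleton_iff equiv_class_eq_iff[OF equiv_cofinal] quotientE)

lemma tail_in_end: assumes "\<xi> \<in> ends E" "\<rho> \<in> \<xi>" shows "(\<lambda>n. \<rho> (n + k)) \<in> \<xi>"
proof -
  have "(\<rho>, \<lambda>n. \<rho> (n + k)) \<in> cofinal E"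
    using endsD[OF assms] ray_tail[OF endsD[OF assms]]
    by (rule cofinalI[of _ _ k 0]) (simp add: add.commute)
  then show ?thesis using ends_eq[OF assms] by auto
qed

lemma cons_in_end:
  assumes "\<xi> \<in> ends E" "\<rho> \<in> \<xi>" "(x, \<rho> 0) \<in> E" "x \<noteq> \<rho> 1" shows "case_nat x \<rho> \<in> \<xi>"
proof -
  have "(\<rho>, case_nat x \<rho>) \<in> cofinal E"
    using endsD[OF assms(1,2)] ray_cons[OF endsD[OF assms(1,2)] assms(3,4)]
    by (rule cofinalI[of _ _ 0 1]) simp
  then show ?thesis using ends_eq[OF assms(1,2)] by auto
qed

lemma ray_from: assumes "\<xi> \<in> ends E" shows "\<exists>\<rho>\<in>\<xi>. \<rho> 0 = p"
proof -
  obtain \<rho>0 where \<rho>0: "\<rho>0 \<in> \<xi>"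
    using assms in_quotient_imp_non_empty[OF equiv_cofinal] unfolding ends_def by blast
  have "(\<rho>0 0, p) \<in> E\<^sup>*" using tree by (simp add: is_tree_def)
  then show ?thesis
  proof (induction rule: rtrancl_induct)
    case base then show ?case using \<rho>0 by blast
  next
    case (step x y)
    then obtain \<rho> where \<rho>: "\<rho> \<in> \<xi>" "\<rho> 0 = x" by blast
    show ?case
    proof (cases "y = \<rho> 1")
      case True then show ?thesis using tail_in_end[OF assms \<rho>(1), of 1] by force
    next
      case False
      then have "case_nat y \<rho> \<in> \<xi>"
        using cons_in_end[OF assms \<rho>(1), of y] sym_E[OF step(2)] \<rho>(2) by simp
      then show ?thesis by (rule bexI[rotated]) simp
    qed
  qed
qed

text \<open>Two rays from a common origin are cut off just before the first index at which they
  differ; the tails form a bi-infinite line.\<close>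

lemma rays_between:
  assumes "\<xi>1 \<in> ends E" "\<xi>2 \<in> ends E" "\<xi>1 \<noteq> \<xi>2"
  shows "\<exists>\<rho>1\<in>\<xi>1. \<exists>\<rho>2\<in>\<xi>2. \<rho>1 0 = \<rho>2 0 \<and> \<rho>1 1 \<noteq> \<rho>2 1"
proof -
  obtain \<rho>1 \<rho>2 where \<rho>: "\<rho>1 \<in> \<xi>1" "\<rho>2 \<in> \<xi>2" "\<rho>1 0 = \<rho>2 0"
    using ray_from[OF assms(1)] ray_from[OF assms(2)] by metis
  have "\<rho>1 \<noteq> \<rho>2"
  proof
    assume "\<rho>1 = \<rho>2"
    then have "\<xi>1 = \<xi>2" using ends_eq[OF assms(1) \<rho>(1)] ends_eq[OF assms(2) \<rho>(2)] by simp
    then show False using assms(3) by simp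
  qed
  then obtain k where "\<rho>1 k \<noteq> \<rho>2 k" by auto
  define n where "n = (LEAST k. \<rho>1 k \<noteq> \<rho>2 k)"
  have n: "\<rho>1 n \<noteq> \<rho>2 n" unfolding n_def by (rule LeastI) fact
  then have "n \<noteq> 0" using \<rho>(3) by metis
  then obtain j where j: "n = Suc j" using not0_implies_Suc by blast
  have "\<rho>1 j = \<rho>2 j" using not_less_Least[of j "\<lambda>k. \<rho>1 k \<noteq> \<rho>2 k"] j by (simp add: n_def)
  then show ?thesis
    using tail_in_end[OF assms(1) \<rho>(1), of j] tail_in_end[OF assms(2) \<rho>(2), of j] n j
    by (intro bexI[of _ "\<lambda>n. \<rho>1 (n + j)"] bexI[of _ "\<lambda>n. \<rho>2 (n + j)"]) simp_all
qed

text \<open>A type-preserving element can match two lines only if their base points have the same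
  type. Moving the base point one step along the first ray changes its type.\<close>

lemma rays_between_typed:
  assumes "\<xi>1 \<in> ends E" "\<xi>2 \<in> ends E" "\<xi>1 \<noteq> \<xi>2" and t: "t \<in> {0, 1}"
  shows "\<exists>\<rho>1\<in>\<xi>1. \<exists>\<rho>2\<in>\<xi>2. \<rho>1 0 = \<rho>2 0 \<and> \<rho>1 1 \<noteq> \<rho>2 1 \<and> ty (\<rho>1 0) = t"
proof -
  obtain \<rho>1 \<rho>2 where \<rho>: "\<rho>1 \<in> \<xi>1" "\<rho>2 \<in> \<xi>2" "\<rho>1 0 = \<rho>2 0" "\<rho>1 1 \<noteq> \<rho>2 1"
    using rays_between[OF assms(1-3)] by blast
  show ?thesis
  proof (cases "ty (\<rho>1 0) = t")
    case True then show ?thesis using \<rho> by blast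
  next
    case False
    have ray: "\<rho>1 \<in> rays E" using endsD[OF assms(1) \<rho>(1)] .
    then have e: "(\<rho>1 0, \<rho>1 1) \<in> E" by (auto simp: rays_def)
    then have "ty (\<rho>1 1) = t" using ty_edge[OF e] False t ty_01[of "\<rho>1 0"] by auto
    moreover have "\<rho>1 (1 + 1) \<noteq> \<rho>1 0" using ray by (auto simp: rays_def inj_eq)
    moreover have "case_nat (\<rho>1 1) \<rho>2 \<in> \<xi>2"
      using cons_in_end[OF assms(2) \<rho>(2), of "\<rho>1 1"] sym_E[OF e] \<rho>(3,4) by simp
    ultimately show ?thesis using \<rho>(3) tail_in_end[OF assms(1) \<rho>(1), of 1]
      by (intro bexI[of _ "\<lambda>n. \<rho>1 (n + 1)"] bexI[of _ "case_nat (\<rho>1 1) \<rho>2"]) simp_all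
  qed
qed

lemma rays_meet:
  assumes "\<rho>1 \<in> rays E" "\<rho>2 \<in> rays E" "\<rho>1 0 = \<rho>2 0" "\<rho>1 1 \<noteq> \<rho>2 1" "\<rho>1 a = \<rho>2 b"
  shows "a = 0 \<and> b = 0"
proof -
  have ab: "a = b" using ray_\<delta>[OF assms(1), of a] ray_\<delta>[OF assms(2), of b] assms(3,5) by simp
  have "n = 0" if "\<rho>1 n = \<rho>2 n" for n
    using that
  proof (induction n)
    case (Suc n)
    have "\<rho>1 n = \<rho>2 n"
      using ray_par[OF assms(1), of n] ray_par[OF assms(2), of n] Suc.prems assms(3) by simp
    then have "n = 0" by (rule Suc.IH)
    then show ?case using Suc.prems assms(4) by simp
  qed simp
  then show ?thesis using ab assms(5) by blast
qed

text \<open>One ray decides the image of an end because automorphisms preserve cofinality; the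
  inverse of \<open>g\<close> supplies the inclusion of \<eta> in the image.\<close>

lemma end_act_eq:
  assumes g: "g \<in> Aut E" and \<xi>: "\<xi> \<in> ends E" "\<rho> \<in> \<xi>" and \<eta>: "\<eta> \<in> ends E" "g \<circ> \<rho> \<in> \<eta>"
  shows "end_act g \<xi> = \<eta>"
proof -
  have ray: "h \<circ> \<tau> \<in> rays E" if "h \<in> Aut E" "\<tau> \<in> rays E" for h \<tau>
    using that by (auto simp: rays_def Aut_def bij_def intro: inj_compose)
  have cof: "(h \<circ> \<tau>, h \<circ> \<tau>') \<in> cofinal E" if h: "h \<in> Aut E" and c: "(\<tau>, \<tau>') \<in> cofinal E" for h \<tau> \<tau>'
  proof -
    obtain m n where "\<And>k. \<tau> (m + k) = \<tau>' (n + k)" using c by (auto simp: cofinal_def)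
    moreover have "\<tau> \<in> rays E" "\<tau>' \<in> rays E" using c by (auto simp: cofinal_def)
    ultimately show ?thesis using ray[OF h] by (intro cofinalI[of _ _ m n]) simp_all
  qed
  define g' where "g' = inv_into UNIV g"
  have g': "g' \<in> Aut E" "g \<circ> g' = id" "g' \<circ> g = id" unfolding g'_def using inv_Aut[OF g] by simp_all
  have "\<tau> \<in> end_act g \<xi>" if "\<tau> \<in> \<eta>" for \<tau>
  proof -
    have "(g' \<circ> (g \<circ> \<rho>), g' \<circ> \<tau>) \<in> cofinal E"
      using ends_eq[OF \<eta>] that by (intro cof[OF g'(1)]) auto
    then have "g' \<circ> \<tau> \<in> \<xi>" using ends_eq[OF \<xi>] g'(3) by (auto simp: o_assoc)
    moreover have "g \<circ> (g' \<circ> \<tau>) = \<tau>" using g'(2) by (simp add: o_assoc)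
    ultimately show ?thesis unfolding end_act_def by (metis image_eqI)
  qed
  moreover have "g \<circ> \<tau> \<in> \<eta>" if "\<tau> \<in> \<xi>" for \<tau>
    using cof[OF g, of \<rho> \<tau>] ends_eq[OF \<xi>] ends_eq[OF \<eta>] that by auto
  ultimately show ?thesis by (auto simp: end_act_def)
qed

end

subsection \<open>Local permutations and extension of partial automorphisms\<close>

locale colored_tree = semiregular_tree E V d for E :: "('v \<times> 'v) set" and V d +
  fixes i :: "'v \<Rightarrow> nat"
  assumes d_ge_4: "d 0 \<ge> 4" "d 1 \<ge> 4" and legal: "legal_coloring E V d i"
begin

abbreviation sg :: "('v \<Rightarrow> 'v) \<Rightarrow> 'v \<Rightarrow> int" where
  "sg g v \<equiv> sign (local_perm E i g v)"

lemma card_S_ge_4: "card (S v) \<ge> 4"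
  using d_ge_4 ty_01[of v] by (auto simp: card_S)

text \<open>With at most two neighbours in \<open>U\<close>, degree at least 4 leaves two outside,
  and transposing these corrects a wrong sign.\<close>

lemma two_free: assumes "S v \<inter> U \<subseteq> {a, b}" shows "\<exists>x\<in>S v - U. \<exists>y\<in>S v - U. x \<noteq> y"
proof (rule ccontr)
  assume "\<not> ?thesis"
  then have "card (S v - U) \<le> Suc 0"
    by (subst card_le_Suc0_iff_eq) (use finite_S in blast)+
  moreover have "card (S v \<inter> U) \<le> 2"
    using card_mono[OF _ assms] card_insert_le_m1[of 2 "{b}" a] by simp
  moreover have "card (S v) = card (S v \<inter> U) + card (S v - U)"
    using finite_S by (metis Int_Diff_Un Int_Diff_disjoint card_Un_disjoint finite_Diff finite_Int)
  ultimately show False using card_S_ge_4[of v] by simp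
qed

lemma bij_color: "bij_betw i (S v) {1..card (S v)}"
  using legal ty_01[of v] V_iff_ty[of "ty v" v]
    by (auto simp: legal_coloring_def gsphere_1 card_S simp del: One_nat_def)

lemma image_color: "i ` S v = {1..card (S v)}"
  using bij_color by (rule bij_betw_imp_surj_on)

lemma local_perm_apply: assumes "x \<in> S v" shows "local_perm E i g v (i x) = i (g x)"
  unfolding local_perm_def gsphere_1 restrict_id_simps(1)[OF imageI[OF assms]]
    comp_apply inv_into_f_f[OF bij_betw_imp_inj_on[OF bij_color] assms] ..

lemma local_perm_outside: "c \<notin> {1..card (S v)} \<Longrightarrow> local_perm E i g v c = c"
  unfolding local_perm_def gsphere_1 by (simp add: image_color)

lemma color_cases:
  obtains x where "x \<in> S v" "c = i x" | "c \<notin> {1..card (S v)}"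
proof (cases "c \<in> i ` S v")
  case True then show ?thesis using that(1) by (rule imageE)
next
  case False then show ?thesis using that(2) unfolding image_color by blast
qed

lemma local_perm_eqI:
  assumes "\<And>x. x \<in> S v \<Longrightarrow> f (i x) = i (g x)" "\<And>c. c \<notin> {1..card (S v)} \<Longrightarrow> f c = c"
  shows "local_perm E i g v = f"
proof
  fix c
  show "local_perm E i g v c = f c"
    by (rule color_cases[of v c]) (simp_all add: local_perm_apply local_perm_outside assms
        del: Image_singleton_iff)
qed

lemma permutation_local_perm:
  assumes "bij_betw g (S v) (S v')"
  shows "permutation (local_perm E i g v)"
proof -
  have c: "card (S v) = card (S v')" using bij_betw_same_card[OF assms] .
  have "bij_betw (i \<circ> g \<circ> inv_into (S v) i) {1..card (S v)} {1..card (S v)}"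
    using bij_betw_inv_into[OF bij_color[of v]] assms bij_color[of v']
    by (auto simp: c intro: bij_betw_trans simp del: Image_singleton_iff)
  then have "local_perm E i g v permutes {1..card (S v)}"
    unfolding local_perm_def gsphere_1 image_color by (rule permutes_restrict_id)
  then show ?thesis by (rule permutes_imp_permutation[rotated]) simp
qed

lemma sg_comp:
  assumes "bij_betw h (S v) (S (h v))" "bij_betw g (S (h v)) (S w)"
  shows "sg (g \<circ> h) v = sg g (h v) * sg h v"
proof -
  have "local_perm E i (g \<circ> h) v = local_perm E i g (h v) \<circ> local_perm E i h v"
  proof (rule local_perm_eqI)
    fix x assume x: "x \<in> S v"
    then have "h x \<in> S (h v)" using assms(1) bij_betwE by blast
    with x show "(local_perm E i g (h v) \<circ> local_perm E i h v) (i x) = i ((g \<circ> h) x)"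
      by (simp add: local_perm_apply del: Image_singleton_iff)
  next
    fix c assume c: "c \<notin> {1..card (S v)}"
    moreover have "card (S (h v)) = card (S v)" using bij_betw_same_card[OF assms(1)] by simp
    ultimately show "(local_perm E i g (h v) \<circ> local_perm E i h v) c = c"
      using local_perm_outside[of c v] local_perm_outside[of c "h v"] by simp
  qed
  then show ?thesis
    using sign_compose permutation_local_perm[OF assms(1)] permutation_local_perm[OF assms(2)] by metis
qed

lemma sg_comp_Aut: "g \<in> Aut E \<Longrightarrow> h \<in> Aut E \<Longrightarrow> sg (g \<circ> h) v = sg g (h v) * sg h v"
  by (rule sg_comp[OF Aut_local_iso Aut_local_iso])

lemma sg_cong: "(\<And>x. x \<in> S v \<Longrightarrow> g x = h x) \<Longrightarrow> sg g v = sg h v"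
  by (rule arg_cong[of _ _ sign], rule local_perm_eqI)
     (simp_all add: local_perm_apply local_perm_outside del: Image_singleton_iff)

lemma sg_id [simp]: "sg id v = 1" "sg (\<lambda>x. x) v = 1"
proof -
  have "local_perm E i (\<lambda>x. x) v = id" by (rule local_perm_eqI) auto
  then show "sg (\<lambda>x. x) v = 1" by simp
  then show "sg id v = 1" by (simp add: id_def)
qed

lemma sg_transpose:
  assumes "bij_betw g (S v) (S v')" "a \<in> S v" "b \<in> S v" "a \<noteq> b"
  shows "sg (g \<circ> transpose a b) v = - sg g v"
proof -
  have inj: "inj_on i (S v)" using bij_betw_imp_inj_on[OF bij_color] .
  have "local_perm E i (g \<circ> transpose a b) v = local_perm E i g v \<circ> transpose (i a) (i b)"
  proof (rule local_perm_eqI)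
    fix x assume x: "x \<in> S v"
    have "transpose (i a) (i b) (i x) = i (transpose a b x)" "transpose a b x \<in> S v"
      using x assms inj by (auto simp: transpose_def inj_on_def)
    then show "(local_perm E i g v \<circ> transpose (i a) (i b)) (i x) = i ((g \<circ> transpose a b) x)"
      by (simp add: local_perm_apply del: Image_singleton_iff)
  next
    fix c assume c: "c \<notin> {1..card (S v)}"
    moreover have "i a \<in> {1..card (S v)}" "i b \<in> {1..card (S v)}"
      using assms image_color[of v] by blast+
    ultimately have "c \<noteq> i a" "c \<noteq> i b" by auto
    then show "(local_perm E i g v \<circ> transpose (i a) (i b)) c = c"
      using local_perm_outside[OF c] by (simp add: transpose_def)
  qed
  moreover have "sign (transpose (i a) (i b)) = -1"
    using assms inj by (auto simp: sign_swap_id inj_on_def)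
  ultimately show ?thesis
    using permutation_local_perm[OF assms(1)] by (simp add: sign_compose permutation_swap_id)
qed

text \<open>Any bijective completion of \<phi> has sign \<epsilon> or its negative. In the latter
  case, composing with the transposition of two points outside \<open>Z\<close> repairs the sign and
  leaves the values on \<open>Z\<close> alone.\<close>

lemma local_bij_ex:
  assumes "Z \<subseteq> S v" "inj_on \<phi> Z" "\<phi> ` Z \<subseteq> S v'" "card (S v) = card (S v')" "\<epsilon> \<in> {1, -1}"
    and "Z = S v \<and> sg \<phi> v = \<epsilon> \<or> (\<exists>a\<in>S v - Z. \<exists>b\<in>S v - Z. a \<noteq> b)"
  shows "\<exists>\<beta>. bij_betw \<beta> (S v) (S v') \<and> (\<forall>x\<in>Z. \<beta> x = \<phi> x) \<and> sg \<beta> v = \<epsilon>"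
proof -
  have fin: "finite Z" using assms(1) finite_S finite_subset by blast
  have "card (S v - Z) = card (S v' - \<phi> ` Z)"
    using assms fin finite_S by (simp add: card_Diff_subset card_image)
  then obtain \<psi> where \<psi>: "bij_betw \<psi> (S v - Z) (S v' - \<phi> ` Z)"
    using finite_same_card_bij finite_S by (metis finite_Diff)
  define \<beta> where "\<beta> = (\<lambda>x. if x \<in> Z then \<phi> x else \<psi> x)"
  have "bij_betw \<beta> Z (\<phi> ` Z)" "bij_betw \<beta> (S v - Z) (S v' - \<phi> ` Z)"
    using bij_betw_cong[of Z \<beta> \<phi>] bij_betw_cong[of "S v - Z" \<beta> \<psi>] assms(2) \<psi>
    by (auto simp: \<beta>_def bij_betw_imageI)
  then have "bij_betw \<beta> (Z \<union> (S v - Z)) (\<phi> ` Z \<union> (S v' - \<phi> ` Z))"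
    by (rule bij_betw_combine) auto
  moreover have "Z \<union> (S v - Z) = S v" "\<phi> ` Z \<union> (S v' - \<phi> ` Z) = S v'" using assms by auto
  ultimately have \<beta>: "bij_betw \<beta> (S v) (S v')" by simp
  have Z: "\<forall>x\<in>Z. \<beta> x = \<phi> x" by (simp add: \<beta>_def)
  show ?thesis
  proof (cases "sg \<beta> v = \<epsilon>")
    case True then show ?thesis using \<beta> Z by blast
  next
    case False
    have "\<not> (Z = S v \<and> sg \<phi> v = \<epsilon>)" using False Z sg_cong[of v \<beta> \<phi>] by auto
    then obtain a b where ab: "a \<in> S v - Z" "b \<in> S v - Z" "a \<noteq> b" using assms(6) by blast
    have "bij_betw (transpose a b) (S v) (S v)"
      using ab by (intro permutes_imp_bij permutes_swap_id) auto
    then have "bij_betw (\<beta> \<circ> transpose a b) (S v) (S v')" using \<beta> by (rule bij_betw_trans)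
    moreover have "\<forall>x\<in>Z. (\<beta> \<circ> transpose a b) x = \<phi> x" using ab Z by (auto simp: transpose_def)
    moreover have "sg (\<beta> \<circ> transpose a b) v = \<epsilon>"
      using sg_transpose[OF \<beta>, of a b] ab False assms(5)
        by (cases "local_perm E i \<beta> v" rule: sign_cases) auto
    ultimately show ?thesis by blast
  qed
qed

text \<open>The map is extended vertex by vertex, away from \<^term>\<open>p\<close>; the sign of the local permutation at
  a vertex is corrected by a transposition of two neighbours outside \<^term>\<open>U\<close>.\<close>

lemma extension:
  fixes s :: "'v \<Rightarrow> int"
  assumes p: "p \<in> U" and closed: "\<And>v. v \<in> U \<Longrightarrow> v \<noteq> p \<Longrightarrow> par p v \<in> U"
    and edge: "\<And>v w. v \<in> U \<Longrightarrow> w \<in> U \<Longrightarrow> (v, w) \<in> E \<Longrightarrow> (f v, f w) \<in> E"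
    and inj: "\<And>v. v \<in> U \<Longrightarrow> inj_on f (S v \<inter> U)"
    and types: "ty (f p) = ty p \<or> d 0 = d 1"
    and s: "\<And>v. s v \<in> {1, -1}"
    and free: "\<And>v. v \<in> U \<Longrightarrow> S v \<subseteq> U \<and> sg f v = s v \<or> (\<exists>a\<in>S v - U. \<exists>b\<in>S v - U. a \<noteq> b)"
  shows "\<exists>g\<in>Aut E. (\<forall>v\<in>U. g v = f v) \<and> (\<forall>v. sg g v = s v)"
proof -
  define P where "P v v' u' \<beta> \<longleftrightarrow> bij_betw \<beta> (S v) (S v') \<and> sg \<beta> v = s v \<and>
      (if v \<in> U then \<forall>x\<in>S v \<inter> U. \<beta> x = f x else \<beta> (par p v) = u')" for v v' u' \<beta>
  define \<beta> where "\<beta> v v' u' = (SOME \<beta>. P v v' u' \<beta>)" for v v' u'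
  \<comment> \<open>The value at \<open>w\<close> is determined by those at its parent and
    grandparent. Iterating \<open>F\<close> replaces a recursion on the distance from
    \<open>p\<close>: the \<open>n\<close>-th iterate is final on the ball of radius
    \<open>n\<close>.\<close>
  define F where "F g w = (if w = p then f p else \<beta> (par p w) (g (par p w)) (g (par p (par p w))) w)"
    for g w
  define G where "G n = (F ^^ n) (\<lambda>_. f p)" for n
  have G_Suc: "G (Suc n) = F (G n)" for n by (simp add: G_def)
  \<comment> \<open>For a neighbour of \<open>p\<close> the grandparent \<open>par p p\<close> is a
    junk value. It is harmless: \<open>p\<close> lies in \<open>U\<close>, and there
    \<open>P\<close> ignores the argument \<open>u'\<close>.\<close>
  obtain c where 4: "\<And>x y. \<beta> p x y = c x"
    using p that[of "\<lambda>x. \<beta> p x undefined"] by (simp add: \<beta>_def P_def)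
  have par_less: "\<delta> p (par p w) < \<delta> p w" if "w \<noteq> p" for w using par(2)[OF that] by simp
  have stable: "\<delta> p w \<le> n \<Longrightarrow> G (Suc n) w = G n w" for w n
  proof (induction n arbitrary: w)
    case 0
    then show ?case by (simp add: G_def F_def)
  next
    case (Suc n)
    show ?case
    proof (cases "w = p")
      case True then show ?thesis by (simp add: G_Suc F_def)
    next
      case False
      then have 1: "\<delta> p (par p w) \<le> n" using par_less[of w] Suc.prems by simp
      then have 2: "G (Suc n) (par p w) = G n (par p w)" by (rule Suc.IH)
      have 3: "G (Suc n) (par p (par p w)) = G n (par p (par p w))" if "par p w \<noteq> p"
        using Suc.IH[of "par p (par p w)"] par_less[OF that] 1 by simp
      have "G (Suc (Suc n)) w = \<beta> (par p w) (G (Suc n) (par p w)) (G (Suc n) (par p (par p w))) w"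
        using False by (subst G_Suc) (simp add: F_def)
      also have "\<dots> = \<beta> (par p w) (G n (par p w)) (G n (par p (par p w))) w"
        using 2 3 4 by (cases "par p w = p") auto
      also have "\<dots> = G (Suc n) w"
        using False by (subst G_Suc) (simp add: F_def)
      finally show ?thesis .
    qed
  qed
  have stable': "G (\<delta> p w + k) w = G (\<delta> p w) w" for w k
    by (induction k) (simp_all add: stable)
  define g where "g w = G (\<delta> p w) w" for w
  have G_g: "G n w = g w" if "\<delta> p w \<le> n" for n w
    using stable'[of w "n - \<delta> p w"] that by (simp add: g_def)
  have gp: "g p = f p" by (simp add: g_def G_def)
  have g_rec: "g w = \<beta> (par p w) (g (par p w)) (g (par p (par p w))) w" if w: "w \<noteq> p" for w
  proof -
    obtain n where n: "\<delta> p w = Suc n" using w by (metis \<delta>_0_iff not0_implies_Suc)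
    have "G n (par p w) = g (par p w)" using G_g par_less[OF w] n by simp
    moreover have "G n (par p (par p w)) = g (par p (par p w))" if "par p w \<noteq> p"
      using G_g[of "par p (par p w)" n] par_less[OF w] par_less[OF that] n by simp
    ultimately show ?thesis using w n 4
      by (cases "par p w = p") (simp_all add: g_def[of w] G_Suc F_def)
  qed
  have main: "(v \<in> U \<longrightarrow> g v = f v) \<and> card (S (g v)) = card (S v) \<and>
      (v \<noteq> p \<longrightarrow> (g (par p v), g v) \<in> E) \<and> (ty (g v) = ty v \<or> d 0 = d 1) \<and>
      P v (g v) (g (par p v)) (\<beta> v (g v) (g (par p v)))" for v
  proof (induction "\<delta> p v" arbitrary: v rule: less_induct)
    case (less v)
    have a: "(v \<in> U \<longrightarrow> g v = f v) \<and> (v \<noteq> p \<longrightarrow> (g (par p v), g v) \<in> E)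
        \<and> (ty (g v) = ty v \<or> d 0 = d 1)"
    proof (cases "v = p")
      case True then show ?thesis using gp types by simp
    next
      case False
      define u where "u = par p v"
      have u: "(u, v) \<in> E" "\<delta> p u < \<delta> p v"
        using par(1)[OF False] par_less[OF False] by (simp_all add: u_def)
      have gv: "g v = \<beta> u (g u) (g (par p u)) v" using g_rec[OF False] by (simp add: u_def)
      have IH: "u \<in> U \<longrightarrow> g u = f u" "ty (g u) = ty u \<or> d 0 = d 1"
        "P u (g u) (g (par p u)) (\<beta> u (g u) (g (par p u)))" using less u(2) by auto
      have e: "(g u, g v) \<in> E" using IH(3) u(1) by (auto simp: P_def gv dest!: bij_betwE)
      moreover have "ty (g v) = ty v \<or> d 0 = d 1"
        using ty_edge[OF e] ty_edge[OF u(1)] IH(2) by auto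
      moreover have "v \<in> U \<longrightarrow> g v = f v"
      proof
        assume "v \<in> U"
        then have "u \<in> U" using closed False by (simp add: u_def)
        then show "g v = f v" using IH(3) u(1) \<open>v \<in> U\<close> by (auto simp: P_def gv)
      qed
      ultimately show ?thesis by (simp add: u_def)
    qed
    \<comment> \<open>Either types are preserved or all degrees agree, so the neighbourhoods to be
      matched have equal size.\<close>
    have c: "card (S (g v)) = card (S v)"
      using a ty_01[of v] ty_01[of "g v"] by (auto simp: card_S)
    have "\<exists>\<beta>. P v (g v) (g (par p v)) \<beta>"
    proof (cases "v \<in> U")
      case True
      have "f ` (S v \<inter> U) \<subseteq> S (g v)" using edge True a by auto
      moreover have "S v \<inter> U = S v \<and> sg f v = s v \<or> (\<exists>a\<in>S v - S v \<inter> U. \<exists>b\<in>S v - S v \<inter> U. a \<noteq> b)"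
        using free[OF True] by blast
      ultimately show ?thesis
        using local_bij_ex[of "S v \<inter> U" v f "g v" "s v"] inj[OF True] s[of v] c True
        by (auto simp: P_def)
    next
      case False
      then have vp: "v \<noteq> p" using p by auto
      have u: "par p v \<in> S v" using sym_E[OF par(1)[OF vp]] by simp
      have "card (S v - {par p v}) \<ge> 2" using card_S_ge_4[of v] u finite_S[of v] by simp
      then have "\<exists>a\<in>S v - {par p v}. \<exists>b\<in>S v - {par p v}. a \<noteq> b"
        using card_le_Suc0_iff_eq[of "S v - {par p v}"] finite_S[of v] by force
      moreover have "g (par p v) \<in> S (g v)" using a vp sym_E by auto
      ultimately show ?thesis
        using local_bij_ex[of "{par p v}" v "\<lambda>_. g (par p v)" "g v" "s v"] s[of v] c False u
        by (auto simp: P_def simp del: Image_singleton_iff)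
    qed
    then have "P v (g v) (g (par p v)) (\<beta> v (g v) (g (par p v)))"
      unfolding \<beta>_def by (rule someI_ex)
    then show ?case using a c by blast
  qed
  \<comment> \<open>On children this is the recursion. On the parent it is the last clause of
    \<open>P\<close> if \<open>v\<close> is outside \<open>U\<close>; otherwise the parent also lies
    in \<open>U\<close>, and both sides equal \<open>f\<close>.\<close>
  have eq: "g x = \<beta> v (g v) (g (par p v)) x" if "x \<in> S v" for x v
  proof -
    have "(v, x) \<in> E" using that by simp
    then consider "x \<noteq> p" "v = par p x" | "v \<noteq> p" "x = par p v" using edge_cases[of v x p] by blast
    then show ?thesis
    proof cases
      case 1 then show ?thesis using g_rec by simp
    next
      case 2
      show ?thesis
      proof (cases "v \<in> U")
        case True
        then have "x \<in> U" using closed 2 by simp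
        then show ?thesis using main[of v] main[of x] True that by (auto simp: P_def)
      next
        case False
        then show ?thesis using main[of v] 2 by (auto simp: P_def)
      qed
    qed
  qed
  have "bij_betw g (S v) (S (g v))" for v
    using bij_betw_cong[of "S v" g "\<beta> v (g v) (g (par p v))", OF eq] main[of v] by (simp add: P_def)
  then have "g \<in> Aut E" by (rule local_iso_Aut)
  moreover have "sg g v = s v" for v
    using sg_cong[of v g "\<beta> v (g v) (g (par p v))", OF eq] main[of v] by (simp add: P_def)
  ultimately show ?thesis using main by blast
qed

section \<open>Deep vertices, displaced half-trees and cones\<close>

lemma ty_ex: "t \<in> {0, 1} \<Longrightarrow> \<exists>v. ty v = t"
proof -
  fix v assume t: "t \<in> {0, 1}"
  obtain a where "a \<in> S v" using two_free[of v "{}" v v] by blast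
  then have "ty v + ty a = 1" using ty_edge by simp
  then have "ty v = t \<or> ty a = t" using t ty_01[of v] by auto
  then show ?thesis by blast
qed

lemma deep_vertex: assumes "(u, p) \<in> E" shows "\<exists>w\<in>branch p u. \<delta> u w = n \<and> \<delta> p w = Suc n"
proof (induction n)
  case 0
  show ?case using branch_self(1)[OF assms] sym_E[OF assms]
    by (intro bexI[of _ u]) (simp_all add: edge_iff_\<delta>)
next
  case (Suc n)
  then obtain w where w: "w \<in> branch p u" "\<delta> u w = n" "\<delta> p w = Suc n" by blast
  obtain w' where w': "w' \<in> S w" "w' \<noteq> par p w"
    using two_free[of w "{par p w}" "par p w" "par p w"] by blast
  have e: "(w, w') \<in> E" using w'(1) by simp
  then have p: "\<delta> p w' = Suc (Suc n)" using edge_cases[of w w' p] w'(2) w(3) by auto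
  have "\<delta> u w' \<le> Suc n" using \<delta>_step[OF e, of u] w(2) by auto
  then have "w' \<in> branch p u" using p by (simp add: branch_def)
  moreover from this have "\<delta> u w' = Suc n" using branch_D[OF assms] p by fastforce
  ultimately show ?case using p by blast
qed

lemma descendant_ex: "\<exists>x. \<delta> v x = n \<and> \<delta> p x = \<delta> p v + n"
proof (cases n)
  case 0 then show ?thesis by (intro exI[of _ v]) simp
next
  case (Suc k)
  obtain y where y: "y \<in> S v" "y \<noteq> par p v"
    using two_free[of v "{par p v}" "par p v" "par p v"] by blast
  have e: "(v, y) \<in> E" using y(1) by simp
  have y': "y \<noteq> p" "par p y = v" "\<delta> p y = \<delta> p v + 1" using edge_cases[OF e, of p] y(2) by auto
  obtain x where x: "x \<in> branch v y" "\<delta> y x = k" "\<delta> v x = Suc k"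
    using deep_vertex[OF sym_E[OF e], of k] by blast
  have "\<delta> p x = \<delta> p v + n" using \<delta>_branch_root[OF y'(1)] x y' Suc by simp
  then show ?thesis using x(3) Suc by blast
qed

text \<open>Take \<open>y\<close> in a direction that leads neither to \<open>n v\<close> nor to the
  preimage of \<open>v\<close>. A vertex \<open>n z\<close> in both half-trees would have
  \<open>v\<close> on its geodesic to \<open>n v\<close> and \<open>n v\<close> on its geodesic to
  \<open>v\<close>, forcing \<open>n v = v\<close>.\<close>

lemma moved_half_tree:
  assumes n: "n \<in> Aut E" and v: "n v \<noteq> v"
  shows "\<exists>y. (v, y) \<in> E \<and> n ` branch v y \<inter> branch v y = {}"
proof -
  define n' where "n' = inv_into UNIV n"
  note inv = inv_Aut[OF n, folded n'_def]
  have n'v: "n' v \<noteq> v" using v inv(2)[of v] by metis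
  obtain y1 where y1: "(y1, v) \<in> E" "n v \<in> branch v y1" using branch_cover[OF v] by blast
  obtain y2 where y2: "(y2, v) \<in> E" "n' v \<in> branch v y2" using branch_cover[OF n'v] by blast
  obtain y where y: "y \<in> S v" "y \<noteq> y1" "y \<noteq> y2" using two_free[of v "{y1, y2}" y1 y2] by blast
  have e: "(v, y) \<in> E" using y(1) by simp
  have a: "n v \<notin> branch v y" "n' v \<notin> branch v y"
    using branch_disjoint[OF y1(1) sym_E[OF e]] branch_disjoint[OF y2(1) sym_E[OF e]] y y1 y2 by blast+
  have e': "(n y, n v) \<in> E" using n sym_E[OF e] by (simp add: Aut_def)
  have "z \<notin> branch v y \<or> n z \<notin> branch v y" for z
  proof (rule ccontr)
    assume "\<not> ?thesis"
    then have z: "z \<in> branch v y" "n z \<in> branch v y" by auto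
    have "\<delta> (n v) (n z) = \<delta> (n v) v + \<delta> v (n z)"
      using edge_separates[OF sym_E[OF e] z(2) a(1)] branch_D[OF sym_E[OF e] z(2)] by simp
    moreover have "\<delta> v (n z) = \<delta> v (n v) + \<delta> (n v) (n z)"
    proof -
      have "n z \<in> branch (n v) (n y)" "v \<notin> branch (n v) (n y)"
        using Aut_branch[OF n, of z v y] Aut_branch[OF n, of "n' v" v y] z a inv(2) by simp_all
      then show ?thesis using edge_separates[OF e'] branch_D[OF e'] by simp
    qed
    ultimately have "\<delta> v (n v) = 0" by linarith
    then show False using v by simp
  qed
  then show ?thesis using e by blast
qed

text \<open>The geodesic from \<open>p\<close> to \<open>w\<close> together with the half-tree
  beyond \<open>w\<close>. It links that half-tree to the root, as the parent-closed domains of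
  \<open>extension\<close> require.\<close>

definition cone :: "'v \<Rightarrow> 'v \<Rightarrow> 'v set" where
  "cone p w = {y. \<delta> p w = \<delta> p y + \<delta> y w} \<union> branch (par p w) w"

lemma cone_par:
  assumes w: "w \<noteq> p" and y: "y \<in> cone p w" "y \<noteq> p"
  shows "par p y \<in> cone p w" "y \<in> branch (par p w) w \<Longrightarrow> y \<noteq> w \<Longrightarrow> par p y \<in> branch (par p w) w"
proof -
  show 1: "par p y \<in> branch (par p w) w" if "y \<in> branch (par p w) w" "y \<noteq> w"
  proof -
    have "\<delta> p y = \<delta> p w + \<delta> w y" by (rule \<delta>_branch_root[OF w that(1)])
    then have "\<delta> p (par p y) = \<delta> p w + \<delta> w (par p y)"
      using par_ancestor(2)[of w y p] that(2) by simp
    then show ?thesis by (rule branch_rootI[OF w])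
  qed
  have anc: "par p y \<in> cone p w" if "\<delta> p w = \<delta> p y + \<delta> y w"
  proof -
    have "\<delta> p y = \<delta> p (par p y) + 1" "\<delta> (par p y) y = 1"
      using par[OF y(2)] by (simp_all add: edge_iff_\<delta>)
    then have "\<delta> p w = \<delta> p (par p y) + \<delta> (par p y) w"
      using \<delta>_triangle[of p w "par p y"] \<delta>_triangle[of "par p y" w y] that by linarith
    then show ?thesis by (simp add: cone_def)
  qed
  show "par p y \<in> cone p w"
  proof (cases "y \<in> branch (par p w) w \<and> y \<noteq> w")
    case True then show ?thesis using 1 by (simp add: cone_def)
  next
    case False
    then have "\<delta> p w = \<delta> p y + \<delta> y w" using y(1) by (auto simp: cone_def)
    then show ?thesis by (rule anc)
  qed
qed

text \<open>Otherwise \<open>p\<close> would lie strictly between \<open>y\<close> and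
  \<open>w\<close>, so that neither could be an ancestor of the other.\<close>

lemma cone_subset_branch:
  assumes u: "(u, p) \<in> E" and w: "w \<in> branch p u" and y: "y \<in> cone p w" "y \<noteq> p"
  shows "y \<in> branch p u"
proof (rule ccontr)
  assume n: "y \<notin> branch p u"
  have wp: "w \<noteq> p" using w branch_self(2)[of p u] by auto
  have yw: "\<delta> y w = \<delta> y p + \<delta> p w" using edge_separates[OF u w n] branch_D[OF u w] by simp
  have "\<delta> p y > 0" using y(2) by (simp add: neq0_conv[symmetric] del: neq0_conv)
  moreover have "\<delta> y p = \<delta> p y" by (rule \<delta>_sym)
  moreover have "\<delta> p w = \<delta> p y + \<delta> y w \<or> \<delta> p y = \<delta> p w + \<delta> w y"
    using y(1) \<delta>_branch_root[OF wp] by (auto simp: cone_def)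
  moreover have "\<delta> w y = \<delta> y w" by (rule \<delta>_sym)
  moreover have "\<delta> p w > 0" using wp by (simp add: neq0_conv[symmetric] del: neq0_conv)
  ultimately show False using yw by linarith
qed

text \<open>In the half-tree the cone contains whole neighbourhoods, so local permutations are fully
  determined there: the first alternative of the hypothesis \<open>free\<close> in
  \<open>extension\<close>.\<close>

lemma cone_S: assumes w: "w \<noteq> p" and v: "v \<in> branch (par p w) w" shows "S v \<subseteq> cone p w"
proof
  fix y assume "y \<in> S v"
  then have e: "(v, y) \<in> E" by simp
  have vp: "v \<noteq> p" using v branch_par[OF w] by auto
  have v1: "\<delta> p v = \<delta> p w + \<delta> w v" by (rule \<delta>_branch_root[OF w v])
  consider "y \<noteq> p" "v = par p y" "\<delta> p y = \<delta> p v + 1" | "y = par p v"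
    using edge_cases[OF e, of p] by blast
  then show "y \<in> cone p w"
  proof cases
    case 1
    have "\<delta> w y \<le> \<delta> w v + 1" using \<delta>_step[OF e, of w] by auto
    then have "\<delta> p y = \<delta> p w + \<delta> w y" using \<delta>_triangle[of p y w] 1(3) v1 by linarith
    then show ?thesis using branch_rootI[OF w] by (simp add: cone_def)
  next
    case 2
    have "v \<in> cone p w" using v by (simp add: cone_def)
    then show ?thesis using cone_par(1)[OF w _ vp] 2 by simp
  qed
qed

text \<open>Outside the half-tree such a child is an ancestor of \<open>w\<close> at a fixed
  distance from \<open>p\<close>. Hence a vertex there has at most two neighbours in the cone, its
  parent and this child, and \<open>two_free\<close> applies.\<close>

lemma cone_child_unique:
  assumes w: "w \<noteq> p" and v: "v \<notin> branch (par p w) w"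
    and y: "y \<in> cone p w" "y \<noteq> p" "par p y = v" and y': "y' \<in> cone p w" "y' \<noteq> p" "par p y' = v"
  shows "y = y'"
proof -
  have "\<delta> p w = \<delta> p y + \<delta> y w" if y: "y \<in> cone p w" "y \<noteq> p" "par p y = v" for y
    using cone_par(2)[OF w y(1,2)] y(1,3) v by (cases "y = w") (auto simp: cone_def)
  from this[OF y] this[OF y'] have "\<delta> p w = \<delta> p y + \<delta> y w" "\<delta> p w = \<delta> p y' + \<delta> y' w" .
  moreover have "\<delta> p y = \<delta> p y'" using par(2)[OF y(2)] par(2)[OF y'(2)] y(3) y'(3) by simp
  ultimately show ?thesis using ancestor_unique[of y w "\<delta> y w" y' p] by simp
qed

end

subsection \<open>The sign equations\<close>

lemma prod_pm_one:
  fixes f :: "'a \<Rightarrow> int"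
  assumes "\<And>x. x \<in> A \<Longrightarrow> f x \<in> {1, -1}" shows "(\<Prod>x\<in>A. f x) \<in> {1, -1}"
  using assms
proof (induction A rule: infinite_finite_induct)
  case (insert x A)
  then have "f x \<in> {1, -1}" "(\<Prod>x\<in>A. f x) \<in> {1, -1}" by blast+
  then show ?case using insert.hyps by auto
qed auto

text \<open>Equation \<open>e\<close> is solved for its pivot \<open>c e\<close>. Every other
  unknown in it either has smaller rank or is no pivot and keeps its value \<open>s0\<close>. Signs
  are their own inverses, so the pivot receives \<open>b e\<close> times the product of the other
  values.\<close>

lemma triangular_system:
  fixes r :: "'a \<Rightarrow> nat" and c :: "'e \<Rightarrow> 'a" and F :: "'e \<Rightarrow> 'a set" and b :: "'e \<Rightarrow> int"
  assumes inj: "inj_on c I" and fin: "\<And>e. e \<in> I \<Longrightarrow> finite (F e)" and c: "\<And>e. e \<in> I \<Longrightarrow> c e \<in> F e"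
    and r: "\<And>e w. e \<in> I \<Longrightarrow> w \<in> F e \<Longrightarrow> w \<noteq> c e \<Longrightarrow> w \<in> c ` I \<Longrightarrow> r w < r (c e)"
    and b: "\<And>e. e \<in> I \<Longrightarrow> b e \<in> {1, -1}" and s0: "\<And>w. s0 w \<in> {1, -1}"
  shows "\<exists>s. (\<forall>w. s w \<in> {1, -1}) \<and> (\<forall>w. w \<notin> c ` I \<longrightarrow> s w = s0 w) \<and> (\<forall>e\<in>I. (\<Prod>w\<in>F e. s w) = b e)"
proof -
  define H where "H f w = (if w \<in> c ` I then b (inv_into I c w) *
      (\<Prod>x\<in>F (inv_into I c w) - {w}. if r x < r w then f x else s0 x) else s0 w)" for f w
  define s where "s = wfrec (measure r) H"
  have cut: "cut s (measure r) w x = s x" if "r x < r w" for w x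
    using that by (simp add: cut_def)
  have "s w = H (cut s (measure r) w) w" for w
    unfolding s_def by (rule wfrec) simp
  also have "H (cut s (measure r) w) w = H s w" for w
    unfolding H_def using cut by (auto intro!: prod.cong)
  finally have s_rec: "s w = H s w" for w .
  have off: "s w = s0 w" if "w \<notin> c ` I" for w
    using s_rec[of w] that by (simp add: H_def)
  have on: "s (c e) = b e * (\<Prod>x\<in>F e - {c e}. s x)" if e: "e \<in> I" for e
  proof -
    have "s (c e) = b e * (\<Prod>x\<in>F e - {c e}. if r x < r (c e) then s x else s0 x)"
      using s_rec[of "c e"] e inj by (simp add: H_def)
    also have "(\<Prod>x\<in>F e - {c e}. if r x < r (c e) then s x else s0 x) = (\<Prod>x\<in>F e - {c e}. s x)"
      by (intro prod.cong refl) (metis DiffE insertI1 off r[OF e])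
    finally show ?thesis .
  qed
  have val: "s w \<in> {1, -1}" for w
  proof (induction "r w" arbitrary: w rule: less_induct)
    case (less w)
    show ?case
    proof (cases "w \<in> c ` I")
      case True
      then obtain e where e: "e \<in> I" "w = c e" by auto
      have "(\<Prod>x\<in>F e - {w}. if r x < r w then s x else s0 x) \<in> {1, -1}"
        using less s0 by (intro prod_pm_one) auto
      then show ?thesis using s_rec[of w] e b[OF e(1)] inj by (auto simp: H_def)
    next
      case False then show ?thesis using off s0 by simp
    qed
  qed
  have "(\<Prod>w\<in>F e. s w) = b e" if e: "e \<in> I" for e
  proof -
    have "(\<Prod>w\<in>F e. s w) = s (c e) * (\<Prod>x\<in>F e - {c e}. s x)"
      using fin[OF e] c[OF e] by (rule prod.remove)
    moreover have "s (c e) * s (c e) = 1" "b e * b e = 1" using val[of "c e"] b[OF e] by auto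
    ultimately show ?thesis using on[OF e] by (metis mult.assoc mult.commute mult_1)
  qed
  then show ?thesis using val off by blast
qed

locale sign_tree = colored_tree E V d i for E :: "('v \<times> 'v) set" and V d i +
  fixes Y :: "nat \<Rightarrow> nat set"
  assumes fin_Y: "finite (Y 0)" "finite (Y 1)"
begin

abbreviation F :: "nat \<Rightarrow> 'v \<Rightarrow> 'v set" where "F t \<equiv> gspheres E (Y t)"

abbreviation m :: "nat \<Rightarrow> nat" where "m t \<equiv> max0 (Y t)"

text \<open>The type of a center is such that the outermost sphere around it consists of vertices of
  type \<^term>\<open>t\<close>.\<close>

abbreviation "center t v \<equiv> ty v = (t + m t) mod 2"

section \<open>The products of signs and the group they define\<close>

definition sphere_sign :: "nat \<Rightarrow> ('v \<Rightarrow> 'v) \<Rightarrow> 'v \<Rightarrow> int" where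
  "sphere_sign t g v = (\<Prod>w\<in>F t v. sg g w)"

definition G where "G = G_plus E V i (Y 0) (Y 1)"

definition M :: nat where "M = max (m 0) (m 1)"

lemma F_iff: "w \<in> F t v \<longleftrightarrow> \<delta> v w \<in> Y t"
  by (simp add: gspheres_def gsphere_def)

lemma F_le: assumes "t \<in> {0, 1}" "w \<in> F t v" shows "\<delta> v w \<le> m t"
  using assms fin_Y by (auto simp: F_iff max0_def)

lemma m_in: assumes "t \<in> {0, 1}" "Y t \<noteq> {}" shows "m t \<in> Y t"
proof -
  have "finite (Y t)" using assms(1) fin_Y by auto
  then show ?thesis using assms(2) by (simp add: max0_def)
qed

lemma m_le_M: "t \<in> {0, 1} \<Longrightarrow> m t \<le> M"
  by (auto simp: M_def)

lemma finite_F: assumes "t \<in> {0, 1}" shows "finite (F t v)"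
proof (rule finite_subset)
  show "F t v \<subseteq> {w. \<delta> v w \<le> m t}" using F_le[OF assms] by auto
qed (rule finite_ball)

lemma sphere_sign_cong: "(\<And>w x. w \<in> F t v \<Longrightarrow> x \<in> S w \<Longrightarrow> g x = h x) \<Longrightarrow> sphere_sign t g v = sphere_sign t h v"
  unfolding sphere_sign_def by (intro prod.cong sg_cong) auto

lemma sphere_sign_id [simp]: "sphere_sign t id v = 1"
  by (simp add: sphere_sign_def)

lemma sphere_sign_empty: "Y t = {} \<Longrightarrow> sphere_sign t g v = 1"
  by (simp add: sphere_sign_def gspheres_def)

lemma sphere_sign_pm: "sphere_sign t g v \<in> {1, -1}"
  unfolding sphere_sign_def by (rule prod_pm_one) (auto simp: sign_def)

lemma sphere_sign_square: "sphere_sign t g v * sphere_sign t g v = 1"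
  using sphere_sign_pm[of t g v] by auto

lemma sphere_sign_comp:
  assumes "g \<in> Aut E" "h \<in> Aut E"
  shows "sphere_sign t (g \<circ> h) v = sphere_sign t g (h v) * sphere_sign t h v"
proof -
  have bij: "bij h" using assms(2) by (simp add: Aut_def)
  have "bij_betw h (F t v) (F t (h v))"
  proof (rule bij_betw_imageI)
    show "inj_on h (F t v)" using bij by (meson bij_is_inj inj_on_subset subset_UNIV)
    have "w \<in> h ` F t v" if "w \<in> F t (h v)" for w
    proof -
      obtain u where "w = h u" using bij by (metis bij_pointE)
      then show ?thesis using that Aut_\<delta>[OF assms(2)] by (auto simp: F_iff)
    qed
    then show "h ` F t v = F t (h v)" using Aut_\<delta>[OF assms(2)] by (auto simp: F_iff)
  qed
  then have "(\<Prod>w\<in>F t v. sg g (h w)) = sphere_sign t g (h v)"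
    unfolding sphere_sign_def by (rule prod.reindex_bij_betw)
  then show ?thesis using assms by (simp add: sphere_sign_def sg_comp_Aut prod.distrib)
qed

lemma sphere_sign_inv: assumes "g \<in> Aut E"
  shows "sphere_sign t (inv_into UNIV g) (g v) = sphere_sign t g v"
proof -
  have "sphere_sign t (inv_into UNIV g) (g v) * sphere_sign t g v = 1"
    using sphere_sign_comp[OF inv_Aut(1)[OF assms] assms, of t v] inv_Aut(5)[OF assms] by simp
  then show ?thesis
    using sphere_sign_pm[of t g v] sphere_sign_pm[of t "inv_into UNIV g" "g v"] by auto
qed

lemma sphere_sign_conj:
  assumes "g \<in> Aut E" "h \<in> Aut E"
  shows "sphere_sign t (g \<circ> h \<circ> inv_into UNIV g) (g v) = sphere_sign t g (h v) * sphere_sign t h v * sphere_sign t g v"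
proof -
  have "sphere_sign t (g \<circ> h \<circ> inv_into UNIV g) (g v)
      = sphere_sign t (g \<circ> h) (inv_into UNIV g (g v)) * sphere_sign t (inv_into UNIV g) (g v)"
    by (rule sphere_sign_comp[OF comp_Aut[OF assms] inv_Aut(1)[OF assms(1)]])
  then show ?thesis
    unfolding inv_Aut(3)[OF assms(1)] sphere_sign_comp[OF assms] sphere_sign_inv[OF assms(1)] .
qed

lemma G_iff: "g \<in> G \<longleftrightarrow> g \<in> Aut E \<and> (\<forall>v. ty (g v) = ty v) \<and> (\<forall>t\<in>{0, 1}. \<forall>v. center t v \<longrightarrow> sphere_sign t g v = 1)"
proof -
  have "v \<in> V ((t + m t) mod 2) \<longleftrightarrow> center t v" for v t
    by (rule V_iff_ty) auto
  from this[of _ 0] this[of _ 1]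
  have "v \<in> V (m 0 mod 2) \<longleftrightarrow> center 0 v" "v \<in> V ((1 + m 1) mod 2) \<longleftrightarrow> center 1 v" for v
    by simp_all
  then show ?thesis
    unfolding G_def G_plus_def mem_Collect_eq Aut_plus_iff Ball_def sphere_sign_def by auto
qed

lemma G_Aut: "g \<in> G \<Longrightarrow> g \<in> Aut E"
  by (simp add: G_iff)

lemma G_sphere_sign: "g \<in> G \<Longrightarrow> t \<in> {0, 1} \<Longrightarrow> center t v \<Longrightarrow> sphere_sign t g v = 1"
  and G_ty: "g \<in> G \<Longrightarrow> ty (g v) = ty v"
  using G_iff by blast+

lemma id_G: "id \<in> G"
  by (simp add: G_iff id_Aut)

lemma comp_G: "g \<in> G \<Longrightarrow> h \<in> G \<Longrightarrow> g \<circ> h \<in> G"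
  by (simp add: G_iff comp_Aut sphere_sign_comp)

lemma inv_G: assumes "g \<in> G" shows "inv_into UNIV g \<in> G"
proof -
  have A: "g \<in> Aut E" and ty: "\<And>v. ty (g v) = ty v" using assms by (auto simp: G_iff)
  have "ty (inv_into UNIV g v) = ty v" for v
    using ty[of "inv_into UNIV g v"] inv_Aut(2)[OF A] by simp
  moreover have "sphere_sign t (inv_into UNIV g) v = 1" if "t \<in> {0, 1}" "center t v" for t v
  proof -
    have "center t (inv_into UNIV g v)" using that calculation by simp
    then have "sphere_sign t g (inv_into UNIV g v) = 1" using assms that(1) by (auto simp: G_iff)
    then show ?thesis using sphere_sign_inv[OF A, of t "inv_into UNIV g v"] inv_Aut(2)[OF A] by simp
  qed
  ultimately show ?thesis using inv_Aut(1)[OF A] by (simp add: G_iff)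
qed

lemma subgroup_G: "subgroup G (comp_group (Aut E))"
  by (rule subgroup_AutI) (use G_Aut id_G comp_G inv_G in blast)+

text \<open>Being an automorphism, preserving types and satisfying an equation are each tested on
  finite sets. This gives closedness of the group and lets it absorb the pointwise limit in
  \<open>shift_commutator\<close>.\<close>

lemma G_local:
  assumes "\<And>A. finite A \<Longrightarrow> \<exists>\<gamma>\<in>G. \<forall>x\<in>A. g x = \<gamma> x"
  shows "g \<in> G"
proof -
  have "bij_betw g (S v) (S (g v))" for v
  proof -
    obtain \<gamma> where "\<gamma> \<in> G" and eq: "\<forall>x\<in>insert v (S v). g x = \<gamma> x"
      using assms[of "insert v (S v)"] finite_S by auto
    then have "bij_betw \<gamma> (S v) (S (\<gamma> v))" using Aut_local_iso G_Aut by blast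
    then show ?thesis using bij_betw_cong[of "S v" g \<gamma>] eq by simp
  qed
  then have "g \<in> Aut E" by (rule local_iso_Aut)
  moreover have "ty (g v) = ty v" for v
    using assms[of "{v}"] by (auto simp: G_iff)
  moreover have "sphere_sign t g v = 1" if t: "t \<in> {0, 1}" "center t v" for t v
  proof -
    have "finite (\<Union>w\<in>F t v. S w)" using finite_F[OF t(1)] finite_S by blast
    then obtain \<gamma> where "\<gamma> \<in> G" "\<forall>x\<in>(\<Union>w\<in>F t v. S w). g x = \<gamma> x" using assms by blast
    then show ?thesis using sphere_sign_cong[of t v g \<gamma>] t by (auto simp: G_iff)
  qed
  ultimately show ?thesis by (simp add: G_iff)
qed

lemma G_closedin: "closedin (Aut_topology E) G"
proof -
  have top: "topspace (Aut_topology E) = Aut E" by (simp add: Aut_topology_def)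
  have "openin (Aut_topology E) (Aut E - G)"
  proof (subst openin_subopen, intro ballI)
    fix g assume g: "g \<in> Aut E - G"
    then obtain A where A: "finite A" "\<And>\<gamma>. \<gamma> \<in> G \<Longrightarrow> \<exists>x\<in>A. g x \<noteq> \<gamma> x" using G_local[of g] by blast
    define B where "B = (\<Pi>\<^sub>E x\<in>UNIV. if x \<in> A then {g x} else UNIV)"
    have "openin (product_topology (\<lambda>_. discrete_topology UNIV) UNIV) B"
      unfolding B_def using A(1) by (intro product_topology_basis) (auto intro: finite_subset)
    then have "openin (Aut_topology E) (B \<inter> Aut E)"
      unfolding Aut_topology_def by (auto simp: openin_subtopology)
    moreover have "g \<in> B \<inter> Aut E" using g by (auto simp: B_def)
    moreover have "B \<inter> Aut E \<subseteq> Aut E - G"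
    proof
      fix \<gamma> assume \<gamma>: "\<gamma> \<in> B \<inter> Aut E"
      then have "g x = \<gamma> x" if "x \<in> A" for x
        using that PiE_mem[of \<gamma> UNIV "\<lambda>x. if x \<in> A then {g x} else UNIV" x] by (auto simp: B_def)
      then show "\<gamma> \<in> Aut E - G" using A(2) \<gamma> by auto
    qed
    ultimately show "\<exists>T. openin (Aut_topology E) T \<and> g \<in> T \<and> T \<subseteq> Aut E - G" by blast
  qed
  then show ?thesis using G_Aut by (auto simp: closedin_def top)
qed

text \<open>Each equation is solved for the value at one vertex of its outermost sphere, at maximal distance
  from \<^term>\<open>p\<close>; this makes the system triangular with respect to that distance.\<close>

lemma solve_signs:
  assumes descend: "\<And>v n. v \<notin> H \<Longrightarrow> \<exists>x. \<delta> v x = n \<and> \<delta> p x = \<delta> p v + n \<and> (\<forall>z\<in>H. \<delta> z x = \<delta> z v + n)"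
    and b: "\<And>t. b t \<in> {1, -1}" and s0: "\<And>w. s0 w \<in> {1, -1}"
  shows "\<exists>s :: 'v \<Rightarrow> int. (\<forall>w. s w \<in> {1, -1}) \<and> (\<forall>z\<in>H. \<forall>w. \<delta> z w \<le> M \<longrightarrow> s w = s0 w) \<and>
    (\<forall>t\<in>{0, 1}. \<forall>v. Y t \<noteq> {} \<longrightarrow> center t v \<longrightarrow> (\<forall>z\<in>H. \<delta> z v + m t > M) \<longrightarrow> (\<Prod>w\<in>F t v. s w) = b t)"
proof -
  \<comment> \<open>The pivot of such an equation will have distance exactly
    \<open>\<delta> z v + m t\<close> from each \<open>z\<close> in \<open>H\<close>. The bound by
    \<open>M\<close> thus keeps all pivots out of the \<open>M\<close>-neighbourhood of
    \<open>H\<close>, where \<open>s0\<close> must survive.\<close>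
  define I where "I = {(t, v). t \<in> {0, 1} \<and> Y t \<noteq> {} \<and> center t v \<and> (\<forall>z\<in>H. \<delta> z v + m t > M)}"
  have notH: "v \<notin> H" if "(t, v) \<in> I" for t v
    using that m_le_M by (force simp: I_def)
  have "\<forall>e\<in>I. \<exists>x. \<delta> (snd e) x = m (fst e) \<and> \<delta> p x = \<delta> p (snd e) + m (fst e)
      \<and> (\<forall>z\<in>H. \<delta> z x = \<delta> z (snd e) + m (fst e))"
    using descend notH by auto
  then obtain c where c: "\<And>e. e \<in> I \<Longrightarrow> \<delta> (snd e) (c e) = m (fst e) \<and> \<delta> p (c e) = \<delta> p (snd e) + m (fst e)
      \<and> (\<forall>z\<in>H. \<delta> z (c e) = \<delta> z (snd e) + m (fst e))" by metis
  \<comment> \<open>The center has type \<open>t + m t\<close> modulo 2 and the pivot is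
    \<open>m t\<close> steps away, so the pivot reveals the family of its equation.\<close>
  have c_ty: "ty (c (t, v)) = t" if e: "(t, v) \<in> I" for t v
  proof -
    have "even (m t) \<longleftrightarrow> ty v = ty (c (t, v))" using even_\<delta>_iff[of v "c (t, v)"] c[OF e] by simp
    moreover have "t \<in> {0, 1}" "ty v = (t + m t) mod 2" using e by (auto simp: I_def)
    ultimately show ?thesis
      using ty_01[of "c (t, v)"] by (cases "even (m t)") (auto elim!: evenE oddE)
  qed
  have inj: "inj_on c I"
  proof (rule inj_onI)
    fix e e' assume e: "e \<in> I" "e' \<in> I" "c e = c e'"
    obtain t v where [simp]: "e = (t, v)" by (cases e)
    obtain t' v' where [simp]: "e' = (t', v')" by (cases e')
    have "t = t'" using c_ty[of t v] c_ty[of t' v'] e by simp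
    then show "e = e'"
      using ancestor_unique[of v "c e" "m t" v' p] c[OF e(1)] c[OF e(2)] e(3) by simp
  qed
  have rk: "\<delta> p w < \<delta> p (c e)" if e: "e \<in> I" "w \<in> F (fst e) (snd e)" "w \<noteq> c e" "w \<in> c ` I" for e w
  proof -
    obtain t v where [simp]: "e = (t, v)" by (cases e)
    obtain t' v' where e': "(t', v') \<in> I" "w = c (t', v')" using e(4) by auto
    have t: "t \<in> {0, 1}" using e by (auto simp: I_def)
    have le: "\<delta> v w \<le> m t" using F_le[OF t] e(2) by simp
    have tri: "\<delta> p w \<le> \<delta> p v + \<delta> v w" by (rule \<delta>_triangle)
    have ce: "\<delta> p (c e) = \<delta> p v + m t" using c[OF e(1)] by simp
    \<comment> \<open>At equal distance from \<open>p\<close> the two pivots have equal type, hence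
      belong to the same family. Both centers then lie \<open>m t\<close> levels above
      \<open>w\<close>, so they coincide.\<close>
    have "\<delta> p w \<noteq> \<delta> p (c e)"
    proof
      assume a: "\<delta> p w = \<delta> p (c e)"
      then have "even (\<delta> p w) \<longleftrightarrow> even (\<delta> p (c e))" by simp
      then have "ty w = ty (c e)"
        unfolding even_\<delta>_iff by (rule ty_eqI)
      then have "t' = t" using c_ty e' e(1) by auto
      moreover have "v = v'"
        using ancestor_unique[of v w "m t" v' p] a ce tri le c[OF e'(1)] e'(2) \<open>t' = t\<close> by simp
      ultimately show False using e(3) e'(2) by simp
    qed
    then show ?thesis using tri le ce by simp
  qed
  have "\<exists>s. (\<forall>w. s w \<in> {1, -1}) \<and> (\<forall>w. w \<notin> c ` I \<longrightarrow> s w = s0 w) \<and>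
      (\<forall>e\<in>I. (\<Prod>w\<in>F (fst e) (snd e). s w) = b (fst e))"
  proof (rule triangular_system[where r = "\<delta> p", OF inj])
    show "finite (F (fst e) (snd e))" if "e \<in> I" for e
      using that finite_F by (auto simp: I_def)
    show "c e \<in> F (fst e) (snd e)" if "e \<in> I" for e
    proof -
      have "m (fst e) \<in> Y (fst e)" by (rule m_in) (use that in \<open>auto simp: I_def\<close>)
      then show ?thesis using c[OF that] by (simp add: F_iff)
    qed
  qed (use rk b s0 in auto)
  then obtain s where s: "\<And>w. s w \<in> {1, -1}" "\<And>w. w \<notin> c ` I \<Longrightarrow> s w = s0 w"
    "\<And>e. e \<in> I \<Longrightarrow> (\<Prod>w\<in>F (fst e) (snd e). s w) = b (fst e)" by blast
  have eqs: "(\<Prod>w\<in>F t v. s w) = b t" if "(t, v) \<in> I" for t v using s(3)[OF that] by simp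
  have "s w = s0 w" if w: "z \<in> H" "\<delta> z w \<le> M" for z w
  proof (rule s(2), rule notI)
    assume "w \<in> c ` I"
    then obtain t v where e: "(t, v) \<in> I" "w = c (t, v)" by auto
    then have "\<delta> z v + m t > M" using w(1) by (auto simp: I_def)
    then show False using c[OF e(1)] e(2) w by auto
  qed
  moreover have "(\<Prod>w\<in>F t v. s w) = b t"
    if "t \<in> {0, 1}" "Y t \<noteq> {}" "center t v" "\<forall>z\<in>H. \<delta> z v + m t > M" for t v
    by (rule eqs) (use that in \<open>simp add: I_def\<close>)
  ultimately show ?thesis using s(1) by blast
qed

text \<open>With \<open>H\<close> empty all equations are solved at once, and only the image of
  \<open>p\<close> is prescribed. This provides preimages for the quotient maps of both normalizers;
  a \<open>q\<close> of the other type serves the dihedral case.\<close>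

lemma prescribed_sphere_sign:
  assumes b: "\<And>t. b t \<in> {1, -1}" and q: "ty q = ty p \<or> d 0 = d 1"
  shows "\<exists>g\<in>Aut E. g p = q \<and> (\<forall>t\<in>{0, 1}. \<forall>v. Y t \<noteq> {} \<longrightarrow> center t v \<longrightarrow> sphere_sign t g v = b t)"
proof -
  have "\<exists>s :: 'v \<Rightarrow> int. (\<forall>w. s w \<in> {1, -1}) \<and> (\<forall>z\<in>{}. \<forall>w. \<delta> z w \<le> M \<longrightarrow> s w = 1) \<and>
    (\<forall>t\<in>{0, 1}. \<forall>v. Y t \<noteq> {} \<longrightarrow> center t v \<longrightarrow> (\<forall>z\<in>{}. \<delta> z v + m t > M) \<longrightarrow> (\<Prod>w\<in>F t v. s w) = b t)"
    by (rule solve_signs[of _ p]) (use b descendant_ex in auto)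
  then obtain s :: "'v \<Rightarrow> int" where s: "\<And>w. s w \<in> {1, -1}"
    "\<And>t v. t \<in> {0, 1} \<Longrightarrow> Y t \<noteq> {} \<Longrightarrow> center t v \<Longrightarrow> (\<Prod>w\<in>F t v. s w) = b t" by blast
  have "\<exists>g\<in>Aut E. (\<forall>v\<in>{p}. g v = q) \<and> (\<forall>v. sg g v = s v)"
  proof (rule extension[where p = p])
    show "S v \<subseteq> {p} \<and> sg (\<lambda>v. q) v = s v \<or> (\<exists>a\<in>S v - {p}. \<exists>b\<in>S v - {p}. a \<noteq> b)" for v
      using two_free[of v "{p}" p p] by blast
  qed (use q s(1) in auto)
  then obtain g where g: "g \<in> Aut E" "g p = q" "\<And>v. sg g v = s v" by blast
  then show ?thesis using s(2) by (intro bexI[of _ g]) (auto simp: sphere_sign_def)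
qed

subsection \<open>Boundary 2-transitivity\<close>

text \<open>If all local signs are 1, so are all products, and no equations have to be
  solved.\<close>

lemma G_extension:
  assumes "p \<in> U" "\<And>v. v \<in> U \<Longrightarrow> v \<noteq> p \<Longrightarrow> par p v \<in> U"
    "\<And>v w. v \<in> U \<Longrightarrow> w \<in> U \<Longrightarrow> (v, w) \<in> E \<Longrightarrow> (f v, f w) \<in> E"
    "\<And>v. v \<in> U \<Longrightarrow> inj_on f (S v \<inter> U)" "ty (f p) = ty p"
    "\<And>v. v \<in> U \<Longrightarrow> \<exists>a b. S v \<inter> U \<subseteq> {a, b}"
  shows "\<exists>g\<in>G. \<forall>v\<in>U. g v = f v"
proof -
  have "\<exists>x\<in>S v - U. \<exists>y\<in>S v - U. x \<noteq> y" if "v \<in> U" for v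
    using assms(6)[OF that] two_free by blast
  then obtain g where g: "g \<in> Aut E" "\<forall>v\<in>U. g v = f v" "\<And>v. sg g v = 1"
    using extension[OF assms(1-4), of "\<lambda>_. 1"] assms(5) by force
  have "ty (g p) = ty p" using g(2) assms(1,5) by simp
  then have "g \<in> G" using g by (simp add: G_iff type_preserving[of g p] sphere_sign_def)
  then show ?thesis using g(2) by blast
qed

lemma G_edge_transitive:
  assumes "(x, y) \<in> E" "(x', y') \<in> E" "ty x = ty x'"
  shows "\<exists>g\<in>G. g x = x' \<and> g y = y'"
proof -
  have xy: "x \<noteq> y" "x' \<noteq> y'" using assms by auto
  have "par x y = x" using assms(1) by (intro par_eqI) (simp_all add: edge_iff_\<delta>)
  then have "\<exists>g\<in>G. \<forall>v\<in>{x, y}. g v = (if v = x then x' else y')"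
    using assms xy sym_E by (intro G_extension[where p = x]) (auto simp: inj_on_def)
  then show ?thesis using xy by auto
qed

lemma same_type_transitive: assumes "ty v = ty u" shows "\<exists>h\<in>G. h v = u"
proof -
  obtain a b where "a \<in> S v" "b \<in> S u"
    using two_free[of v "{}" v v] two_free[of u "{}" u u] by blast
  then show ?thesis using G_edge_transitive[of v a u b] assms by auto
qed

lemma G_rays:
  assumes \<rho>: "\<rho>1 \<in> rays E" "\<rho>2 \<in> rays E" "\<rho>1 0 = \<rho>2 0" "\<rho>1 1 \<noteq> \<rho>2 1"
    and \<sigma>: "\<sigma>1 \<in> rays E" "\<sigma>2 \<in> rays E" "\<sigma>1 0 = \<sigma>2 0" "\<sigma>1 1 \<noteq> \<sigma>2 1"
    and ty: "ty (\<sigma>1 0) = ty (\<rho>1 0)"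
  shows "\<exists>g\<in>G. g \<circ> \<rho>1 = \<sigma>1 \<and> g \<circ> \<rho>2 = \<sigma>2"
proof -
  define p where "p = \<rho>1 0"
  define U where "U = range \<rho>1 \<union> range \<rho>2"
  \<comment> \<open>The index of a vertex on either ray is its distance from \<open>p\<close>. The
    rays meet only at \<open>p\<close>, so the case distinction sends each ray to its
    counterpart.\<close>
  define f where "f x = (if x \<in> range \<rho>1 then \<sigma>1 (\<delta> p x) else \<sigma>2 (\<delta> p x))" for x
  have \<delta>1: "\<delta> p (\<rho>1 n) = n" for n using ray_\<delta>[OF \<rho>(1)] by (simp add: p_def)
  have \<delta>2: "\<delta> p (\<rho>2 n) = n" for n using ray_\<delta>[OF \<rho>(2)] \<rho>(3) by (simp add: p_def)
  have par1: "par p (\<rho>1 (Suc n)) = \<rho>1 n" for n using ray_par[OF \<rho>(1)] by (simp add: p_def)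
  have par2: "par p (\<rho>2 (Suc n)) = \<rho>2 n" for n using ray_par[OF \<rho>(2)] \<rho>(3) by (simp add: p_def)
  have f1: "f (\<rho>1 n) = \<sigma>1 n" for n by (simp add: f_def \<delta>1)
  have f2: "f (\<rho>2 n) = \<sigma>2 n" for n
  proof (cases "\<rho>2 n \<in> range \<rho>1")
    case True
    then obtain k where "\<rho>1 k = \<rho>2 n" by auto
    then have "n = 0" using rays_meet[OF \<rho>] by blast
    then show ?thesis using \<sigma>(3) \<rho>(3) f1[of 0] by simp
  qed (simp add: f_def \<delta>2)
  have fin: "inj \<sigma>1" "inj \<sigma>2" using \<sigma> by (auto simp: rays_def)
  have sedge: "(\<sigma>1 n, \<sigma>1 (Suc n)) \<in> E" "(\<sigma>2 n, \<sigma>2 (Suc n)) \<in> E" for n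
    using \<sigma> by (auto simp: rays_def)
  have inj: "inj_on f U"
  proof (rule inj_onI)
    fix x y assume xy: "x \<in> U" "y \<in> U" "f x = f y"
    have "\<rho>1 a = \<rho>2 b" if "\<sigma>1 a = \<sigma>2 b" for a b using rays_meet[OF \<sigma> that] \<rho>(3) by simp
    then show "x = y" using xy fin unfolding U_def by (auto simp: f1 f2 inj_eq) metis
  qed
  have down: "(\<exists>n. w = \<rho>1 (Suc n) \<and> par p w = \<rho>1 n) \<or> (\<exists>n. w = \<rho>2 (Suc n) \<and> par p w = \<rho>2 n)"
    if w: "w \<in> U" "w \<noteq> p" for w
  proof -
    have "\<exists>n. w = \<rho>1 n \<or> w = \<rho>2 n" using w(1) by (auto simp: U_def)
    then obtain n where n: "w = \<rho>1 n \<or> w = \<rho>2 n" by blast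
    then have "n \<noteq> 0" using w(2) \<rho>(3) by (metis p_def)
    then show ?thesis using n par1 par2 by (metis not0_implies_Suc)
  qed
  have down_edge: "(f (par p w), f w) \<in> E" if w: "w \<in> U" "w \<noteq> p" for w
    using down[OF w] sedge by (metis f1 f2)
  have nbr: "\<exists>a b. S v \<inter> U \<subseteq> {a, b}" if v: "v \<in> U" for v
  proof (cases "v = p")
    case True
    have "w = \<rho>1 1 \<or> w = \<rho>2 1" if "w \<in> S v" "w \<in> U" for w
    proof -
      have "(p, w) \<in> E" using that True by simp
      then have wp: "w \<noteq> p" "\<delta> p w = 1" by (auto simp: edge_iff_\<delta>)
      from down[OF that(2) wp(1)] wp(2) show ?thesis by (auto simp: \<delta>1 \<delta>2)
    qed
    then show ?thesis by blast
  next
    case False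
    have "w = par p v \<or> w = (if v \<in> range \<rho>1 then \<rho>1 (Suc (\<delta> p v)) else \<rho>2 (Suc (\<delta> p v)))"
      if w: "w \<in> S v" "w \<in> U" for w
    proof (cases "w = par p v")
      case False2: False
      have "(v, w) \<in> E" using w by simp
      then have wv: "w \<noteq> p" "v = par p w" using edge_cases[of v w p] False2 by auto
      from down[OF w(2) wv(1)] consider n where "w = \<rho>1 (Suc n)" "v = \<rho>1 n"
        | n where "w = \<rho>2 (Suc n)" "v = \<rho>2 n" using wv(2) by auto
      then show ?thesis
      proof cases
        case 1 then show ?thesis by (simp add: \<delta>1)
      next
        case 2
        have "v \<notin> range \<rho>1"
        proof
          assume "v \<in> range \<rho>1"
          then obtain k where "\<rho>1 k = \<rho>2 n" using 2 by auto
          then have "n = 0" using rays_meet[OF \<rho>] by blast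
          then show False using 2 False \<rho>(3) by (simp add: p_def)
        qed
        then show ?thesis using 2 by (simp add: \<delta>2)
      qed
    qed simp
    then show ?thesis by blast
  qed
  have "\<exists>g\<in>G. \<forall>v\<in>U. g v = f v"
  proof (rule G_extension)
    show "p \<in> U" by (simp add: U_def p_def)
    show "par p v \<in> U" if "v \<in> U" "v \<noteq> p" for v using down[OF that] by (auto simp: U_def)
    show "(f v, f w) \<in> E" if "v \<in> U" "w \<in> U" "(v, w) \<in> E" for v w
      using edge_cases[OF that(3), of p] down_edge[OF that(1)] down_edge[OF that(2)] sym_E by metis
    show "inj_on f (S v \<inter> U)" for v using inj by (rule inj_on_subset) simp
    show "ty (f p) = ty p" using f1[of 0] ty by (simp add: p_def)
  qed (fact nbr)
  then obtain g where g: "g \<in> G" "\<And>v. v \<in> U \<Longrightarrow> g v = f v" by blast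
  have "g (\<rho>1 n) = \<sigma>1 n" "g (\<rho>2 n) = \<sigma>2 n" for n
    using g(2)[of "\<rho>1 n"] g(2)[of "\<rho>2 n"] f1 f2 by (simp_all add: U_def)
  then show ?thesis using g(1) by (intro bexI[of _ g]) auto
qed

lemma G_two_transitive: "two_transitive_on_ends E G"
  unfolding two_transitive_on_ends_def
proof (intro ballI impI)
  fix \<xi>1 \<xi>2 \<eta>1 \<eta>2
  assume e: "\<xi>1 \<in> ends E" "\<xi>2 \<in> ends E" "\<eta>1 \<in> ends E" "\<eta>2 \<in> ends E" "\<xi>1 \<noteq> \<xi>2" "\<eta>1 \<noteq> \<eta>2"
  obtain \<rho>1 \<rho>2 where \<rho>: "\<rho>1 \<in> \<xi>1" "\<rho>2 \<in> \<xi>2" "\<rho>1 0 = \<rho>2 0" "\<rho>1 1 \<noteq> \<rho>2 1" "ty (\<rho>1 0) = 0"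
    using rays_between_typed[OF e(1,2,5), of 0] by auto
  obtain \<sigma>1 \<sigma>2 where \<sigma>: "\<sigma>1 \<in> \<eta>1" "\<sigma>2 \<in> \<eta>2" "\<sigma>1 0 = \<sigma>2 0" "\<sigma>1 1 \<noteq> \<sigma>2 1" "ty (\<sigma>1 0) = 0"
    using rays_between_typed[OF e(3,4,6), of 0] by auto
  obtain g where g: "g \<in> G" "g \<circ> \<rho>1 = \<sigma>1" "g \<circ> \<rho>2 = \<sigma>2"
    using G_rays[OF endsD[OF e(1) \<rho>(1)] endsD[OF e(2) \<rho>(2)] \<rho>(3,4)
        endsD[OF e(3) \<sigma>(1)] endsD[OF e(4) \<sigma>(2)] \<sigma>(3,4)] \<rho>(5) \<sigma>(5) by auto
  have "end_act g \<xi>1 = \<eta>1" using end_act_eq[OF G_Aut[OF g(1)] e(1) \<rho>(1) e(3)] g(2) \<sigma>(1) by simp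
  moreover have "end_act g \<xi>2 = \<eta>2"
    using end_act_eq[OF G_Aut[OF g(1)] e(2) \<rho>(2) e(4)] g(3) \<sigma>(2) by simp
  ultimately show "\<exists>h\<in>G. end_act h \<xi>1 = \<eta>1 \<and> end_act h \<xi>2 = \<eta>2" using g(1) by blast
qed

lemma G_HT_plus: "G \<in> HT_plus E V"
  using subgroup_G G_closedin G_two_transitive
    by (auto simp: HT_plus_def HT_def Aut_plus_iff G_Aut G_ty)

subsection \<open>Simplicity\<close>

text \<open>This cuts \<^term>\<open>g\<close> into \<^term>\<open>f\<close> and \<open>f\<inverse> g\<close>, each of which fixes a half-tree. The half-trees are
  chosen so far from \<^term>\<open>p\<close> that no defining equation sees both of them.\<close>

lemma gluing:
  assumes g: "g \<in> G" and gp: "g p = p"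
  shows "\<exists>f\<in>G. \<exists>x y x' y'. (x, y) \<in> E \<and> (x', y') \<in> E \<and> (\<forall>z\<in>branch x y. f z = g z) \<and> (\<forall>z\<in>branch x' y'. f z = z)"
proof -
  have A: "g \<in> Aut E" using g by (rule G_Aut)
  obtain u where u: "u \<in> S p" using two_free[of p "{}" p p] by blast
  \<comment> \<open>The map will be \<open>g\<close> towards \<open>u\<close> and the identity
    towards \<open>q\<close>. Its images then lie in the directions \<open>g u\<close> and
    \<open>q\<close>, which must differ for injectivity.\<close>
  obtain q where q: "q \<in> S p" "q \<noteq> u" "q \<noteq> g u" using two_free[of p "{u, g u}" u "g u"] by blast
  have up: "(u, p) \<in> E" "(q, p) \<in> E" using u q(1) sym_E by simp_all
  have "(g u, g p) \<in> E" using A up(1) by (simp add: Aut_def)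
  then have gup: "(g u, p) \<in> E" by (simp add: gp)
  \<comment> \<open>Beyond depth \<open>M + 1\<close>, a ball of radius \<open>M\<close> around a
    vertex of the half-tree cannot reach across \<open>p\<close>.\<close>
  obtain w1 where w1: "w1 \<in> branch p u" "\<delta> p w1 = Suc M" using deep_vertex[OF up(1), of M] by blast
  obtain w3 where w3: "w3 \<in> branch p q" "\<delta> p w3 = Suc M" using deep_vertex[OF up(2), of M] by blast
  have wp: "w1 \<noteq> p" "w3 \<noteq> p" using w1(2) w3(2) by auto
  define H1 where "H1 = branch (par p w1) w1"
  define H3 where "H3 = branch (par p w3) w3"
  define U1 where "U1 = cone p w1"
  define U3 where "U3 = cone p w3"
  define U where "U = U1 \<union> U3"
  define f where "f y = (if y \<in> U1 then g y else y)" for y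
  \<comment> \<open>On and near the two half-trees the signs must be those of \<open>g\<close> on
    one side and those of the identity on the other.\<close>
  define s0 where "s0 w = (if w \<in> branch p u then sg g w else 1)" for w
  have H_U: "H1 \<subseteq> U1" "H3 \<subseteq> U3" by (auto simp: H1_def H3_def U1_def U3_def cone_def)
  have Hp: "p \<notin> H1" "p \<notin> H3" using branch_par wp by (auto simp: H1_def H3_def)
  have pU: "p \<in> U1" "p \<in> U3" by (simp_all add: U1_def U3_def cone_def)
  have U_branch: "y \<in> U1 \<Longrightarrow> y \<noteq> p \<Longrightarrow> y \<in> branch p u" "y \<in> U3 \<Longrightarrow> y \<noteq> p \<Longrightarrow> y \<in> branch p q" for y
    using cone_subset_branch[OF up(1) w1(1)] cone_subset_branch[OF up(2) w3(1)]
      by (simp_all add: U1_def U3_def)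
  have disj: "branch p u \<inter> branch p q = {}" using branch_disjoint[OF up] q(2) by auto
  have disj': "branch p (g u) \<inter> branch p q = {}" using branch_disjoint[OF gup up(2)] q(3) by auto
  have par1: "par p y \<in> U1" if "y \<in> U1" "y \<noteq> p" for y
    using cone_par(1)[OF wp(1)] that by (simp add: U1_def)
  have par3: "par p y \<in> U3" if "y \<in> U3" "y \<noteq> p" for y
    using cone_par(1)[OF wp(2)] that by (simp add: U3_def)
  have f1: "f y = g y" if "y \<in> U1" for y using that by (simp add: f_def)
  have f3: "f y = y" if "y \<in> U3" for y
  proof (cases "y = p")
    case True then show ?thesis using gp pU by (simp add: f_def)
  next
    case False
    then have "y \<notin> U1" using U_branch[of y] that disj by blast
    then show ?thesis by (simp add: f_def)
  qed
  have closed: "par p y \<in> U" if "y \<in> U" "y \<noteq> p" for y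
    using that par1 par3 by (auto simp: U_def)
  have S_H1: "S v \<subseteq> U1" if "v \<in> H1" for v
    using cone_S[OF wp(1)] that by (simp add: H1_def U1_def)
  have S_H3: "S v \<subseteq> U3" if "v \<in> H3" for v
    using cone_S[OF wp(2)] that by (simp add: H3_def U3_def)
  have nbr_p: "S p \<inter> U \<subseteq> {u, q}"
  proof
    fix y assume y: "y \<in> S p \<inter> U"
    then have yp: "y \<noteq> p" "\<delta> p y = 1" by (auto simp: edge_iff_\<delta>)
    then have "\<delta> u y = 0 \<or> \<delta> q y = 0" using y U_branch[of y] by (auto simp: branch_def U_def)
    then show "y \<in> {u, q}" by auto
  qed
  \<comment> \<open>Stated for abstract \<open>Ua\<close> and \<open>Ub\<close> since the two cones
    exchange roles. The directions \<open>a\<close> and \<open>b\<close> differ, so a child of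
    \<open>v\<close> in \<open>U\<close> belongs to the cone of \<open>v\<close>.\<close>
  have nbr_gen: "\<exists>c. S v \<inter> U \<subseteq> {par p v, c}"
    if v: "v \<in> branch p a" "v \<in> Ua" "v \<notin> branch (par p w) w" and w: "w \<noteq> p" and Ua: "Ua = cone p w"
      and Ub: "\<And>y. y \<in> Ub \<Longrightarrow> y \<noteq> p \<Longrightarrow> y \<in> branch p b" "\<And>y. y \<in> Ub \<Longrightarrow> y \<noteq> p \<Longrightarrow> par p y \<in> Ub"
      and ab: "(a, p) \<in> E" "branch p a \<inter> branch p b = {}" and UU: "U = Ua \<union> Ub" for v w a b Ua Ub
  proof -
    have vp: "v \<noteq> p" using v(1) branch_self(2)[of p a] by auto
    have child: "y \<in> Ua \<and> y \<noteq> p \<and> par p y = v" if y: "y \<in> S v" "y \<in> U" "y \<noteq> par p v" for y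
    proof -
      have y': "y \<noteq> p" "par p y = v" using edge_cases[of v y p] y by auto
      have "y \<notin> Ub" using Ub(1)[of v] Ub(2)[of y] y' vp v(1) ab(2) by auto
      then show ?thesis using y' y(2) UU by blast
    qed
    show ?thesis
    proof (cases "\<exists>y\<in>S v \<inter> U. y \<noteq> par p v")
      case True
      then obtain c where c: "c \<in> S v" "c \<in> U" "c \<noteq> par p v" by blast
      have "y = c" if "y \<in> S v" "y \<in> U" "y \<noteq> par p v" for y
        using cone_child_unique[OF w v(3), of y c] child[OF that] child[OF c] Ua by simp
      then show ?thesis by blast
    qed blast
  qed
  have nbr: "\<exists>a b. S v \<inter> U \<subseteq> {a, b}" if v: "v \<in> U" "v \<notin> H1" "v \<notin> H3" for v
  proof (cases "v = p")
    case True then show ?thesis using nbr_p by blast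
  next
    case False
    from v(1) consider "v \<in> U1" | "v \<in> U3" by (auto simp: U_def)
    then show ?thesis
    proof cases
      case 1
      have "\<exists>c. S v \<inter> U \<subseteq> {par p v, c}"
        by (rule nbr_gen[where w = w1 and Ua = U1 and Ub = U3 and a = u and b = q])
           (use 1 False v U_branch par3 up disj wp in \<open>auto simp: U_def H1_def U1_def\<close>)
      then show ?thesis by blast
    next
      case 2
      have "\<exists>c. S v \<inter> U \<subseteq> {par p v, c}"
        by (rule nbr_gen[where w = w3 and Ua = U3 and Ub = U1 and a = q and b = u])
           (use 2 False v U_branch par1 up disj wp in \<open>auto simp: U_def H3_def U3_def\<close>)
      then show ?thesis by blast
    qed
  qed
  have HU: "z \<in> U" "z \<noteq> p" if "z \<in> H1 \<union> H3" for z using that H_U Hp by (auto simp: U_def)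
  have descend: "\<exists>x. \<delta> v x = n \<and> \<delta> p x = \<delta> p v + n \<and> (\<forall>z\<in>H1 \<union> H3. \<delta> z x = \<delta> z v + n)"
    if v: "v \<notin> H1 \<union> H3" for v n
  proof (cases n)
    case 0 then show ?thesis by (intro exI[of _ v]) simp
  next
    case (Suc k)
    have "\<exists>a b. S v \<inter> U \<subseteq> {a, b}"
    proof (cases "v \<in> U")
      case True then show ?thesis using nbr v by blast
    next
      case False
      have "y = par p v" if "y \<in> S v" "y \<in> U" for y
        using edge_cases[of v y p] that closed[OF that(2)] False by auto
      then show ?thesis by blast
    qed
    then obtain a b where ab: "a \<in> S v - U" "b \<in> S v - U" "a \<noteq> b" using two_free by blast
    then obtain y where y: "y \<in> S v" "y \<notin> U" "y \<noteq> par p v" by blast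
    have e: "(v, y) \<in> E" using y(1) by simp
    have y': "y \<noteq> p" "par p y = v" "\<delta> p y = \<delta> p v + 1" using edge_cases[OF e, of p] y(3) by auto
    obtain x where x: "x \<in> branch v y" "\<delta> y x = k" "\<delta> v x = Suc k"
      using deep_vertex[OF sym_E[OF e], of k] by blast
    have px: "\<delta> p x = \<delta> p v + n" using \<delta>_branch_root[OF y'(1)] x y' Suc by simp
    have "\<delta> z x = \<delta> z v + n" if z: "z \<in> H1 \<union> H3" for z
    proof -
      \<comment> \<open>A vertex of \<open>H1\<close> or \<open>H3\<close> beyond \<open>y\<close>
        would have \<open>y\<close> as an ancestor, and \<open>U\<close> is closed under ancestors.
        So the walk from \<open>v\<close> through \<open>y\<close> leads away from both
        half-trees.\<close>
      have "z \<notin> branch v y"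
      proof
        assume "z \<in> branch v y"
        then have "\<delta> p z = \<delta> p y + \<delta> y z" using \<delta>_branch_root[OF y'(1)] y'(2) by simp
        then have "y \<in> U" using closed_ancestor[of U p z y] closed HU(1)[OF z] by blast
        then show False using y(2) by simp
      qed
      then show ?thesis using edge_separates[OF sym_E[OF e] x(1)] x(2) Suc by simp
    qed
    then show ?thesis using px x(3) Suc by blast
  qed
  have "\<exists>s :: 'v \<Rightarrow> int. (\<forall>w. s w \<in> {1, -1}) \<and> (\<forall>z\<in>H1 \<union> H3. \<forall>w. \<delta> z w \<le> M \<longrightarrow> s w = s0 w) \<and>
    (\<forall>t\<in>{0, 1}. \<forall>v. Y t \<noteq> {} \<longrightarrow> center t v \<longrightarrow> (\<forall>z\<in>H1 \<union> H3. \<delta> z v + m t > M) \<longrightarrow> (\<Prod>w\<in>F t v. s w) = 1)"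
    by (rule solve_signs[of _ p]) (fact descend, simp_all add: s0_def sign_def)
  then obtain s :: "'v \<Rightarrow> int" where s: "\<And>w. s w \<in> {1, -1}"
    "\<And>z w. z \<in> H1 \<union> H3 \<Longrightarrow> \<delta> z w \<le> M \<Longrightarrow> s w = s0 w"
    "\<And>t v. t \<in> {0, 1} \<Longrightarrow> Y t \<noteq> {} \<Longrightarrow> center t v \<Longrightarrow> \<forall>z\<in>H1 \<union> H3. \<delta> z v + m t > M \<Longrightarrow> (\<Prod>w\<in>F t v. s w) = 1"
    by blast
  have s_H1: "s v = sg g v" if "v \<in> H1" for v
    using s(2)[of v v] that U_branch(1)[of v] H_U Hp by (auto simp: s0_def)
  have s_H3: "s v = 1" if "v \<in> H3" for v
  proof -
    have "v \<notin> branch p u" using that U_branch(2)[of v] H_U Hp disj by blast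
    then show ?thesis using s(2)[of v v] that by (simp add: s0_def)
  qed
  have "\<exists>f'\<in>Aut E. (\<forall>v\<in>U. f' v = f v) \<and> (\<forall>v. sg f' v = s v)"
  proof (rule extension[where p = p])
    show "p \<in> U" using pU by (simp add: U_def)
    show "ty (f p) = ty p \<or> d 0 = d 1" using f1[OF pU(1)] gp by simp
    show "(f v, f w) \<in> E" if vw: "v \<in> U" "w \<in> U" "(v, w) \<in> E" for v w
    proof -
      have "v \<in> U1 \<and> w \<in> U1 \<or> v \<in> U3 \<and> w \<in> U3"
        using edge_cases[OF vw(3), of p] vw(1,2) par1 par3 by (auto simp: U_def)
      then show ?thesis using f1 f3 A vw(3) by (auto simp: Aut_def)
    qed
    have "inj_on f U"
    proof (rule inj_onI)
      have *: "f x \<noteq> f y" if "x \<in> U1" "x \<noteq> p" "y \<in> U3" "y \<noteq> p" for x y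
      proof -
        have "g x \<in> branch p (g u)"
          using Aut_branch[OF A, of x p u] U_branch(1)[OF that(1,2)] gp by simp
        then show ?thesis
          using f1[OF that(1)] f3[OF that(3)] U_branch(2)[OF that(3,4)] disj' by auto
      qed
      have inj_g: "g x = g y \<Longrightarrow> x = y" for x y using A by (auto simp: Aut_def bij_def inj_def)
      fix x y assume xy: "x \<in> U" "y \<in> U" "f x = f y"
      consider "x \<in> U1" "y \<in> U1" | "x \<in> U3" "y \<in> U3" | "x \<in> U1" "y \<in> U3" "x \<noteq> p" "y \<noteq> p"
        | "x \<in> U3" "y \<in> U1" "x \<noteq> p" "y \<noteq> p"
        using xy(1,2) pU unfolding U_def by blast
      then show "x = y"
      proof cases
        case 1 then show ?thesis using xy(3) f1 inj_g by simp
      next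
        case 2 then show ?thesis using xy(3) f3 by simp
      next
        case 3 then show ?thesis using * xy(3) by blast
      next
        case 4 then show ?thesis using *[of y x] xy(3) by simp
      qed
    qed
    then show "inj_on f (S v \<inter> U)" for v by (rule inj_on_subset) simp
    show "S v \<subseteq> U \<and> sg f v = s v \<or> (\<exists>a\<in>S v - U. \<exists>b\<in>S v - U. a \<noteq> b)" if v: "v \<in> U" for v
    proof -
      consider "v \<in> H1" | "v \<in> H3" | "v \<notin> H1" "v \<notin> H3" by blast
      then show ?thesis
      proof cases
        case 1
        have "sg f v = sg g v" by (rule sg_cong) (use f1 S_H1[OF 1] in blast)
        then show ?thesis using S_H1[OF 1] s_H1[OF 1] by (auto simp: U_def)
      next
        case 2
        have "sg f v = sg (\<lambda>x. x) v" by (rule sg_cong) (use f3 S_H3[OF 2] in blast)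
        then show ?thesis using S_H3[OF 2] s_H3[OF 2] by (auto simp: U_def)
      next
        case 3
        then show ?thesis using nbr[OF v] two_free by blast
      qed
    qed
  qed (use closed s(1) in auto)
  then obtain f' where f': "f' \<in> Aut E" "\<And>v. v \<in> U \<Longrightarrow> f' v = f v" "\<And>v. sg f' v = s v" by blast
  have near: "w \<in> branch p a" if z: "z \<in> branch p a" "\<delta> p z > M" "\<delta> z w \<le> M" and a: "(a, p) \<in> E"
    for a z w
  proof (rule ccontr)
    assume n: "w \<notin> branch p a"
    have "\<delta> w z = \<delta> w p + 1 + \<delta> a z" "\<delta> p z = \<delta> a z + 1" "\<delta> w z = \<delta> z w"
      using edge_separates[OF a z(1) n] branch_D[OF a z(1)] \<delta>_sym by simp_all
    then show False using z by linarith
  qed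
  have far: "\<delta> p z > M" if "z \<in> H1 \<union> H3" for z
    using that \<delta>_branch_root[OF wp(1), of z] \<delta>_branch_root[OF wp(2), of z] w1(2) w3(2)
    by (auto simp: H1_def H3_def)
  have "sphere_sign t f' v = 1" if t: "t \<in> {0, 1}" "center t v" for t v
  \<comment> \<open>Either the equation was solved explicitly, or all its vertices are within
    \<open>M\<close> of some \<open>z\<close> in a half-tree. In the latter case \<open>s\<close>
    equals \<open>s0\<close> on it, and \<open>near\<close> puts it on one side of \<open>p\<close>:
    the product is that of \<open>g\<close> or of the identity.\<close>
  proof (cases "Y t \<noteq> {} \<and> (\<forall>z\<in>H1 \<union> H3. \<delta> z v + m t > M)")
    case True
    then show ?thesis using s(3)[OF t(1) _ t(2)] by (simp add: sphere_sign_def f'(3))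
  next
    case False
    show ?thesis
    proof (cases "Y t = {}")
      case True
      then show ?thesis by (simp add: sphere_sign_def gspheres_def)
    next
      case nonempty: False
      with False obtain z where z: "z \<in> H1 \<union> H3" "\<delta> z v + m t \<le> M" by force
      have zw: "\<delta> z w \<le> M" if "w \<in> F t v" for w
        using F_le[OF t(1) that] \<delta>_triangle[of z w v] z(2) by linarith
      have sphere_sign: "sphere_sign t f' v = (\<Prod>w\<in>F t v. s0 w)"
        unfolding sphere_sign_def f'(3) using s(2)[OF z(1) zw] by (rule prod.cong[OF refl])
      show ?thesis
      proof (cases "z \<in> H1")
        case True
        have "z \<in> branch p u" using U_branch(1)[of z] True H_U(1) Hp(1) by blast
        then have "s0 w = sg g w" if "w \<in> F t v" for w
          using near[OF _ far[OF z(1)] zw[OF that] up(1)] by (simp add: s0_def)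
        then have "sphere_sign t f' v = sphere_sign t g v"
          unfolding sphere_sign by (simp add: sphere_sign_def)
        then show ?thesis using G_sphere_sign[OF g t] by simp
      next
        case False
        then have "z \<in> branch p q" using U_branch(2)[of z] z(1) H_U(2) Hp(2) by blast
        then have "w \<in> branch p q" if "w \<in> F t v" for w
          using near[OF _ far[OF z(1)] zw[OF that] up(2)] by simp
        then have "s0 w = 1" if "w \<in> F t v" for w using that disj by (auto simp: s0_def)
        then show ?thesis unfolding sphere_sign by simp
      qed
    qed
  qed
  moreover have "ty (f' p) = ty p" using f'(2)[of p] pU f1[OF pU(1)] gp by (simp add: U_def)
  then have "ty (f' v) = ty v" for v by (rule type_preserving[OF f'(1)])
  ultimately have "f' \<in> G" using f'(1) by (simp add: G_iff)
  moreover have "\<forall>z\<in>branch (par p w1) w1. f' z = g z" "\<forall>z\<in>branch (par p w3) w3. f' z = z"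
    using f'(2) f1 f3 H_U by (auto simp: U_def H1_def H3_def)
  moreover have "(par p w1, w1) \<in> E" "(par p w3, w3) \<in> E" using par(1) wp by blast+
  ultimately show ?thesis by blast
qed

text \<open>The classical commutator trick: \<^term>\<open>f\<close> is the commutator of \<^term>\<open>h\<close> with the
  infinite product of the conjugates of \<open>f\<inverse>\<close> by the powers of \<^term>\<open>h\<close>, which converges since
  the translates of \<^term>\<open>D\<close> are disjoint.\<close>

lemma shift_commutator:
  assumes h: "h \<in> G" and f: "f \<in> G" and D: "D \<subseteq> B" "h ` B \<subseteq> B - D" "\<And>z. z \<notin> D \<Longrightarrow> f z = z"
  shows "\<exists>g\<in>G. f = h \<circ> g \<circ> inv_into UNIV h \<circ> inv_into UNIV g"
proof -
  define h' where "h' = inv_into UNIV h"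
  define f' where "f' = inv_into UNIV f"
  note inv_h = inv_Aut[OF G_Aut[OF h], folded h'_def] and inv_f = inv_Aut[OF G_Aut[OF f], folded f'_def]
  \<comment> \<open>The desired commutator identity amounts to
    \<open>g = f' \<circ> h \<circ> g \<circ> h'\<close>. Iterating the right-hand side from the
    identity produces the partial products.\<close>
  define \<gamma> where "\<gamma> n = ((\<lambda>g. f' \<circ> h \<circ> g \<circ> h') ^^ n) id" for n
  have \<gamma>_Suc: "\<gamma> (Suc n) x = f' (h (\<gamma> n (h' x)))" for n x by (simp add: \<gamma>_def)
  have \<gamma>_G: "\<gamma> n \<in> G" for n
  proof (induction n)
    case 0
    have "\<gamma> 0 = id" by (rule ext) (simp add: \<gamma>_def)
    then show ?case using id_G by metis
  next
    case (Suc n)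
    have "\<gamma> (Suc n) = f' \<circ> h \<circ> \<gamma> n \<circ> h'" by (auto simp: \<gamma>_Suc)
    moreover have "f' \<circ> h \<circ> \<gamma> n \<circ> h' \<in> G"
      unfolding f'_def h'_def by (intro comp_G inv_G f h Suc.IH)
    ultimately show ?case by metis
  qed
  have f'_fix: "f' z = z" if "z \<notin> D" for z using D(3)[OF that] inv_f(3)[of z] by simp
  \<comment> \<open>The new factor is a conjugate of \<open>f'\<close> by a power of
    \<open>h\<close>; it acts only on the corresponding translate of \<open>D\<close>.\<close>
  have step: "\<gamma> (Suc n) x = \<gamma> n x" if "x \<notin> (h ^^ n) ` D" for n x
    using that
  proof (induction n arbitrary: x)
    case 0
    have "\<gamma> (Suc 0) x = f' x" using \<gamma>_Suc[of 0 x] inv_h(2) by (simp add: \<gamma>_def)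
    then show ?case using 0 f'_fix by (simp add: \<gamma>_def)
  next
    case (Suc n)
    have "h' x \<notin> (h ^^ n) ` D"
    proof
      assume "h' x \<in> (h ^^ n) ` D"
      then obtain z where "z \<in> D" "h' x = (h ^^ n) z" by auto
      then have "x = (h ^^ Suc n) z" using inv_h(2)[of x] by simp
      then show False using Suc.prems \<open>z \<in> D\<close> by blast
    qed
    then have "\<gamma> (Suc n) (h' x) = \<gamma> n (h' x)" by (rule Suc.IH)
    then show ?case by (simp only: \<gamma>_Suc[of "Suc n"] \<gamma>_Suc[of n])
  qed
  have pow_B: "(h ^^ n) ` B \<subseteq> B" for n
  proof (induction n)
    case (Suc n)
    have "(h ^^ Suc n) ` B = h ` ((h ^^ n) ` B)" by (simp add: image_comp)
    then show ?case using Suc D(2) by blast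
  qed simp
  have inj: "inj (h ^^ n)" for n using h G_Aut by (auto simp: Aut_def bij_def intro: inj_fn)
  have "\<exists>K. \<forall>n\<ge>K. x \<notin> (h ^^ n) ` D" for x
  proof (cases "\<exists>k. x \<in> (h ^^ k) ` D")
    case True
    then obtain k z where z: "z \<in> D" "x = (h ^^ k) z" by auto
    have "x \<notin> (h ^^ n) ` D" if n: "n \<ge> Suc k" for n
    proof
      assume "x \<in> (h ^^ n) ` D"
      then obtain y where y: "y \<in> D" "x = (h ^^ n) y" by auto
      obtain j where j: "n = k + Suc j" using n by (metis add_Suc_right add_Suc le_Suc_ex)
      have "x = (h ^^ k) (h ((h ^^ j) y))" using y(2) by (simp add: j funpow_add funpow_swap1)
      then have "z = h ((h ^^ j) y)" using inj[of k] z(2) by (simp add: inj_eq)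
      moreover have "(h ^^ j) y \<in> B" using pow_B[of j] y(1) D(1) by blast
      ultimately show False using D(2) z(1) by blast
    qed
    then show ?thesis by blast
  qed blast
  then obtain K where K: "\<And>x n. K x \<le> n \<Longrightarrow> x \<notin> (h ^^ n) ` D" by metis
  define g where "g x = \<gamma> (K x) x" for x
  have g_eq: "\<gamma> n x = g x" if "K x \<le> n" for n x
    using that by (induction n rule: dec_induct) (use step K in \<open>auto simp: g_def\<close>)
  have "g \<in> G"
  proof (rule G_local)
    fix A :: "'v set" assume A: "finite A"
    \<comment> \<open>The sum serves as a common upper bound of the stabilisation indices on
      \<open>A\<close>.\<close>
    have "\<forall>x\<in>A. g x = \<gamma> (\<Sum>x\<in>A. K x) x"
      using g_eq A by (metis member_le_sum zero_le)
    then show "\<exists>\<gamma>\<in>G. \<forall>x\<in>A. g x = \<gamma> x" using \<gamma>_G by blast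
  qed
  have fg: "f (g x) = h (g (h' x))" for x
  proof -
    define n where "n = max (K x) (K (h' x))"
    have "g x = \<gamma> (Suc n) x" "g (h' x) = \<gamma> n (h' x)" using g_eq by (simp_all add: n_def)
    then show ?thesis using inv_f(2) by (simp add: \<gamma>_Suc)
  qed
  have "f x = (h \<circ> g \<circ> h' \<circ> inv_into UNIV g) x" for x
    using fg[of "inv_into UNIV g x"] inv_Aut(2)[OF G_Aut[OF \<open>g \<in> G\<close>], of x] by simp
  then show ?thesis using \<open>g \<in> G\<close> unfolding h'_def by blast
qed

text \<open>The subgroup gains elements in stages: those supported in one half-tree, then in any
  half-tree, then vertex stabilizers. These stabilizers generate enough to make \<open>N\<close>
  transitive on each type, and a transitive subgroup containing the stabilizers is
  everything.\<close>

lemma normal_subgroup_eq_G: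
  assumes N: "N \<subseteq> G" "id \<in> N" "\<And>a b. a \<in> N \<Longrightarrow> b \<in> N \<Longrightarrow> a \<circ> b \<in> N" "\<And>a. a \<in> N \<Longrightarrow> inv_into UNIV a \<in> N"
    and conj: "\<And>g a. g \<in> G \<Longrightarrow> a \<in> N \<Longrightarrow> g \<circ> a \<circ> inv_into UNIV g \<in> N"
    and nontriv: "N \<noteq> {id}"
  shows "N = G"
proof -
  obtain n where n: "n \<in> N" "n \<noteq> id" using nontriv N(2) by blast
  have nA: "n \<in> Aut E" using n N(1) G_Aut by blast
  have comm: "f \<in> N" if h: "h \<in> N" and f: "f \<in> G" and D: "D \<subseteq> B" "h ` B \<subseteq> B - D" "\<And>z. z \<notin> D \<Longrightarrow> f z = z"
    for h f D B
  proof -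
    obtain g where g: "g \<in> G" "f = h \<circ> g \<circ> inv_into UNIV h \<circ> inv_into UNIV g"
      using shift_commutator[OF _ f D] h N(1) by blast
    have "h \<circ> (g \<circ> inv_into UNIV h \<circ> inv_into UNIV g) \<in> N" using N(3,4) conj g(1) h by simp
    then show ?thesis using g(2) by (simp add: o_assoc)
  qed
  have one: "\<exists>x'. (x', y) \<in> E \<and> (\<forall>f\<in>G. (\<forall>z. z \<notin> branch y x' \<longrightarrow> f z = z) \<longrightarrow> f \<in> N)"
    if e: "(x, y) \<in> E" and moved: "n ` branch x y \<inter> branch x y = {}" for x y
  proof -
    obtain x1 x2 where x12: "x1 \<in> S y - {x}" "x2 \<in> S y - {x}" "x1 \<noteq> x2"
      using two_free[of y "{x}" x x] by blast
    have e1: "(y, x1) \<in> E" "(y, x2) \<in> E" "x \<noteq> x1" "x \<noteq> x2" using x12 by auto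
    obtain a where a: "a \<in> G" "a y = y" "a x = x1"
      using G_edge_transitive[OF sym_E[OF e] e1(1)] by blast
    have aA: "a \<in> Aut E" using a(1) by (rule G_Aut)
    define a' where "a' = inv_into UNIV a"
    note inv = inv_Aut[OF aA, folded a'_def]
    \<comment> \<open>The first \<open>n\<close> throws \<open>branch x y\<close> into
      \<open>branch y x\<close>, which lies in the \<open>a\<close>-image of
      \<open>branch x y\<close>. The conjugate of \<open>n\<close> by \<open>a\<close> then carries
      it into \<open>branch y x1\<close>. So \<open>h\<close> maps \<open>branch x y\<close> into
      itself and misses \<open>branch y x2\<close>, as \<open>comm\<close> requires.\<close>
    define h where "h = a \<circ> n \<circ> a' \<circ> n"
    have "h \<in> N" unfolding h_def using N(3) conj[OF a(1) n(1)] n(1) by (simp add: a'_def)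
    have nest: "branch y x2 \<subseteq> branch x y" "branch y x1 \<subseteq> branch x y" "branch y x \<subseteq> branch x1 y"
      using branch_nest[OF e e1(2)] branch_nest[OF e e1(1)] branch_nest[OF sym_E[OF e1(1)] sym_E[OF e]] e1 by auto
    have "h z \<in> branch x y - branch y x2" if z: "z \<in> branch x y" for z
    proof -
      have "n z \<in> branch y x" using moved z branch_compl[OF e, of "n z"] by blast
      then have "a (a' (n z)) \<in> branch (a x) (a y)" using nest(3) a inv(2) by auto
      then have "a' (n z) \<in> branch x y" unfolding Aut_branch[OF aA] .
      then have "n (a' (n z)) \<in> branch y x"
        using moved branch_compl[OF e, of "n (a' (n z))"] by blast
      then have "a (n (a' (n z))) \<in> branch (a y) (a x)" unfolding Aut_branch[OF aA] .
      then have "h z \<in> branch y x1" using a by (simp add: h_def)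
      then show ?thesis
        using nest(2) branch_disjoint[OF sym_E[OF e1(1)] sym_E[OF e1(2)] x12(3)] by blast
    qed
    then have "h ` branch x y \<subseteq> branch x y - branch y x2" by blast
    then have "f \<in> N" if "f \<in> G" "\<forall>z. z \<notin> branch y x2 \<longrightarrow> f z = z" for f
      using comm[OF \<open>h \<in> N\<close> that(1) nest(1)] that(2) by blast
    then show ?thesis using sym_E[OF e1(2)] by blast
  qed
  obtain v where v: "n v \<noteq> v" using n(2) by fastforce
  obtain y where y: "(v, y) \<in> E" "n ` branch v y \<inter> branch v y = {}"
    using moved_half_tree[OF nA v] by blast
  \<comment> \<open>Conjugation in the group preserves types, so one half-tree reaches only those
    whose removed endpoint has the same type. Adjacent \<open>y\<close> and \<open>y'\<close>
    provide both types.\<close>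
  obtain y' where y': "y' \<in> S y" "y' \<noteq> v" using two_free[of y "{v}" v v] by blast
  have e': "(y, y') \<in> E" using y'(1) by simp
  have "n ` branch y y' \<inter> branch y y' = {}" using y(2) branch_nest[OF y(1) e'] y'(2) by blast
  then obtain x1 x2 where x1: "(x1, y) \<in> E" "\<And>f. f \<in> G \<Longrightarrow> \<forall>z. z \<notin> branch y x1 \<longrightarrow> f z = z \<Longrightarrow> f \<in> N"
    and x2: "(x2, y') \<in> E" "\<And>f. f \<in> G \<Longrightarrow> \<forall>z. z \<notin> branch y' x2 \<longrightarrow> f z = z \<Longrightarrow> f \<in> N"
    using one[OF y] one[OF e'] by blast
  have half: "f \<in> N" if e: "(x, w) \<in> E" and f: "f \<in> G" "\<forall>z\<in>branch x w. f z = z" for f x w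
  proof -
    have "ty w = ty y \<or> ty w = ty y'"
      using ty_edge[OF e'] ty_01[of w] ty_01[of y] ty_01[of y'] by auto
    then obtain x0 y0 where y0: "(x0, y0) \<in> E" "ty y0 = ty w"
      "\<And>f. f \<in> G \<Longrightarrow> \<forall>z. z \<notin> branch y0 x0 \<longrightarrow> f z = z \<Longrightarrow> f \<in> N"
      using x1 x2 by metis
    obtain b where b: "b \<in> G" "b y0 = w" "b x0 = x"
      using G_edge_transitive[OF sym_E[OF y0(1)] sym_E[OF e]] y0(2) by blast
    note inv = inv_Aut[OF G_Aut[OF b(1)]]
    define f' where "f' = inv_into UNIV b \<circ> f \<circ> b"
    have "f' \<in> G" unfolding f'_def using comp_G inv_G b(1) f(1) by simp
    moreover have "f' z = z" if "z \<notin> branch y0 x0" for z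
    proof -
      have "b z \<notin> branch w x" using Aut_branch[OF G_Aut[OF b(1)], of z y0 x0] that b by simp
      then have "f (b z) = b z" using f(2) branch_compl[OF e] by blast
      then show ?thesis using inv(3) by (simp add: f'_def)
    qed
    ultimately have "f' \<in> N" using y0(3) by blast
    then have "b \<circ> f' \<circ> inv_into UNIV b \<in> N" using conj b(1) by blast
    moreover have "b \<circ> f' \<circ> inv_into UNIV b = f" using inv(2) by (auto simp: f'_def)
    ultimately show ?thesis by simp
  qed
  have stab: "g \<in> N" if g: "g \<in> G" "g p = p" for g p
  proof -
    obtain f x w x' w' where f: "f \<in> G" "(x, w) \<in> E" "(x', w') \<in> E" "\<forall>z\<in>branch x w. f z = g z"
      "\<forall>z\<in>branch x' w'. f z = z"
      using gluing[OF g] by blast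
    have fN: "f \<in> N" using half[OF f(3,1,5)] .
    note inv = inv_Aut[OF G_Aut[OF f(1)]]
    have "inv_into UNIV f \<circ> g \<in> N"
      by (rule half[OF f(2)]) (use comp_G inv_G f g inv(3) in \<open>auto simp flip: f(4)\<close>)
    then have "f \<circ> (inv_into UNIV f \<circ> g) \<in> N" using N(3) fN by blast
    moreover have "f \<circ> (inv_into UNIV f \<circ> g) = g" using inv(2) by auto
    ultimately show ?thesis by simp
  qed
  \<comment> \<open>Vertices of one type are reached two steps at a time: an element fixing the
    midpoint \<open>c\<close> moves \<open>b\<close> to \<open>w\<close>, and it lies in
    \<open>N\<close> by \<open>stab\<close>.\<close>
  have trans: "\<exists>\<nu>\<in>N. \<nu> p = w" if "ty w = ty p" for p w
    using that
  proof (induction "\<delta> p w" arbitrary: w rule: less_induct)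
    case (less w)
    show ?case
    proof (cases "w = p")
      case True then show ?thesis using N(2) by (intro bexI[of _ id]) simp_all
    next
      case False
      define c where "c = par p w"
      have c: "(c, w) \<in> E" "\<delta> p w = \<delta> p c + 1" using par[OF False] by (simp_all add: c_def)
      have "c \<noteq> p"
      proof
        assume "c = p"
        then have "ty p + ty p = 1" using ty_edge[OF c(1)] less.prems by simp
        then show False by presburger
      qed
      define b where "b = par p c"
      have b: "(b, c) \<in> E" "\<delta> p c = \<delta> p b + 1" using par[OF \<open>c \<noteq> p\<close>] by (simp_all add: b_def)
      have "ty b = ty p" using ty_edge[OF c(1)] ty_edge[OF b(1)] less.prems by simp
      then obtain \<nu> where \<nu>: "\<nu> \<in> N" "\<nu> p = b" using less.hyps[of b] b c by auto
      obtain g where g: "g \<in> G" "g c = c" "g b = w"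
        using G_edge_transitive[OF sym_E[OF b(1)] c(1)] by blast
      have "g \<circ> \<nu> \<in> N" using N(3) stab[OF g(1,2)] \<nu>(1) by blast
      then show ?thesis using g(3) \<nu>(2) by (intro bexI[of _ "g \<circ> \<nu>"]) simp_all
    qed
  qed
  have "g \<in> N" if g: "g \<in> G" for g
  proof -
    obtain \<nu> where \<nu>: "\<nu> \<in> N" "\<nu> y = g y" using trans[of "g y" y] G_ty[OF g] by blast
    have "\<nu> \<in> G" using \<nu>(1) N(1) by blast
    note inv = inv_Aut[OF G_Aut[OF this]]
    have "inv_into UNIV \<nu> \<circ> g \<in> N"
      by (rule stab[of _ y]) (use comp_G inv_G \<open>\<nu> \<in> G\<close> g inv(3) in \<open>auto simp flip: \<nu>(2)\<close>)
    then have "\<nu> \<circ> (inv_into UNIV \<nu> \<circ> g) \<in> N" using N(3) \<nu>(1) by blast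
    moreover have "\<nu> \<circ> (inv_into UNIV \<nu> \<circ> g) = g" using inv(2) by auto
    ultimately show ?thesis by simp
  qed
  then show ?thesis using N(1) by blast
qed

lemma G_nontrivial: "G \<noteq> {id}"
proof -
  fix v
  obtain a b where ab: "a \<in> S v" "b \<in> S v" "a \<noteq> b" using two_free[of v "{}" v v] by blast
  obtain g where "g \<in> G" "g v = v" "g a = b" using G_edge_transitive[of v a v b] ab by auto
  then have "g \<in> G" "g \<noteq> id" using ab(3) by auto
  then show ?thesis by blast
qed

lemma G_simple: "abstractly_simple (comp_group G)"
proof -
  note grp = group_comp_group[OF subgroup_G]
  have "N = {id} \<or> N = G" if N: "N \<lhd> comp_group G" for N
  proof -
    interpret N: normal N "comp_group G" by (rule N)
    have NG: "N \<subseteq> G" using N.subset by simp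
    have "N = G" if "N \<noteq> {id}"
    proof (rule normal_subgroup_eq_G[OF NG])
      show "inv_into UNIV a \<in> N" if "a \<in> N" for a
        using N.m_inv_closed[OF that] grp(2)[OF subsetD[OF NG that]] by simp
      show "g \<circ> a \<circ> inv_into UNIV g \<in> N" if "g \<in> G" "a \<in> N" for g a
        using N.inv_op_closed2[of g a] grp(2)[of g] that by simp
    qed (use subgroup.one_closed[OF N.subgroup_axioms] subgroup.m_closed[OF N.subgroup_axioms] that in simp_all)
    then show ?thesis by blast
  qed
  then show ?thesis using grp(1) G_nontrivial by (simp add: abstractly_simple_def)
qed

subsection \<open>The normalizer\<close>

lemma normalizer_comp_group:
  assumes A: "subgroup A (comp_group (Aut E))" and G: "G \<subseteq> A"
  shows "normalizer (comp_group A) G = {g \<in> A. (\<lambda>h. g \<circ> h \<circ> inv_into UNIV g) ` G = G}"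
    and "group (comp_group (normalizer (comp_group A) G))"
proof -
  note grp = group_comp_group[OF A]
  have "g <#\<^bsub>comp_group A\<^esub> G #>\<^bsub>comp_group A\<^esub> (inv\<^bsub>comp_group A\<^esub> g) = (\<lambda>h. g \<circ> h \<circ> inv_into UNIV g) ` G"
    if "g \<in> A" for g
    unfolding l_coset_def r_coset_def grp(2)[OF that] by auto
  then show "normalizer (comp_group A) G = {g \<in> A. (\<lambda>h. g \<circ> h \<circ> inv_into UNIV g) ` G = G}"
    using G unfolding normalizer_def stabilizer_def by auto
  have "subgroup (normalizer (comp_group A) G) (comp_group A)"
    using group.normalizer_imp_subgroup[OF grp(1)] G by simp
  from subgroup.subgroup_is_group[OF this grp(1)]
  show "group (comp_group (normalizer (comp_group A) G))" by (simp add: comp_group_def)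
qed

definition const_sphere_sign :: "('v \<Rightarrow> 'v) \<Rightarrow> bool" where
  "const_sphere_sign g \<longleftrightarrow> (\<forall>t\<in>{0, 1}. \<forall>u v. center t u \<longrightarrow> center t v \<longrightarrow> sphere_sign t g u = sphere_sign t g v)"

lemma const_sphere_signD: "const_sphere_sign g \<Longrightarrow> t \<in> {0, 1} \<Longrightarrow> center t u \<Longrightarrow> center t v \<Longrightarrow> sphere_sign t g u = sphere_sign t g v"
  unfolding const_sphere_sign_def by blast

text \<open>The two cases of the theorem differ in whether \<^term>\<open>g\<close> preserves the types; in the second
  one it may exchange the two families of equations, which have the same form.\<close>

definition permutes_eqs :: "('v \<Rightarrow> 'v) \<Rightarrow> bool" where
  "permutes_eqs g \<longleftrightarrow> (\<forall>t\<in>{0, 1}. \<forall>v. center t v \<longrightarrow> (\<exists>t'\<in>{0, 1}. center t' (g v) \<and> sphere_sign t' = sphere_sign t))"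

text \<open>At \<open>g v\<close> the product of the conjugate is that of \<open>h\<close> at
  \<open>v\<close>, which is 1, times the products of \<open>g\<close> at \<open>h v\<close> and at
  \<open>v\<close>. These two centers have the same type, so the latter products cancel.\<close>

lemma conj_subset:
  assumes g: "g \<in> Aut E"
    "const_sphere_sign g" and perm: "permutes_eqs (inv_into UNIV g)" and h: "h \<in> G"
  shows "g \<circ> h \<circ> inv_into UNIV g \<in> G"
proof -
  define k where "k = g \<circ> h \<circ> inv_into UNIV g"
  note inv = inv_Aut[OF g(1)] and hA = G_Aut[OF h]
  have "k \<in> Aut E" unfolding k_def using comp_Aut g(1) hA inv(1) by blast
  moreover have "ty (k w) = ty w" for w
  proof -
    have "ty (g (h (inv_into UNIV g w))) = ty (g (inv_into UNIV g w))"
      unfolding Aut_same_type[OF g(1)] by (rule G_ty[OF h])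
    then show ?thesis using inv(2) by (simp add: k_def)
  qed
  moreover have "sphere_sign t k w = 1" if t: "t \<in> {0, 1}" "center t w" for t w
  proof -
    define v where "v = inv_into UNIV g w"
    have w: "w = g v" using inv(2) by (simp add: v_def)
    obtain t' where t': "t' \<in> {0, 1}" "center t' v" "sphere_sign t' = sphere_sign t"
      using perm t unfolding permutes_eqs_def v_def by blast
    have "center t' (h v)" using t'(2) G_ty[OF h] by simp
    then have "sphere_sign t' g (h v) = sphere_sign t' g v"
      using const_sphere_signD[OF g(2) t'(1)] t'(2) by blast
    moreover have "sphere_sign t' h v = 1" by (rule G_sphere_sign[OF h t'(1,2)])
    ultimately have "sphere_sign t' k w = 1"
      unfolding k_def w sphere_sign_conj[OF g(1) hA] by (simp add: sphere_sign_square)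
    then show ?thesis by (simp add: t'(3))
  qed
  ultimately show ?thesis by (simp add: G_iff k_def)
qed

lemma const_sphere_sign_inv:
  assumes g: "g \<in> Aut E" "const_sphere_sign g" and perm: "permutes_eqs (inv_into UNIV g)"
  shows "const_sphere_sign (inv_into UNIV g)"
  unfolding const_sphere_sign_def
proof (intro ballI allI impI)
  fix t u v assume t: "t \<in> {0, 1}" "center t u" "center t v"
  define g' where "g' = inv_into UNIV g"
  note inv = inv_Aut[OF g(1), folded g'_def]
  obtain t' where t': "t' \<in> {0, 1}" "center t' (g' u)" "sphere_sign t' = sphere_sign t"
    using perm t(1,2) unfolding permutes_eqs_def g'_def by blast
  have "ty (g' u) = ty (g' v)" unfolding Aut_same_type[OF inv(1)] using t(2,3) by simp
  then have "sphere_sign t' g (g' u) = sphere_sign t' g (g' v)"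
    using const_sphere_signD[OF g(2) t'(1,2)] t'(2) by simp
  moreover have "sphere_sign t' g' x = sphere_sign t' g (g' x)" for x
    using sphere_sign_inv[OF g(1), of t' "g' x"] inv(2)[of x] by (simp add: g'_def)
  ultimately have "sphere_sign t' g' u = sphere_sign t' g' v" by simp
  then show "sphere_sign t (inv_into UNIV g) u = sphere_sign t (inv_into UNIV g) v"
    by (simp add: t'(3) g'_def)
qed

text \<open>For the forward direction, some \<open>h\<close> in the group carries any center to any
  other of the same type. The equation for the conjugate of \<open>h\<close> then equates the
  products of \<open>g\<close> at the two centers.\<close>

lemma normalizes_iff:
  assumes g: "g \<in> Aut E" and perm: "permutes_eqs g" "permutes_eqs (inv_into UNIV g)"
  shows "(\<lambda>h. g \<circ> h \<circ> inv_into UNIV g) ` G = G \<longleftrightarrow> const_sphere_sign g"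
proof
  assume eq: "(\<lambda>h. g \<circ> h \<circ> inv_into UNIV g) ` G = G"
  show "const_sphere_sign g"
    unfolding const_sphere_sign_def
  proof (intro ballI allI impI)
    fix t u v assume t: "t \<in> {0, 1}" "center t u" "center t v"
    obtain h where h: "h \<in> G" "h v = u" using same_type_transitive[of v u] t(2,3) by auto
    have k: "g \<circ> h \<circ> inv_into UNIV g \<in> G" using eq h(1) by blast
    obtain t' where t': "t' \<in> {0, 1}" "center t' (g v)" "sphere_sign t' = sphere_sign t"
      using perm(1) t(1,3) unfolding permutes_eqs_def by blast
    have "sphere_sign t (g \<circ> h \<circ> inv_into UNIV g) (g v) = 1"
      using G_sphere_sign[OF k t'(1,2)] by (simp add: t'(3))
    then have "sphere_sign t g u * sphere_sign t g v = 1"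
      unfolding sphere_sign_conj[OF g G_Aut[OF h(1)]]
        using G_sphere_sign[OF h(1) t(1,3)] h(2) by simp
    then show "sphere_sign t g u = sphere_sign t g v"
      using sphere_sign_pm[of t g u] sphere_sign_pm[of t g v] by auto
  qed
next
  assume c: "const_sphere_sign g"
  note inv = inv_Aut[OF g]
  have inv_inv: "inv_into UNIV (inv_into UNIV g) = g"
    using g by (simp add: Aut_def inv_inv_eq)
  have "h \<in> (\<lambda>h. g \<circ> h \<circ> inv_into UNIV g) ` G" if h: "h \<in> G" for h
  proof
    show "inv_into UNIV g \<circ> h \<circ> g \<in> G"
      using conj_subset[OF inv(1) const_sphere_sign_inv[OF g c perm(2)] _ h] perm(1)
        by (simp add: inv_inv)
    show "h = g \<circ> (inv_into UNIV g \<circ> h \<circ> g) \<circ> inv_into UNIV g" using inv(2) by auto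
  qed
  then show "(\<lambda>h. g \<circ> h \<circ> inv_into UNIV g) ` G = G"
    using conj_subset[OF g c perm(2)] by blast
qed

lemma G_subset_Aut_plus: "G \<subseteq> Aut_plus E V"
  by (auto simp: Aut_plus_iff G_Aut G_ty)

lemma normalizer_Aut_plus:
  "normalizer (comp_group (Aut_plus E V)) G = {g \<in> Aut_plus E V. const_sphere_sign g}"
proof -
  have perm: "permutes_eqs g" if "g \<in> Aut_plus E V" for g
    using that unfolding permutes_eqs_def by (auto simp: Aut_plus_iff)
  have "(\<lambda>h. g \<circ> h \<circ> inv_into UNIV g) ` G = G \<longleftrightarrow> const_sphere_sign g" if g: "g \<in> Aut_plus E V" for g
  proof (rule normalizes_iff)
    show A: "g \<in> Aut E" using g by (simp add: Aut_plus_iff)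
    show "permutes_eqs (inv_into UNIV g)"
      using subgroup.m_inv_closed[OF subgroup_Aut_plus g] inv_comp_Aut[OF A] perm by simp
  qed (rule perm[OF g])
  then show ?thesis
    unfolding normalizer_comp_group(1)[OF subgroup_Aut_plus G_subset_Aut_plus] by auto
qed

lemma center_ex: "\<exists>v. center t v"
  by (rule ty_ex) auto

lemma normalizer_quotient:
  "comp_group (normalizer (comp_group (Aut_plus E V)) G) Mod G
    \<cong> product_group {..<card {t \<in> {0, 1}. Y t \<noteq> {}}} (\<lambda>_. integer_mod_group 2)"
proof -
  define K where "K = {t \<in> {0, 1}. Y t \<noteq> {}}"
  define N where "N = normalizer (comp_group (Aut_plus E V)) G"
  define P where "P = product_group {..<card K} (\<lambda>_. integer_mod_group 2)"
  have N_iff: "g \<in> N \<longleftrightarrow> g \<in> Aut E \<and> (\<forall>v. ty (g v) = ty v) \<and> const_sphere_sign g" for g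
    unfolding N_def normalizer_Aut_plus by (simp add: Aut_plus_iff)
  have K: "finite K" "t \<in> K \<Longrightarrow> t \<in> {0, 1}" "t \<in> K \<Longrightarrow> Y t \<noteq> {}" for t by (auto simp: K_def)
  \<comment> \<open>The target group has numbers as coordinates, so the nonempty families are
    enumerated. An empty family has product 1 everywhere and contributes no coordinate.\<close>
  obtain e where e: "bij_betw e {..<card K} K"
    using ex_bij_betw_nat_finite[OF K(1)] by (auto simp: lessThan_atLeast0)
  obtain c where c: "\<And>t. center t (c t)" using center_ex by metis
  define bit :: "int \<Rightarrow> int" where "bit x = (if x = 1 then 0 else 1)" for x
  define \<phi> where "\<phi> g = (\<lambda>j\<in>{..<card K}. bit (sphere_sign (e j) g (c (e j))))" for g
  have grpN: "group (comp_group N)"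
    unfolding N_def by (rule normalizer_comp_group(2)[OF subgroup_Aut_plus G_subset_Aut_plus])
  have grpP: "group P" by (simp add: P_def)
  have eK: "e j \<in> K" if "j < card K" for j using bij_betwE[OF e] that by auto
  have "\<phi> \<in> hom (comp_group N) P"
  proof (rule homI)
    show "\<phi> g \<in> carrier P" for g by (auto simp: P_def \<phi>_def bit_def carrier_integer_mod_group)
    fix g h assume "g \<in> carrier (comp_group N)" "h \<in> carrier (comp_group N)"
    then have gh: "g \<in> N" "h \<in> N" by simp_all
    have "bit (sphere_sign t (g \<circ> h) (c t)) = (bit (sphere_sign t g (c t)) + bit (sphere_sign t h (c t))) mod 2"
      if "t \<in> K" for t
    proof -
      have "center t (h (c t))" using c[of t] gh(2) N_iff by simp
      then have "sphere_sign t g (h (c t)) = sphere_sign t g (c t)"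
        using const_sphere_signD[of g t] K(2)[OF that] c[of t] gh(1) N_iff by blast
      then have "sphere_sign t (g \<circ> h) (c t) = sphere_sign t g (c t) * sphere_sign t h (c t)"
        using sphere_sign_comp gh N_iff by simp
      then show ?thesis
        using sphere_sign_pm[of t g "c t"] sphere_sign_pm[of t h "c t"] by (auto simp: bit_def)
    qed
    then show "\<phi> (g \<otimes>\<^bsub>comp_group N\<^esub> h) = \<phi> g \<otimes>\<^bsub>P\<^esub> \<phi> h"
      using eK by (auto simp: P_def \<phi>_def fun_eq_iff restrict_def)
  qed
  then interpret \<phi>: group_hom "comp_group N" P \<phi>
    using grpN grpP by (simp add: group_hom_def group_hom_axioms_def)
  have ker: "kernel (comp_group N) P \<phi> = G"
  proof -
    have "g \<in> G \<longleftrightarrow> g \<in> N \<and> \<phi> g = \<one>\<^bsub>P\<^esub>" for g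
    proof
      assume g: "g \<in> G"
      have "const_sphere_sign g" unfolding const_sphere_sign_def using G_sphere_sign[OF g] by simp
      then have "g \<in> N" using g by (simp add: N_iff G_Aut G_ty)
      moreover have "sphere_sign (e j) g (c (e j)) = 1" if "j < card K" for j
        using G_sphere_sign[OF g K(2)[OF eK[OF that]] c] .
      then have "\<phi> g = \<one>\<^bsub>P\<^esub>" by (auto simp: P_def \<phi>_def bit_def fun_eq_iff restrict_def)
      ultimately show "g \<in> N \<and> \<phi> g = \<one>\<^bsub>P\<^esub>" ..
    next
      assume g: "g \<in> N \<and> \<phi> g = \<one>\<^bsub>P\<^esub>"
      have "sphere_sign t g v = 1" if t: "t \<in> {0, 1}" "center t v" for t v
      proof (cases "Y t = {}")
        case True then show ?thesis by (rule sphere_sign_empty)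
      next
        case False
        then have "t \<in> K" using t(1) by (simp add: K_def)
        then obtain j where j: "j < card K" "t = e j" using bij_betw_imp_surj_on[OF e] by auto
        have "\<phi> g j = \<one>\<^bsub>P\<^esub> j" using g by simp
        moreover have "\<phi> g j = bit (sphere_sign t g (c t))" using j by (simp add: \<phi>_def)
        moreover have "\<one>\<^bsub>P\<^esub> j = 0" using j(1) by (simp add: P_def)
        ultimately have "sphere_sign t g (c t) = 1" by (simp add: bit_def split: if_splits)
        moreover have "const_sphere_sign g" using g N_iff by metis
        then have "sphere_sign t g v = sphere_sign t g (c t)" by (rule const_sphere_signD[OF _ t c])
        ultimately show ?thesis by simp
      qed
      then show "g \<in> G" using g N_iff by (simp add: G_iff)
    qed
    then show ?thesis by (auto simp: kernel_def)
  qed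
  have "\<exists>g\<in>N. \<phi> g = x" if x: "x \<in> carrier P" for x
  proof -
    \<comment> \<open>The signs decoded from \<open>x\<close>; coordinate 1 stands for the sign
      -1.\<close>
    define b where "b t = (if t \<in> K \<and> x (inv_into {..<card K} e t) = 1 then -1 else 1 :: int)" for t
    have pm: "b t \<in> {1, -1}" for t by (simp add: b_def)
    fix p
    obtain g where g: "g \<in> Aut E" "g p = p"
      "\<And>t v. t \<in> {0, 1} \<Longrightarrow> Y t \<noteq> {} \<Longrightarrow> center t v \<Longrightarrow> sphere_sign t g v = b t"
      using prescribed_sphere_sign[where b = b and p = p and q = p, OF pm] by blast
    have "const_sphere_sign g"
      unfolding const_sphere_sign_def using g(3) sphere_sign_empty by metis
    moreover have "ty (g v) = ty v" for v using type_preserving[OF g(1), of p] g(2) by simp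
    ultimately have "g \<in> N" using g(1) by (simp add: N_iff)
    moreover have "\<phi> g = x"
    proof
      fix j
      show "\<phi> g j = x j"
      proof (cases "j < card K")
        case True
        have "sphere_sign (e j) g (c (e j)) = b (e j)" using g(3) K(2,3)[OF eK[OF True]] c by blast
        moreover have "inv_into {..<card K} e (e j) = j"
          using inv_into_f_f[OF bij_betw_imp_inj_on[OF e], of j] True by simp
        moreover have "x j \<in> {0..<2}"
          using x True by (auto simp: P_def carrier_integer_mod_group PiE_iff)
        then have "x j = 0 \<or> x j = 1" by auto
        ultimately show ?thesis using True eK[OF True] by (auto simp: \<phi>_def b_def bit_def)
      next
        case False
        then show ?thesis using x by (simp add: \<phi>_def P_def PiE_iff extensional_def)
      qed
    qed
    ultimately show ?thesis by blast
  qed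
  then have "\<phi> ` carrier (comp_group N) = carrier P" using \<phi>.hom_closed by auto
  from \<phi>.FactGroup_iso[OF this] show ?thesis unfolding ker unfolding N_def P_def K_def .
qed

text \<open>An element is recorded by whether it exchanges the types and by its two signs, at
  vertices of type 0 and of type 1. Composing with a type-exchanging element on the right swaps the
  signs, which is the wreath product law.\<close>

lemma normalizer_quotient_dihedral:
  assumes d: "d 0 = d 1" and Y: "Y 0 = Y 1" "Y 0 \<noteq> {}"
  shows "comp_group (normalizer (comp_group (Aut E)) G) Mod G \<cong> dihedral_group 4"
proof -
  define N where "N = normalizer (comp_group (Aut E)) G"
  have sphere_sign01: "sphere_sign 1 = sphere_sign 0"
    using Y(1) by (auto simp: sphere_sign_def fun_eq_iff)
  have some_center: "\<exists>t\<in>{0, 1}. center t v" for v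
  proof -
    \<comment> \<open>Both families have the same outer radius, so their centers have opposite types
      and every vertex is a center of exactly one family.\<close>
    have "(0 + m 0) mod 2 = 0 \<and> (1 + m 1) mod 2 = 1 \<or> (0 + m 0) mod 2 = 1 \<and> (1 + m 1) mod 2 = 0"
      unfolding Y(1)[symmetric] by (cases "even (m 0)") (auto elim!: evenE oddE)
    then show ?thesis using ty_01[of v] by auto
  qed
  have perm: "permutes_eqs g" for g
    unfolding permutes_eqs_def using some_center sphere_sign01 by force
  have "(\<lambda>h. g \<circ> h \<circ> inv_into UNIV g) ` G = G \<longleftrightarrow> const_sphere_sign g" if "g \<in> Aut E" for g
    using normalizes_iff[OF that perm perm] .
  moreover have sub: "G \<subseteq> Aut E" using G_Aut by blast
  ultimately have N_iff: "g \<in> N \<longleftrightarrow> g \<in> Aut E \<and> const_sphere_sign g" for g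
    unfolding N_def normalizer_comp_group(1)[OF subgroup_Aut sub] by blast
  have grpN: "group (comp_group N)"
    unfolding N_def by (rule normalizer_comp_group(2)[OF subgroup_Aut sub])
  have const: "const_sphere_sign g \<longleftrightarrow> (\<forall>u v. ty u = ty v \<longrightarrow> sphere_sign 0 g u = sphere_sign 0 g v)"
    for g
  proof
    assume g: "const_sphere_sign g"
    show "\<forall>u v. ty u = ty v \<longrightarrow> sphere_sign 0 g u = sphere_sign 0 g v"
    proof (intro allI impI)
      fix u v assume uv: "ty u = ty v"
      obtain t where "t \<in> {0, 1}" "center t u" using some_center by blast
      moreover from this have "sphere_sign t = sphere_sign 0" using sphere_sign01 by auto
      ultimately show "sphere_sign 0 g u = sphere_sign 0 g v"
        using const_sphere_signD[OF g, of t u v] uv by simp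
    qed
  next
    assume g: "\<forall>u v. ty u = ty v \<longrightarrow> sphere_sign 0 g u = sphere_sign 0 g v"
    show "const_sphere_sign g" unfolding const_sphere_sign_def using g sphere_sign01 by auto
  qed
  obtain a0 a1 where a: "ty a0 = 0" "ty a1 = 1" using ty_ex[of 0] ty_ex[of 1] by auto
  have sphere_sign_a: "sphere_sign 0 g v = sphere_sign 0 g (if ty v = 0 then a0 else a1)"
    if "g \<in> N" for g v
  proof -
    have "ty v = ty (if ty v = 0 then a0 else a1)" using a ty_01[of v] by auto
    then show ?thesis using that N_iff const by blast
  qed
  \<comment> \<open>Writing \<open>r\<close> for a type-exchanging element with signs \<open>(1, -1)\<close> and \<open>f\<close> for one with signs
    \<open>(1, 1)\<close>, the triple \<open>(s, x, y)\<close> is that of \<open>r\<^sup>a f\<^sup>b\<close> with \<open>(a, b) = D s x y\<close>.\<close>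
  define D :: "bool \<Rightarrow> bool \<Rightarrow> bool \<Rightarrow> int \<times> bool" where
    "D s x y = (if x = y then (if x then 2 else 0) else (if s = x then 3 else 1), s \<noteq> (x \<noteq> y))"
      for s x y
  \<comment> \<open>On the left is the cocycle rule for a composition: the right factor acts first,
    so it decides at which type the signs of the left factor are read off.\<close>
  have D_mult: "D (s \<noteq> s') ((if s' then y else x) \<noteq> x') ((if s' then x else y) \<noteq> y')
      = D s x y \<otimes>\<^bsub>dihedral_group 4\<^esub> D s' x' y'" for s x y s' x' y'
    by (cases s; cases x; cases y; cases s'; cases x'; cases y') (simp_all add: D_def dihedral_group_def)
  have D_one: "D s x y = \<one>\<^bsub>dihedral_group 4\<^esub> \<longleftrightarrow> \<not> s \<and> \<not> x \<and> \<not> y" for s x y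
    by (cases s; cases x; cases y) (simp_all add: D_def dihedral_group_def)
  have D_closed: "D s x y \<in> carrier (dihedral_group 4)" for s x y
    by (cases s; cases x; cases y) (simp_all add: D_def dihedral_group_def)
  have D_surj: "\<exists>s x y. D s x y = k" if "k \<in> carrier (dihedral_group 4)" for k
  proof -
    obtain r b where k: "k = (r, b)" by (cases k)
    then have "r \<in> {0..<4}" using that by (simp add: dihedral_group_def)
    then have "r = 0 \<or> r = 1 \<or> r = 2 \<or> r = 3" by auto
    then have "k \<in> {D False False False, D True False False, D True False True, D False True False,
        D False True True, D True True True, D True True False, D False False True}"
      unfolding k D_def by (cases b) auto
    then show ?thesis by blast
  qed
  define \<phi> where "\<phi> g = D (ty (g a0) \<noteq> 0) (sphere_sign 0 g a0 = -1) (sphere_sign 0 g a1 = -1)" for g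
  have ty_g: "ty (g v) = (if ty (g a0) \<noteq> 0 then 1 - ty v else ty v)" if "g \<in> Aut E" for g v
    using Aut_same_type[OF that, of v a0] a ty_01[of v] ty_01[of "g v"] ty_01[of "g a0"] by auto
  have "\<phi> \<in> hom (comp_group N) (dihedral_group 4)"
  proof (rule homI)
    show "\<phi> g \<in> carrier (dihedral_group 4)" for g by (simp add: \<phi>_def D_closed)
    fix g h assume "g \<in> carrier (comp_group N)" "h \<in> carrier (comp_group N)"
    then have gh: "g \<in> N" "h \<in> N" "g \<in> Aut E" "h \<in> Aut E" using N_iff by simp_all
    have p: "sphere_sign 0 (g \<circ> h) v = sphere_sign 0 g (if ty (h v) = 0 then a0 else a1) * sphere_sign 0 h v"
      for v
      using sphere_sign_comp[OF gh(3,4)] sphere_sign_a[OF gh(1), of "h v"] by simp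
    have neg: "x * y = -1 \<longleftrightarrow> (x = -1) \<noteq> (y = -1)" if "x \<in> {1, -1}" "y \<in> {1, -1}" for x y :: int
      using that by auto
    have "(sphere_sign 0 (g \<circ> h) a0 = -1) = ((if ty (h a0) \<noteq> 0 then sphere_sign 0 g a1 = -1 else sphere_sign 0 g a0 = -1) \<noteq> (sphere_sign 0 h a0 = -1))"
      unfolding p neg[OF sphere_sign_pm sphere_sign_pm] by simp
    moreover have "(sphere_sign 0 (g \<circ> h) a1 = -1) = ((if ty (h a0) \<noteq> 0 then sphere_sign 0 g a0 = -1 else sphere_sign 0 g a1 = -1) \<noteq> (sphere_sign 0 h a1 = -1))"
      unfolding p neg[OF sphere_sign_pm sphere_sign_pm] using ty_g[OF gh(4), of a1] a by simp
    moreover have "(ty ((g \<circ> h) a0) \<noteq> 0) = ((ty (g a0) \<noteq> 0) \<noteq> (ty (h a0) \<noteq> 0))"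
      using ty_g[OF gh(3), of "h a0"] ty_01[of "h a0"] by auto
    ultimately have "\<phi> (g \<circ> h) = \<phi> g \<otimes>\<^bsub>dihedral_group 4\<^esub> \<phi> h"
      unfolding \<phi>_def D_mult[symmetric] by (simp only:)
    then show "\<phi> (g \<otimes>\<^bsub>comp_group N\<^esub> h) = \<phi> g \<otimes>\<^bsub>dihedral_group 4\<^esub> \<phi> h" by simp
  qed
  then interpret \<phi>: group_hom "comp_group N" "dihedral_group 4" \<phi>
    using grpN group_dihedral_group[of 4] by (simp add: group_hom_def group_hom_axioms_def)
  have ker: "kernel (comp_group N) (dihedral_group 4) \<phi> = G"
  proof -
    have "g \<in> G \<longleftrightarrow> g \<in> N \<and> \<phi> g = \<one>\<^bsub>dihedral_group 4\<^esub>" for g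
    proof
      assume g: "g \<in> G"
      have "sphere_sign 0 g v = 1" for v
      proof -
        obtain t where t: "t \<in> {0, 1}" "center t v" using some_center by blast
        have "sphere_sign t g v = 1" by (rule G_sphere_sign[OF g t])
        then show ?thesis using t(1) sphere_sign01 by auto
      qed
      then show "g \<in> N \<and> \<phi> g = \<one>\<^bsub>dihedral_group 4\<^esub>"
        using G_Aut[OF g] G_ty[OF g] a by (simp add: N_iff const \<phi>_def D_one)
    next
      assume g: "g \<in> N \<and> \<phi> g = \<one>\<^bsub>dihedral_group 4\<^esub>"
      then have gN: "g \<in> N" "g \<in> Aut E" using N_iff by auto
      have z: "ty (g a0) = 0" "sphere_sign 0 g a0 \<noteq> -1" "sphere_sign 0 g a1 \<noteq> -1"
        using g by (auto simp: \<phi>_def D_one)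
      have "sphere_sign 0 g v = 1" for v
        using sphere_sign_a[OF gN(1), of v] z sphere_sign_pm[of 0 g a0] sphere_sign_pm[of 0 g a1] by auto
      moreover have "ty (g v) = ty v" for v using ty_g[OF gN(2), of v] z(1) by simp
      ultimately show "g \<in> G" using gN(2) sphere_sign01 by (simp add: G_iff)
    qed
    then show ?thesis by (auto simp: kernel_def)
  qed
  have "\<exists>g\<in>N. \<phi> g = D s x y" for s x y
  proof -
    define sn where "sn u = (if u then -1 else 1 :: int)" for u
    \<comment> \<open>Which family has its centers at type 0 depends on the parity of the outer
      radius, so \<open>x\<close> and \<open>y\<close> are assigned by the type of the
      center.\<close>
    define b where "b t = (if (t + m t) mod 2 = 0 then sn x else sn y)" for t
    have pm: "b t \<in> {1, -1}" for t by (simp add: b_def sn_def)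
    obtain q where q: "ty q = (if s then 1 else 0)" using a by (metis (full_types))
    obtain g where g: "g \<in> Aut E" "g a0 = q"
      "\<And>t v. t \<in> {0, 1} \<Longrightarrow> Y t \<noteq> {} \<Longrightarrow> center t v \<Longrightarrow> sphere_sign t g v = b t"
      using prescribed_sphere_sign[where b = b and p = a0 and q = q, OF pm] d by blast
    have sphere_sign: "sphere_sign 0 g v = (if ty v = 0 then sn x else sn y)" for v
    proof -
      obtain t where t: "t \<in> {0, 1}" "center t v" using some_center by blast
      then have "sphere_sign t g v = b t" using g(3)[of t v] Y by auto
      moreover have "sphere_sign t = sphere_sign 0" using t(1) sphere_sign01 by auto
      ultimately show ?thesis using t(2) by (simp add: b_def)
    qed
    have "const_sphere_sign g" unfolding const by (simp add: sphere_sign)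
    then have "g \<in> N" using g(1) by (simp add: N_iff)
    moreover have "\<phi> g = D s x y" using a g(2) q by (simp add: \<phi>_def sphere_sign sn_def)
    ultimately show ?thesis by blast
  qed
  then have "k \<in> \<phi> ` N" if "k \<in> carrier (dihedral_group 4)" for k
    using D_surj[OF that] by (metis imageI)
  then have "\<phi> ` carrier (comp_group N) = carrier (dihedral_group 4)" using \<phi>.hom_closed by auto
  from \<phi>.FactGroup_iso[OF this] show ?thesis unfolding ker unfolding N_def .
qed

end

theorem theorem1:
  fixes E :: "('v \<times> 'v) set" and V :: "nat \<Rightarrow> 'v set" and d :: "nat \<Rightarrow> nat"
    and i :: "'v \<Rightarrow> nat" and Y :: "nat \<Rightarrow> nat set"
  assumes "semiregular_tree E V d"
    and "d 0 \<ge> 4" and "d 1 \<ge> 4"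
    and "legal_coloring E V d i"
    and "finite (Y 0)" and "finite (Y 1)"
  shows "let G = G_plus E V i (Y 0) (Y 1) in
      G \<in> HT_plus E V
    \<and> abstractly_simple (comp_group G)
    \<and> comp_group (normalizer (comp_group (Aut_plus E V)) G) Mod G
        \<cong> product_group {..<card {t \<in> {0, 1}. Y t \<noteq> {}}} (\<lambda>_. integer_mod_group 2)
    \<and> (d 0 = d 1 \<and> Y 0 = Y 1 \<and> Y 0 \<noteq> {} \<longrightarrow>
        comp_group (normalizer (comp_group (Aut E)) G) Mod G \<cong> dihedral_group 4)"
proof -
  interpret semiregular_tree E V d by (rule assms(1))
  interpret sign_tree E V d i Y by unfold_locales (fact assms)+
  show ?thesis
    unfolding Let_def G_def[symmetric]
    using G_HT_plus G_simple normalizer_quotient normalizer_quotient_dihedral by blast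
qed

end
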